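(* Let $b,\sigma$ be uniformly Lipschitz continuous in $(t,x)\in[0,T]\times\mathbb R^d$; let $f$ satisfy $|f(t_2,x_2,y_2,z_2)-f(t_1,x_1,y_1,z_1)|\le C_f(|t_2-t_1|^{1/2}+|x_2-x_1|+|y_2-y_1|+|z_2-z_1|)$ for all arguments; and let $\Phi$ satisfy $|\Phi(\mathbf s^1)-\Phi(\mathbf s^2)|\le C_\Phi\sup_{t\in[0,T]}|s^1_t-s^2_t|$ for all continuous $\mathbf s^1,\mathbf s^2$. Let $I\ge3$ be an integer, and assume that each function basis $p_{l,k}$ is orthonormal (i.e. $\mathbb E(p_{l,k}p_{l,k}^* )=\mathrm{Id}$) and that $\mathbb E|p_{l,k}|^4<\infty$ for all $k,l$. Let $(Y^{N,I,I},Z^{N,I,I})$ be the projected scheme and $(Y^{N,I,I,M},Z^{N,I,I,M})$ the simulation-based scheme with $M$ simulated paths, with truncation levels $\rho^N_{l,k}=\max(1,C_0|p_{l,k}|)$, $C_0$ being a large enough constant (all defined in the context). Then there are constants $h_0>0$ and $C$, independent of $N$ (equivalently $h=T/N$), $M$, $k$ and the function bases, such that whenever $h\le h_0$, for every $0\le k\le N-1$, $$\mathbb E|Y^{N,I,I}_{t_k}-Y^{N,I,I,M}_{t_k}|^2+h\sum_{j=k}^{N-1}\mathbb E|Z^{N,I,I}_{t_j}-Z^{N,I,I,M}_{t_j}|^2$$ $$\le 9\sum_{j=k}^{N-1}\mathbb E\big(|\rho^N_j(P^N_{t_j})|^2\mathbf 1_{[\mathbf A^M_k]^c}\big)+Ch^{I-1}\sum_{j=k}^{N-1}\big[1+|S_0|^2+\mathbb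 E|\rho^N_j(P^N_{t_j})|^2\big]$$ $$+\frac{C}{hM}\sum_{j=k}^{N-1}\bigg(\mathbb E\|v_jv_j^*-\mathrm{Id}\|_F^2\;\mathbb E|\rho^N_j(P^N_{t_j})|^2+\mathbb E(|v_j|^2|p_{0,j+1}|^2)\,\mathbb E|\rho^N_{0,j}(P^N_{t_j})|^2$$ $$+h^2\,\mathbb E\Big[|v_j|^2\Big(1+|S^N_{t_j}|^2+|p_{0,j}|^2\,\mathbb E|\rho^N_{0,j}(P^N_{t_j})|^2+\frac1h\sum_{l=1}^q|p_{l,j}|^2\,\mathbb E|\rho^N_{l,j}(P^N_{t_j})|^2\Big)\Big]\bigg).$$
   Context: Setting: $T>0$; $W$ is a $q$-dimensional Brownian motion with augmented natural filtration $(\mathcal F_t)_{0\le t\le T}$; $S_0\in\mathbb R^d$ deterministic; $b:[0,T]\times\mathbb R^d\to\mathbb R^d$, $\sigma:[0,T]\times\mathbb R^d\to\mathbb R^{d\times q}$, $f:[0,T]\times\mathbb R^d\times\mathbb R\times\mathbb R^q\to\mathbb R$ deterministic; $\Phi$ a real-valued functional on continuous paths. For $N\ge1$: $h=T/N$, $t_k=kh$, $\Delta W_k=W_{t_{k+1}}-W_{t_k}$ (components $\Delta W_{l,k}$). Euler scheme: $S^N_{t_0}=S_0$, $S^N_{t_{k+1}}=S^N_{t_k}+b(t_k,S^N_{t_k})h+\sigma(t_k,S^N_{t_k})\Delta W_k$. $(P^N_{t_k})_{0\le k\le N}$ is an $\mathbb R^{d'}$-valued Markov chain whose first $d$ components are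 $S^N_{t_k}$, with $P^N_{t_k}$ $\mathcal F_{t_k}$-measurable; $\Phi^N:\mathbb R^{d'}\to\mathbb R$ is deterministic with $\mathbb E[\Phi^N(P^N_{t_N})^2]<\infty$ ($\Phi^N(P^N_{t_N})$ approximates $\Phi(\mathbf S)$, where $dS_t=b(t,S_t)dt+\sigma(t,S_t)dW_t$). Function bases: for $0\le l\le q$, $0\le k\le N-1$, $p_{l,k}$ is a finite (column) vector of measurable real functions on $\mathbb R^{d'}$; $p_{l,k}$ also denotes the random vector $p_{l,k}(P^N_{t_k})$. By convention $p_{0,N}:=\Phi^N(P^N_{t_N})$ (scalar). For coefficients $\alpha=(\alpha_0,\dots,\alpha_q)$ put $f_k(\alpha)=f(t_k,S^N_{t_k},\alpha_0\cdot p_{0,k},\dots,\alpha_q\cdot p_{q,k})$. Let $v_k$ be the column vector with $v_k^*=(p_{0,k}^*,p_{1,k}^*\frac{\Delta W_{1,k}}{\sqrt h},\dots,p_{q,k}^*\frac{\Delta W_{q,k}}{\sqrt h})$. $|\cdot|$ is the Euclidean norm of vectors; for a symmetric matrix $A$, $\|A\|$ is the maximal absolute value of its eigenvalues and $\|A\|_F$ its Frobenius norm. Projected scheme: $Y^{N,i,I}_{t_N}=\Phi^N(P^N_{t_N})$ for all $i$. Backward for $k=N-1,\dots,0$: $\alpha^{0,I}_{l,k}=0$, and for $i\ge1$, $\alpha^{i,I}_k=(\alpha^{i,I}_{l,k})_{0\le l\le q}$ is the minimizer over $(\alpha_0,\dots,\alpha_q)$ of $\mathbb E\big(Y^{N,I,I}_{t_{k+1}}-\alpha_0\cdot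 p_{0,k}+hf_k(\alpha^{i-1,I}_k)-\sum_{l=1}^q\alpha_l\cdot p_{l,k}\Delta W_{l,k}\big)^2$; then $Y^{N,i,I}_{t_k}=\alpha^{i,I}_{0,k}\cdot p_{0,k}$, $Z^{N,i,I}_{l,t_k}=\alpha^{i,I}_{l,k}\cdot p_{l,k}$ ($1\le l\le q$). Truncations: $\rho^N_{l,k}(x)=\max(1,C_0|p_{l,k}(x)|)$ for $0\le l\le q$, $0\le k\le N-1$, where $C_0$ is a constant chosen large enough, so that in particular $|Y^{N,i,I}_{t_k}|\le\rho^N_{0,k}(P^N_{t_k})$ and $\sqrt h|Z^{N,i,I}_{l,t_k}|\le\rho^N_{l,k}(P^N_{t_k})$ a.s. for all $i\ge0$, $0\le k\le N-1$, $1\le l\le q$ (such $C_0$ exists for $h$ small). $\rho^N_k=[\rho^N_{0,k},\dots,\rho^N_{q,k}]^*$. Let $\xi:\mathbb R\to\mathbb R$ be a $C^2_b$ function with $\xi(x)=x$ for $|x|\le3/2$, $|\xi|_\infty\le2$, $|\xi'|_\infty\le1$. Simulations: $((P^{N,m}_{t_k})_{0\le k\le N},(\Delta W^m_k)_{0\le k\le N-1})$, $1\le m\le M$, are independent copies of $((P^N_{t_k})_k,(\Delta W_k)_k)$, also independent of $(P^N,W)$; $S^{N,m}$, $p^m_{l,k}=p_{l,k}(P^{N,m}_{t_k})$, $v^m_k$, $f^m_k(\alpha)=f(t_k,S^{N,m}_{t_k},\alpha_0\cdot p^m_{0,k},\dots,\alpha_q\cdot p^m_{q,k})$ denote the quantities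 along the $m$-th simulation. Set $\hat\rho^N_{l,k}(x)=\rho^N_{l,k}(P^N_{t_k})\,\xi\big(x/\rho^N_{l,k}(P^N_{t_k})\big)$ and $\hat\rho^{N,m}_{l,k}(x)=\rho^N_{l,k}(P^{N,m}_{t_k})\,\xi\big(x/\rho^N_{l,k}(P^{N,m}_{t_k})\big)$. Also $V^M_k=\frac1M\sum_{m=1}^M v^m_k[v^m_k]^*$, $P^M_{l,k}=\frac1M\sum_{m=1}^M p^m_{l,k}[p^m_{l,k}]^*$, and $$\mathbf A^M_k=\{\forall j\in\{k,\dots,N-1\}:\ \|V^M_j-\mathrm{Id}\|\le h,\ \|P^M_{0,j}-\mathrm{Id}\|\le h,\ \|P^M_{l,j}-\mathrm{Id}\|\le1\text{ for }1\le l\le q\}.$$ Simulation-based scheme: $Y^{N,I,I,M,m}_{t_N}=\Phi^N(P^{N,m}_{t_N})$. Backward for $k=N-1,\dots,0$: $\alpha^{0,I,M}_{l,k}=0$, and for $i=1,\dots,I$, $\alpha^{i,I,M}_k=(\alpha^{i,I,M}_{l,k})_{0\le l\le q}$ is a minimizer over $(\alpha_0,\dots,\alpha_q)$ of $$\frac1M\sum_{m=1}^M\Big(Y^{N,I,I,M,m}_{t_{k+1}}-\alpha_0\cdot p^m_{0,k}+hf^m_k(\alpha^{i-1,I,M}_k)-\sum_{l=1}^q\alpha_l\cdot p^m_{l,k}\Delta W^m_{l,k}\Big)^2$$ (e.g. the one of minimal norm if not unique), and, for $k\le N-1$, $Y^{N,I,I,M,m}_{t_k}=\hat\rho^{N,m}_{0,k}(\alpha^{I,I,M}_{0,k}\cdot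 p^m_{0,k})$. Finally, for $k\le N-1$, $Y^{N,I,I,M}_{t_k}=\hat\rho^N_{0,k}(\alpha^{I,I,M}_{0,k}\cdot p_{0,k})$ and $\sqrt h\,Z^{N,I,I,M}_{l,t_k}=\hat\rho^N_{l,k}(\sqrt h\,\alpha^{I,I,M}_{l,k}\cdot p_{l,k})$, $1\le l\le q$. Constants $C,h_0$ may depend on $T,d,q,b,\sigma,f,\Phi$ and on the fixed integer $I$. *)

theory Defs
  imports "HOL-Probability.Probability"
begin

text \<open>Expectations of nonnegative quantities take values in \<open>[0, \<infinity>]\<close>, so that a
  non-integrable quantity has expectation \<open>\<infinity>\<close> (and not 0, as for the Bochner integral).\<close>

abbreviation expect_nn :: "'w measure \<Rightarrow> ('w \<Rightarrow> real) \<Rightarrow> ennreal" where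
  "expect_nn \<Omega> X \<equiv> (\<integral>\<^sup>+\<omega>. ennreal (X \<omega>) \<partial>\<Omega>)"

abbreviation sigma_of :: "'w measure \<Rightarrow> 'b measure \<Rightarrow> ('w \<Rightarrow> 'b) \<Rightarrow> 'w measure" where
  "sigma_of \<Omega> S X \<equiv> vimage_algebra (space \<Omega>) X S"

definition natural_filtration :: "'w measure \<Rightarrow> (real \<Rightarrow> 'w \<Rightarrow> real^'q) \<Rightarrow> real \<Rightarrow> 'w measure" where
  "natural_filtration \<Omega> W t =
     sigma (space \<Omega>) {W s -` B \<inter> space \<Omega> | s B. s \<in> {0..t} \<and> B \<in> sets borel}"

definition augmented_filtration :: "'w measure \<Rightarrow> (real \<Rightarrow> 'w \<Rightarrow> real^'q) \<Rightarrow> real \<Rightarrow> 'w measure" where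
  "augmented_filtration \<Omega> W t =
     sigma (space \<Omega>) (sets (natural_filtration \<Omega> W t) \<union> null_sets \<Omega>)"

definition brownian_motion :: "'w measure \<Rightarrow> real \<Rightarrow> (real \<Rightarrow> 'w \<Rightarrow> real^'q) \<Rightarrow> bool" where
  "brownian_motion \<Omega> T W \<longleftrightarrow>
     prob_space \<Omega> \<and>
     (\<forall>t\<in>{0..T}. W t \<in> borel_measurable \<Omega>) \<and>
     (AE \<omega> in \<Omega>. W 0 \<omega> = 0) \<and>
     (AE \<omega> in \<Omega>. continuous_on {0..T} (\<lambda>t. W t \<omega>)) \<and>
     (\<forall>s t. 0 \<le> s \<and> s < t \<and> t \<le> T \<longrightarrow>
        prob_space.indep_set \<Omega> (sets (natural_filtration \<Omega> W s))
          (sets (sigma_of \<Omega> borel (\<lambda>\<omega>. W t \<omega> - W s \<omega>))) \<and>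
        prob_space.indep_vars \<Omega> (\<lambda>_. borel) (\<lambda>l \<omega>. W t \<omega> $ l - W s \<omega> $ l) UNIV \<and>
        (\<forall>l. distributed \<Omega> lborel (\<lambda>\<omega>. W t \<omega> $ l - W s \<omega> $ l)
               (normal_density 0 (sqrt (t - s)))))"

definition markov_chain :: "'w measure \<Rightarrow> 'x measure \<Rightarrow> nat \<Rightarrow> (nat \<Rightarrow> 'w \<Rightarrow> 'x) \<Rightarrow> bool" where
  "markov_chain \<Omega> S N X \<longleftrightarrow>
     (\<forall>k\<le>N. X k \<in> measurable \<Omega> S) \<and>
     (\<forall>k<N. \<forall>B\<in>sets S. AE \<omega> in \<Omega>.
        real_cond_exp \<Omega> (sigma_of \<Omega> (PiM {..k} (\<lambda>_. S)) (\<lambda>\<omega>. \<lambda>j\<in>{..k}. X j \<omega>))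
          (indicator (X (Suc k) -` B \<inter> space \<Omega>)) \<omega> =
        real_cond_exp \<Omega> (sigma_of \<Omega> S (X k))
          (indicator (X (Suc k) -` B \<inter> space \<Omega>)) \<omega>)"

definition independent_copies ::
  "'w measure \<Rightarrow> 'x measure \<Rightarrow> ('w \<Rightarrow> 'x) \<Rightarrow> nat \<Rightarrow> (nat \<Rightarrow> 'w \<Rightarrow> 'x) \<Rightarrow> bool" where
  "independent_copies \<Omega> S X M Xs \<longleftrightarrow>
     prob_space.indep_vars \<Omega> (\<lambda>_. S) Xs {1..M} \<and>
     (\<forall>m\<in>{1..M}. distr \<Omega> S (Xs m) = distr \<Omega> S X)"

abbreviation increment :: "(real \<Rightarrow> 'w \<Rightarrow> real^'q) \<Rightarrow> real \<Rightarrow> nat \<Rightarrow> 'w \<Rightarrow> real^'q" where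
  "increment W h k \<omega> \<equiv> W (real (Suc k) * h) \<omega> - W (real k * h) \<omega>"

primrec euler ::
  "(real \<Rightarrow> real^'d \<Rightarrow> real^'d) \<Rightarrow> (real \<Rightarrow> real^'d \<Rightarrow> real^'q^'d) \<Rightarrow> real^'d \<Rightarrow> real \<Rightarrow>
   (nat \<Rightarrow> real^'q) \<Rightarrow> nat \<Rightarrow> real^'d" where
  "euler b \<sigma> S0 h dW 0 = S0"
| "euler b \<sigma> S0 h dW (Suc k) =
     (let s = euler b \<sigma> S0 h dW k; t = real k * h
      in s + h *\<^sub>R b t s + \<sigma> t s *v dW k)"

text \<open>The state space \<open>\<real>\<^sup>d\<^sup>'\<close> with \<open>d' = d + e\<close>, \<open>e \<ge> 0\<close>: the first \<open>d\<close> components form the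
  first entry of the pair, the remaining \<open>e\<close> ones are indexed by \<open>{..<e}\<close>. In this way \<open>d'\<close>
  is an ordinary variable, on which constants can be required not to depend.\<close>

type_synonym 'd state = "(real^'d) \<times> (nat \<Rightarrow> real)"

definition state_space :: "nat \<Rightarrow> ('d::finite) state measure" where
  "state_space e = borel \<Otimes>\<^sub>M PiM {..<e} (\<lambda>_. borel)"

definition path_space :: "nat \<Rightarrow> nat \<Rightarrow> ((nat \<Rightarrow> ('d::finite) state) \<times> (nat \<Rightarrow> real^'q)) measure" where
  "path_space e N = PiM {..N} (\<lambda>_. state_space e) \<Otimes>\<^sub>M PiM {..<N} (\<lambda>_. borel)"

definition sample_path ::
  "nat \<Rightarrow> (nat \<Rightarrow> 'w \<Rightarrow> 'd state) \<Rightarrow> (nat \<Rightarrow> 'w \<Rightarrow> real^'q) \<Rightarrow> 'w \<Rightarrow>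
   (nat \<Rightarrow> 'd state) \<times> (nat \<Rightarrow> real^'q)" where
  "sample_path N P dW \<omega> = (\<lambda>k\<in>{..N}. P k \<omega>, \<lambda>k\<in>{..<N}. dW k \<omega>)"

definition simulations ::
  "'w measure \<Rightarrow> real \<Rightarrow> nat \<Rightarrow> nat \<Rightarrow> (real \<Rightarrow> 'w \<Rightarrow> real^'q) \<Rightarrow> (nat \<Rightarrow> 'w \<Rightarrow> ('d::finite) state) \<Rightarrow>
   nat \<Rightarrow> (nat \<Rightarrow> nat \<Rightarrow> 'w \<Rightarrow> 'd state) \<Rightarrow> (nat \<Rightarrow> nat \<Rightarrow> 'w \<Rightarrow> real^'q) \<Rightarrow> bool" where
  "simulations \<Omega> T N e W P M Ps dWs \<longleftrightarrow>
     independent_copies \<Omega> (path_space e N) (sample_path N P (increment W (T / real N)))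
       M (\<lambda>m. sample_path N (Ps m) (dWs m)) \<and>
     prob_space.indep_set \<Omega>
       (sets (sigma_of \<Omega> (PiM {1..M} (\<lambda>_. path_space e N))
          (\<lambda>\<omega>. \<lambda>m\<in>{1..M}. sample_path N (Ps m) (dWs m) \<omega>)))
       (sets (sigma_of \<Omega> (PiM {..N} (\<lambda>_. state_space e) \<Otimes>\<^sub>M PiM {0..T} (\<lambda>_. borel))
          (\<lambda>\<omega>. (\<lambda>k\<in>{..N}. P k \<omega>, \<lambda>t\<in>{0..T}. W t \<omega>))))"

text \<open>A basis is a finite list of functions; the index \<open>l \<in> {0,\<dots>,q}\<close> is an element of
  \<^typ>\<open>'q option\<close>, with \<^const>\<open>None\<close> for \<open>l = 0\<close> and \<open>Some l\<close> for \<open>1 \<le> l \<le> q\<close>.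
  Coefficient vectors are functions on \<^typ>\<open>nat\<close>, of which only the entries below the length of
  the basis matter.\<close>

type_synonym 'x basis = "('x \<Rightarrow> real) list"
type_synonym 'q coeffs = "'q option \<Rightarrow> nat \<Rightarrow> real"

definition bdot :: "(nat \<Rightarrow> real) \<Rightarrow> 'x basis \<Rightarrow> 'x \<Rightarrow> real" where
  "bdot a p x = (\<Sum>i<length p. a i * (p ! i) x)"

definition bnorm :: "'x basis \<Rightarrow> 'x \<Rightarrow> real" where
  "bnorm p x = L2_set (\<lambda>i. (p ! i) x) {..<length p}"

definition orthonormal_basis :: "'w measure \<Rightarrow> ('w \<Rightarrow> 'x) \<Rightarrow> 'x basis \<Rightarrow> bool" where
  "orthonormal_basis \<Omega> X p \<longleftrightarrow>
     (\<forall>i<length p. \<forall>j<length p.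
        integrable \<Omega> (\<lambda>\<omega>. (p ! i) (X \<omega>) * (p ! j) (X \<omega>)) \<and>
        (LINT \<omega>|\<Omega>. (p ! i) (X \<omega>) * (p ! j) (X \<omega>)) = (if i = j then 1 else 0))"

definition driver ::
  "(real \<Rightarrow> real^'d \<Rightarrow> real \<Rightarrow> real^'q \<Rightarrow> real) \<Rightarrow> real \<Rightarrow> ('q option \<Rightarrow> 'd state basis) \<Rightarrow>
   'q coeffs \<Rightarrow> 'd state \<Rightarrow> real" where
  "driver f t p a x =
     f t (fst x) (bdot (a None) (p None) x) (\<chi> l. bdot (a (Some l)) (p (Some l)) x)"

text \<open>The vector \<open>v\<^sub>k\<close> is indexed by the pairs \<open>(l, i)\<close> with \<open>i < length (p l)\<close>.\<close>

definition v_index :: "('q option \<Rightarrow> 'x basis) \<Rightarrow> ('q option \<times> nat) set" where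
  "v_index p = (SIGMA l:UNIV. {..<length (p l)})"

definition v_vec ::
  "real \<Rightarrow> ('q option \<Rightarrow> 'x basis) \<Rightarrow> 'x \<Rightarrow> real^'q \<Rightarrow> 'q option \<times> nat \<Rightarrow> real" where
  "v_vec h p x dw = (\<lambda>(l, i). (p l ! i) x *
     (case l of None \<Rightarrow> 1 | Some l' \<Rightarrow> dw $ l' / sqrt h))"

definition eigval :: "'i set \<Rightarrow> ('i \<Rightarrow> 'i \<Rightarrow> real) \<Rightarrow> real \<Rightarrow> bool" where
  "eigval J A c \<longleftrightarrow>
     (\<exists>x. (\<exists>i\<in>J. x i \<noteq> 0) \<and> (\<forall>i\<in>J. (\<Sum>j\<in>J. A i j * x j) = c * x i))"

text \<open>For symmetric \<open>A\<close> and finite nonempty \<open>J\<close> the set of eigenvalues is finite and nonempty, so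
  the supremum is a maximum.\<close>

definition eig_norm :: "'i set \<Rightarrow> ('i \<Rightarrow> 'i \<Rightarrow> real) \<Rightarrow> real" where
  "eig_norm J A = Sup {\<bar>c\<bar> | c. eigval J A c}"

definition frob_norm :: "'i set \<Rightarrow> ('i \<Rightarrow> 'i \<Rightarrow> real) \<Rightarrow> real" where
  "frob_norm J A = L2_set (\<lambda>(i, j). A i j) (J \<times> J)"

definition outer :: "('i \<Rightarrow> real) \<Rightarrow> 'i \<Rightarrow> 'i \<Rightarrow> real" where
  "outer u i j = u i * u j"

definition id_mat :: "'i \<Rightarrow> 'i \<Rightarrow> real" where
  "id_mat i j = (if i = j then 1 else 0)"

text \<open>The entries of \<open>V\<^sup>M - Id\<close> and \<open>P\<^sup>M - Id\<close> are those of \<open>emp_dev M u\<close> for the samples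
  \<open>u m = v\<^sup>m\<close> and \<open>u m = p\<^sup>m\<close>.\<close>

definition emp_dev :: "nat \<Rightarrow> (nat \<Rightarrow> 'i \<Rightarrow> real) \<Rightarrow> 'i \<Rightarrow> 'i \<Rightarrow> real" where
  "emp_dev M u i j = (\<Sum>m=1..M. outer (u m) i j) / real M - id_mat i j"

definition good_event ::
  "'w measure \<Rightarrow> real \<Rightarrow> nat \<Rightarrow> (nat \<Rightarrow> 'q option \<Rightarrow> 'x basis) \<Rightarrow> nat \<Rightarrow>
   (nat \<Rightarrow> nat \<Rightarrow> 'w \<Rightarrow> 'x) \<Rightarrow> (nat \<Rightarrow> nat \<Rightarrow> 'w \<Rightarrow> real^'q) \<Rightarrow> nat \<Rightarrow> 'w set" where
  "good_event \<Omega> h N p M Ps dWs k = {\<omega> \<in> space \<Omega>. \<forall>j\<in>{k..<N}.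
     eig_norm (v_index (p j)) (emp_dev M (\<lambda>m. v_vec h (p j) (Ps m j \<omega>) (dWs m j \<omega>))) \<le> h \<and>
     eig_norm {..<length (p j None)} (emp_dev M (\<lambda>m i. (p j None ! i) (Ps m j \<omega>))) \<le> h \<and>
     (\<forall>l. eig_norm {..<length (p j (Some l))}
            (emp_dev M (\<lambda>m i. (p j (Some l) ! i) (Ps m j \<omega>))) \<le> 1)}"

definition C2b :: "(real \<Rightarrow> real) \<Rightarrow> bool" where
  "C2b \<xi> \<longleftrightarrow> (\<exists>\<xi>1 \<xi>2.
     (\<forall>x. (\<xi> has_real_derivative \<xi>1 x) (at x)) \<and>
     (\<forall>x. (\<xi>1 has_real_derivative \<xi>2 x) (at x)) \<and> continuous_on UNIV \<xi>2 \<and>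
     bounded (range \<xi>) \<and> bounded (range \<xi>1) \<and> bounded (range \<xi>2))"

definition truncation_fun :: "(real \<Rightarrow> real) \<Rightarrow> bool" where
  "truncation_fun \<xi> \<longleftrightarrow> C2b \<xi> \<and> (\<forall>x. \<bar>x\<bar> \<le> 3/2 \<longrightarrow> \<xi> x = x) \<and>
     (\<forall>x. \<bar>\<xi> x\<bar> \<le> 2) \<and> (\<forall>x. \<bar>deriv \<xi> x\<bar> \<le> 1)"

definition rho :: "real \<Rightarrow> 'x basis \<Rightarrow> 'x \<Rightarrow> real" where
  "rho C0 p x = max 1 (C0 * bnorm p x)"

definition rho_norm :: "real \<Rightarrow> (('q::finite) option \<Rightarrow> 'x basis) \<Rightarrow> 'x \<Rightarrow> real" where
  "rho_norm C0 p x = L2_set (\<lambda>l. rho C0 (p l) x) UNIV"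

definition rho_hat :: "(real \<Rightarrow> real) \<Rightarrow> real \<Rightarrow> 'x basis \<Rightarrow> 'x \<Rightarrow> real \<Rightarrow> real" where
  "rho_hat \<xi> C0 p x y = rho C0 p x * \<xi> (y / rho C0 p x)"

definition residual ::
  "(real \<Rightarrow> real^'d \<Rightarrow> real \<Rightarrow> real^'q \<Rightarrow> real) \<Rightarrow> real \<Rightarrow> nat \<Rightarrow> (nat \<Rightarrow> 'q option \<Rightarrow> 'd state basis) \<Rightarrow>
   'q coeffs \<Rightarrow> 'q coeffs \<Rightarrow> real \<Rightarrow> 'd state \<Rightarrow> real^'q \<Rightarrow> real" where
  "residual f h k p a_prev a y x dw =
     y - bdot (a None) (p k None) x + h * driver f (real k * h) (p k) a_prev x
       - (\<Sum>l\<in>UNIV. bdot (a (Some l)) (p k (Some l)) x * dw $ l)"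

text \<open>\<open>\<alpha> k i\<close> stands for the coefficients after \<open>i\<close> iterations at time \<open>t\<^sub>k\<close>.
  The functions \<open>Y_proj\<close>, \<open>Y_sim\<close>, etc. take the current state as last argument, so that the
  same function serves for \<open>P\<^sup>N\<close> and for each simulated path.\<close>

definition Y_proj ::
  "('x \<Rightarrow> real) \<Rightarrow> nat \<Rightarrow> (nat \<Rightarrow> 'q option \<Rightarrow> 'x basis) \<Rightarrow> (nat \<Rightarrow> nat \<Rightarrow> 'q coeffs) \<Rightarrow>
   nat \<Rightarrow> nat \<Rightarrow> 'x \<Rightarrow> real" where
  "Y_proj \<Phi>N N p \<alpha> i k x = (if k = N then \<Phi>N x else bdot (\<alpha> k i None) (p k None) x)"

definition Z_proj ::
  "(nat \<Rightarrow> 'q option \<Rightarrow> 'x basis) \<Rightarrow> (nat \<Rightarrow> nat \<Rightarrow> 'q coeffs) \<Rightarrow> nat \<Rightarrow> nat \<Rightarrow> 'x \<Rightarrow> real^'q" where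
  "Z_proj p \<alpha> i k x = (\<chi> l. bdot (\<alpha> k i (Some l)) (p k (Some l)) x)"

definition projected_scheme ::
  "'w measure \<Rightarrow> (real \<Rightarrow> real^'d \<Rightarrow> real \<Rightarrow> real^'q \<Rightarrow> real) \<Rightarrow> real \<Rightarrow> nat \<Rightarrow> nat \<Rightarrow>
   (real \<Rightarrow> 'w \<Rightarrow> real^'q) \<Rightarrow> (nat \<Rightarrow> 'w \<Rightarrow> 'd state) \<Rightarrow> ('d state \<Rightarrow> real) \<Rightarrow>
   (nat \<Rightarrow> 'q option \<Rightarrow> 'd state basis) \<Rightarrow> (nat \<Rightarrow> nat \<Rightarrow> 'q coeffs) \<Rightarrow> bool" where
  "projected_scheme \<Omega> f h N I W P \<Phi>N p \<alpha> \<longleftrightarrow>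
     (\<forall>k<N. \<alpha> k 0 = (\<lambda>_ _. 0) \<and>
        (\<forall>i\<ge>1. is_arg_min
           (\<lambda>a. expect_nn \<Omega> (\<lambda>\<omega>. (residual f h k p (\<alpha> k (i - 1)) a
              (Y_proj \<Phi>N N p \<alpha> I (Suc k) (P (Suc k) \<omega>)) (P k \<omega>) (increment W h k \<omega>))\<^sup>2))
           (\<lambda>_. True) (\<alpha> k i)))"

definition Y_sim ::
  "(real \<Rightarrow> real) \<Rightarrow> real \<Rightarrow> ('x \<Rightarrow> real) \<Rightarrow> nat \<Rightarrow> (nat \<Rightarrow> 'q option \<Rightarrow> 'x basis) \<Rightarrow>
   (nat \<Rightarrow> nat \<Rightarrow> 'q coeffs) \<Rightarrow> nat \<Rightarrow> nat \<Rightarrow> 'x \<Rightarrow> real" where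
  "Y_sim \<xi> C0 \<Phi>N N p \<alpha> I k x =
     (if k = N then \<Phi>N x else rho_hat \<xi> C0 (p k None) x (bdot (\<alpha> k I None) (p k None) x))"

definition Z_sim ::
  "(real \<Rightarrow> real) \<Rightarrow> real \<Rightarrow> real \<Rightarrow> (nat \<Rightarrow> 'q option \<Rightarrow> 'x basis) \<Rightarrow>
   (nat \<Rightarrow> nat \<Rightarrow> 'q coeffs) \<Rightarrow> nat \<Rightarrow> nat \<Rightarrow> 'x \<Rightarrow> real^'q" where
  "Z_sim \<xi> C0 h p \<alpha> I k x =
     (\<chi> l. rho_hat \<xi> C0 (p k (Some l)) x
             (sqrt h * bdot (\<alpha> k I (Some l)) (p k (Some l)) x) / sqrt h)"

text \<open>Where the empirical minimizer is not unique, any measurable choice is allowed.\<close>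

definition simulation_scheme ::
  "'w measure \<Rightarrow> (real \<Rightarrow> real^'d \<Rightarrow> real \<Rightarrow> real^'q \<Rightarrow> real) \<Rightarrow> real \<Rightarrow> nat \<Rightarrow> nat \<Rightarrow>
   ('d state \<Rightarrow> real) \<Rightarrow> (nat \<Rightarrow> 'q option \<Rightarrow> 'd state basis) \<Rightarrow> (real \<Rightarrow> real) \<Rightarrow> real \<Rightarrow> nat \<Rightarrow>
   (nat \<Rightarrow> nat \<Rightarrow> 'w \<Rightarrow> 'd state) \<Rightarrow> (nat \<Rightarrow> nat \<Rightarrow> 'w \<Rightarrow> real^'q) \<Rightarrow>
   ('w \<Rightarrow> nat \<Rightarrow> nat \<Rightarrow> 'q coeffs) \<Rightarrow> bool" where
  "simulation_scheme \<Omega> f h N I \<Phi>N p \<xi> C0 M Ps dWs \<alpha> \<longleftrightarrow>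
     (\<forall>k<N. \<forall>i\<le>I. \<forall>l n. (\<lambda>\<omega>. \<alpha> \<omega> k i l n) \<in> borel_measurable \<Omega>) \<and>
     (\<forall>\<omega>\<in>space \<Omega>. \<forall>k<N. \<alpha> \<omega> k 0 = (\<lambda>_ _. 0) \<and>
        (\<forall>i\<in>{1..I}. is_arg_min
           (\<lambda>a. (\<Sum>m=1..M. (residual f h k p (\<alpha> \<omega> k (i - 1)) a
              (Y_sim \<xi> C0 \<Phi>N N p (\<alpha> \<omega>) I (Suc k) (Ps m (Suc k) \<omega>))
              (Ps m k \<omega>) (dWs m k \<omega>))\<^sup>2) / real M)
           (\<lambda>_. True) (\<alpha> \<omega> k i)))"

text \<open>\<open>|p\<^bsub>0,k\<^esub>|\<close> for \<open>0 \<le> k \<le> N\<close>, with the convention \<open>p\<^bsub>0,N\<^esub> = \<Phi>\<^sup>N\<close>.\<close>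

definition p0_norm ::
  "('x \<Rightarrow> real) \<Rightarrow> nat \<Rightarrow> (nat \<Rightarrow> 'q option \<Rightarrow> 'x basis) \<Rightarrow> nat \<Rightarrow> 'x \<Rightarrow> real" where
  "p0_norm \<Phi>N N p k x = (if k = N then \<bar>\<Phi>N x\<bar> else bnorm (p k None) x)"

end

(*
  Write theta = (alpha_0, sqrt h alpha_1, ..., sqrt h alpha_q) for the coefficients at time t_k.
  Both schemes are linear regressions on v_k, the projected one with Gram matrix Id = E(v v^T), the
  empirical one with Gram matrix V^M.  On A_k the matrix V^M is h-close to Id, and the difference d
  of the two coefficient vectors satisfies V^M d = tau + beta + phi, where tau is an average of M
  independent centred vectors, beta comes from the error at t_{k+1} and phi from the driver.  The
  driver is Lipschitz with an additional factor h, so phi is absorbed at the price of a factor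
  1 + C h on the Y-part and of a small fraction of the Z-part.  It involves the iterate I - 1
  instead of I; the increments of both Picard iterations contract by a factor O(h) per step in
  squared norm, whence the term h^(I-1).  A discrete Gronwall argument sums up the steps.

  Since the truncation is 1-Lipschitz and fixes the projected scheme, the errors on A_k are at most
  those of the untruncated regressions, evaluated at an independent path; orthonormality turns them
  into the norms of d.  Off A_k the errors are bounded by 3 rho, whence the constant 9.
*)
theory Submission
  imports Defs
begin

section \<open>Eigenvalue norms and quadratic forms\<close>

text \<open>The weight in Young's inequality is \<open>g * h\<close> with \<open>g\<close> constant.
  An order h keeps the factor of the error at t_{k+1} at 1 + O(h), and the inverse weight, of order
  1/h, is compensated in the driver term by its factor h. Nothing compensates it for tau, whose mean
  square is of order 1/M: this is the origin of C/(hM). The noise enters twice, for the iterates 1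
  and I. The first increment of the empirical Picard iteration is known only through the first
  projected iterate and the first error, and the latter contains tau for i = 1. Two obstacles shape
  the rest. The minimizers are an arbitrary measurable choice, so their independence of the
  evaluation path is not given; it has to be derived on A_k, where the normal equation has one
  solution. And C must not depend on the truncation constant \<open>C0\<close>: orthonormality of a
  nonempty basis gives E rho^2 at least C0^2, so powers of \<open>C0\<close> are absorbed into
  moments of rho. The mixed moments on the right need not be finite, so the variance estimates are
  carried out in [0, infinity].\<close>

definition sqn :: "'i set \<Rightarrow> ('i \<Rightarrow> real) \<Rightarrow> real" where
  "sqn J x = (\<Sum>r\<in>J. (x r)\<^sup>2)"

definition ip :: "'i set \<Rightarrow> ('i \<Rightarrow> real) \<Rightarrow> ('i \<Rightarrow> real) \<Rightarrow> real" where
  "ip J x y = (\<Sum>r\<in>J. x r * y r)"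

definition mv :: "'i set \<Rightarrow> ('i \<Rightarrow> 'i \<Rightarrow> real) \<Rightarrow> ('i \<Rightarrow> real) \<Rightarrow> 'i \<Rightarrow> real" where
  "mv J A x r = (\<Sum>s\<in>J. A r s * x s)"

lemma sqn_nonneg [simp]: "0 \<le> sqn J x"
  by (simp add: sqn_def sum_nonneg)

lemma ip_self: "ip J x x = sqn J x"
  by (simp add: ip_def sqn_def power2_eq_square)

lemma ip_commute: "ip J x y = ip J y x"
  by (simp add: ip_def mult.commute)

lemma ip_square_le: "(ip J x y)\<^sup>2 \<le> sqn J x * sqn J y"
  unfolding ip_def sqn_def by (rule Cauchy_Schwarz_ineq_sum)

lemma sqn_eq_0_iff: "finite J \<Longrightarrow> sqn J x = 0 \<longleftrightarrow> (\<forall>r\<in>J. x r = 0)"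
  by (simp add: sqn_def sum_nonneg_eq_0_iff)

lemma sqn_cong: "(\<And>r. r \<in> J \<Longrightarrow> x r = y r) \<Longrightarrow> sqn J x = sqn J y"
  by (simp add: sqn_def)

lemma ip_cong: "(\<And>r. r \<in> J \<Longrightarrow> x r = x' r) \<Longrightarrow> (\<And>r. r \<in> J \<Longrightarrow> y r = y' r) \<Longrightarrow> ip J x y = ip J x' y'"
  by (simp add: ip_def)

lemma sqn_scale: "sqn J (\<lambda>r. c * x r) = c\<^sup>2 * sqn J x"
  by (simp add: sqn_def power_mult_distrib sum_distrib_left)

lemma ip_mv_scale: "ip J (\<lambda>r. c * x r) (mv J A (\<lambda>r. c * x r)) = c\<^sup>2 * ip J x (mv J A x)"
  by (simp add: ip_def mv_def sum_distrib_left power2_eq_square mult_ac)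

lemma ip_diff_right: "ip J x (\<lambda>r. y r - z r) = ip J x y - ip J x z"
  by (simp add: ip_def sum_subtractf algebra_simps)

lemma mv_symmetric:
  assumes "\<And>r s. A r s = A s r"
  shows "ip J x (mv J A y) = ip J (mv J A x) y"
proof -
  have "ip J x (mv J A y) = (\<Sum>r\<in>J. \<Sum>s\<in>J. x r * A r s * y s)"
    by (simp add: ip_def mv_def sum_distrib_left mult_ac)
  also have "\<dots> = (\<Sum>s\<in>J. \<Sum>r\<in>J. x r * A r s * y s)"
    by (rule sum.swap)
  also have "\<dots> = (\<Sum>s\<in>J. \<Sum>r\<in>J. A s r * x r * y s)"
    using assms by (metis (no_types, lifting) mult.commute sum.cong)
  also have "\<dots> = ip J (mv J A x) y"
    by (simp add: ip_def mv_def sum_distrib_right sum_distrib_left mult_ac)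
  finally show ?thesis .
qed

text \<open>First-order condition in one variable; it yields the kernel of a semidefinite form as
  well as both normal equations.\<close>

lemma quadratic_min_linear_zero:
  fixes B D :: real
  assumes "\<And>t. 0 \<le> 2 * t * B + t\<^sup>2 * D"
  shows "B = 0"
proof (rule ccontr)
  assume B: "B \<noteq> 0"
  \<comment> \<open>\<open>c\<close> is positive and dominates \<open>D\<close> whatever the sign of
    \<open>D\<close>, so the polynomial at \<open>t = - B / c\<close> is at most
    \<open>- (B\<^sup>2 / c)\<close>.\<close>
  define c where "c = \<bar>D\<bar> + 1"
  have c: "c > 0" "D \<le> c" by (auto simp: c_def)
  define t where "t = - B / c"
  have "t\<^sup>2 * D \<le> t\<^sup>2 * c" using c by (intro mult_left_mono) auto
  also have "\<dots> = B\<^sup>2 / c" using c unfolding t_def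
    by (simp add: power_divide power2_eq_square)
  finally have "2 * t * B + t\<^sup>2 * D \<le> - 2 * B\<^sup>2 / c + B\<^sup>2 / c"
    by (simp add: t_def power2_eq_square)
  also have "\<dots> = - (B\<^sup>2 / c)" by (simp add: field_simps)
  also have "\<dots> < 0" using B c by simp
  finally show False using assms[of t] by simp
qed

text \<open>A zero of a nonnegative form is a minimum, so its derivative there vanishes in every
  direction; the direction \<open>mv J A x0\<close> shows that this vector has norm zero.\<close>

lemma psd_kernel:
  assumes "finite J" and sym: "\<And>r s. A r s = A s r"
    and psd: "\<And>x. 0 \<le> ip J x (mv J A x)" and zero: "ip J x0 (mv J A x0) = 0" and "r \<in> J"
  shows "mv J A x0 r = 0"
proof -
  have "ip J y (mv J A x0) = 0" for y
  proof (rule quadratic_min_linear_zero)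
    fix t
    have "ip J (\<lambda>r. x0 r + t * y r) (mv J A (\<lambda>r. x0 r + t * y r)) =
      ip J x0 (mv J A x0) + t * ip J x0 (mv J A y) + t * ip J y (mv J A x0) +
          t\<^sup>2 * ip J y (mv J A y)"
      by (simp add: ip_def mv_def sum.distrib sum_distrib_left algebra_simps power2_eq_square)
    also have "ip J x0 (mv J A y) = ip J y (mv J A x0)"
      using mv_symmetric[of A, OF sym, where x = x0 and y = y] by (simp add: ip_commute)
    finally show "0 \<le> 2 * t * ip J y (mv J A x0) + t\<^sup>2 * ip J y (mv J A y)"
      using psd[of "\<lambda>r. x0 r + t * y r"] zero by simp
  qed
  then have "sqn J (mv J A x0) = 0" by (metis ip_self)
  with \<open>finite J\<close> \<open>r \<in> J\<close> show ?thesis by (simp add: sqn_eq_0_iff)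
qed

text \<open>The sphere of \<open>J\<close> leaves the coordinates outside \<open>J\<close> free and
  is not compact in the product topology. Pinning them to 0 gives a closed subset of a product of
  compact intervals, and \<open>F\<close> does not see the difference.\<close>

lemma sphere_attains_max:
  fixes F :: "('i \<Rightarrow> real) \<Rightarrow> real"
  assumes J: "finite J" "J \<noteq> {}" and F: "continuous_on UNIV F"
    and Fc: "\<And>x y. (\<And>r. r \<in> J \<Longrightarrow> x r = y r) \<Longrightarrow> F x = F y"
  obtains x0 where "sqn J x0 = 1" "\<And>x. sqn J x = 1 \<Longrightarrow> F x \<le> F x0"
proof -
  define K :: "('i \<Rightarrow> real) set" where
    "K = PiE UNIV (\<lambda>i. if i \<in> J then {-1..1} else {0}) \<inter> {x. sqn J x = 1}"
  have c: "continuous_on UNIV (\<lambda>x :: 'i \<Rightarrow> real. sqn J x)"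
    unfolding sqn_def by (intro continuous_intros continuous_on_product_coordinates)
  have "compact (PiE UNIV (\<lambda>i. if i \<in> J then {-1..1} else {0}) :: ('i \<Rightarrow> real) set)"
    unfolding compactin_euclidean_iff[symmetric] euclidean_product_topology[symmetric]
    by (subst compactin_PiE) auto
  moreover have "closed {x :: 'i \<Rightarrow> real. sqn J x = 1}"
    by (intro closed_Collect_eq c continuous_intros)
  ultimately have K: "compact K" unfolding K_def by (rule compact_Int_closed)
  obtain i0 where i0: "i0 \<in> J" using J by auto
  have "(\<lambda>i. if i = i0 then 1 else 0) \<in> K"
    using i0 J(1) by (auto simp: K_def sqn_def if_distrib[where f="\<lambda>x. x\<^sup>2"] cong: if_cong)
  then have "K \<noteq> {}" by auto
  from continuous_attains_sup[OF K this continuous_on_subset[OF F]] obtain x0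
    where x0: "x0 \<in> K" "\<forall>x\<in>K. F x \<le> F x0" by auto
  show ?thesis
  proof (rule that)
    show "sqn J x0 = 1" using x0 by (simp add: K_def)
    fix x assume x: "sqn J x = 1"
    let ?y = "\<lambda>i. if i \<in> J then x i else 0"
    have "\<bar>x i\<bar> \<le> 1" if "i \<in> J" for i
    proof -
      have "(x i)\<^sup>2 \<le> sqn J x" unfolding sqn_def using J that by (intro member_le_sum) auto
      then show ?thesis using x abs_square_le_1 by auto
    qed
    moreover have "sqn J ?y = 1" using x by (simp add: sqn_def)
    ultimately have "?y \<in> K" by (fastforce simp: K_def)
    then show "F x \<le> F x0" using x0(2) Fc[of x ?y] by simp
  qed
qed

text \<open>Rayleigh principle. Let \<open>x0\<close> maximize the modulus of the form on the unit
  sphere, with value \<open>l\<close> of sign \<open>s\<close>. Then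
  \<open>\<bar>l\<bar> Id - s A\<close> is positive semidefinite and its form vanishes at
  \<open>x0\<close>, so \<open>x0\<close> lies in its kernel and is an eigenvector for
  \<open>l\<close>.\<close>

lemma symmetric_max_eigenvalue:
  assumes J: "finite J" "J \<noteq> {}" and sym: "\<And>r s. A r s = A s r"
  obtains c where "eigval J A c" "\<And>x. \<bar>ip J x (mv J A x)\<bar> \<le> \<bar>c\<bar> * sqn J x"
proof -
  let ?F = "\<lambda>x. \<bar>ip J x (mv J A x)\<bar>"
  have "continuous_on UNIV ?F"
    unfolding ip_def mv_def by (intro continuous_intros continuous_on_product_coordinates)
  then obtain x0 where x0: "sqn J x0 = 1" "\<And>x. sqn J x = 1 \<Longrightarrow> ?F x \<le> ?F x0"
    by (rule sphere_attains_max[OF J]) (auto simp: ip_def mv_def)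
  define l where "l = ip J x0 (mv J A x0)"
  have bound: "?F x \<le> \<bar>l\<bar> * sqn J x" for x
  proof (cases "sqn J x = 0")
    case True
    then show ?thesis using J by (simp add: sqn_eq_0_iff ip_def)
  next
    case False
    then have pos: "sqn J x > 0" using sqn_nonneg[of J x] by linarith
    let ?c = "1 / sqrt (sqn J x)"
    have "sqn J (\<lambda>r. ?c * x r) = 1"
      unfolding sqn_scale using pos by (simp add: power_divide)
    from x0(2)[OF this] have "?c\<^sup>2 * ?F x \<le> \<bar>l\<bar>"
      unfolding ip_mv_scale l_def by (simp add: abs_mult)
    then show ?thesis using pos by (simp add: power_divide field_simps)
  qed
  define s :: real where "s = (if l \<ge> 0 then 1 else -1)"
  have sl: "\<bar>l\<bar> = s * l" "s * s = 1" by (auto simp: s_def)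
  define B where "B = (\<lambda>i j. \<bar>l\<bar> * id_mat i j - s * A i j)"
  have mvB: "mv J B x r = \<bar>l\<bar> * x r - s * mv J A x r" if "r \<in> J" for x r
  proof -
    have "(\<Sum>j\<in>J. \<bar>l\<bar> * id_mat r j * x j) = \<bar>l\<bar> * x r"
      using that J(1) by (simp add: id_mat_def if_distrib if_distribR cong: if_cong)
    then show ?thesis
      by (simp add: mv_def B_def algebra_simps sum_subtractf sum_distrib_left)
  qed
  have ipB: "ip J x (mv J B x) = \<bar>l\<bar> * sqn J x - s * ip J x (mv J A x)" for x
  proof -
    have "ip J x (mv J B x) = ip J x (\<lambda>r. \<bar>l\<bar> * x r - s * mv J A x r)"
      by (rule ip_cong) (auto simp: mvB)
    then show ?thesis
      by (simp add: ip_def sqn_def algebra_simps sum_subtractf sum_distrib_left power2_eq_square)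
  qed
  have "mv J B x0 r = 0" if "r \<in> J" for r
  proof (rule psd_kernel[OF J(1) _ _ _ that])
    show "B r s = B s r" for r s
      using sym[of r s] by (auto simp: B_def id_mat_def)
    show "0 \<le> ip J x (mv J B x)" for x
      unfolding ipB using bound[of x] by (auto simp: s_def)
    show "ip J x0 (mv J B x0) = 0"
      unfolding ipB using x0(1) sl by (simp add: l_def[symmetric])
  qed
  then have "mv J A x0 r = l * x0 r" if "r \<in> J" for r
    using that mvB[OF that, of x0] sl by (auto simp: s_def split: if_splits)
  moreover have "\<exists>i\<in>J. x0 i \<noteq> 0" using x0(1) J sqn_eq_0_iff[of J x0] by auto
  ultimately have "eigval J A l" unfolding eigval_def mv_def by blast
  with bound show ?thesis by (rule that[rotated])
qed

text \<open>Bridge from the supremum over eigenvalues to quadratic forms, the only shape in which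
  the norm is used later. The extremal eigenvalue \<open>c0\<close> also shows that the set of
  moduli is nonempty and bounded, without which the real supremum says nothing.\<close>

lemma eig_norm_le_iff:
  assumes J: "finite J" "J \<noteq> {}" and sym: "\<And>r s. A r s = A s r"
  shows "eig_norm J A \<le> c \<longleftrightarrow> (\<forall>x. \<bar>ip J x (mv J A x)\<bar> \<le> c * sqn J x)"
proof -
  obtain c0 where c0: "eigval J A c0" "\<And>x. \<bar>ip J x (mv J A x)\<bar> \<le> \<bar>c0\<bar> * sqn J x"
    by (rule symmetric_max_eigenvalue[of J A, OF J sym]) blast
  have eig_le: "\<bar>c1\<bar> \<le> c" if "eigval J A c1" and b: "\<And>x. \<bar>ip J x (mv J A x)\<bar> \<le> c * sqn J x" for c1 c
  proof -
    from that(1) obtain x where x: "\<exists>i\<in>J. x i \<noteq> 0" "\<forall>i\<in>J. mv J A x i = c1 * x i"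
      unfolding eigval_def mv_def by blast
    have "sqn J x \<noteq> 0" using x(1) sqn_eq_0_iff[OF J(1), of x] by auto
    then have "sqn J x > 0" using sqn_nonneg[of J x] by linarith
    moreover have "ip J x (mv J A x) = ip J x (\<lambda>r. c1 * x r)"
      by (rule ip_cong) (auto simp: x)
    then have "ip J x (mv J A x) = c1 * sqn J x"
      by (simp add: ip_def sqn_def sum_distrib_left power2_eq_square mult_ac)
    ultimately show ?thesis using b[of x] by (simp add: abs_mult)
  qed
  have bdd: "bdd_above {\<bar>c\<bar> |c. eigval J A c}"
    by (rule bdd_aboveI[of _ "\<bar>c0\<bar>"]) (use eig_le[OF _ c0(2)] in auto)
  show ?thesis
  proof
    assume "eig_norm J A \<le> c"
    moreover have "\<bar>c0\<bar> \<le> eig_norm J A"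
      unfolding eig_norm_def by (rule cSup_upper[OF _ bdd]) (use c0(1) in blast)
    ultimately have "\<bar>c0\<bar> \<le> c" by linarith
    then show "\<forall>x. \<bar>ip J x (mv J A x)\<bar> \<le> c * sqn J x"
      by (meson c0(2) mult_right_mono order_trans sqn_nonneg)
  next
    assume "\<forall>x. \<bar>ip J x (mv J A x)\<bar> \<le> c * sqn J x"
    then show "eig_norm J A \<le> c"
      unfolding eig_norm_def using c0(1) eig_le by (intro cSup_least) auto
  qed
qed

text \<open>Both sides are continuous in the finitely many coordinates of \<open>J\<close>. The
  approximants vanish outside \<open>J\<close>, so that the test vectors form a countable
  set.\<close>

lemma quadratic_form_le_dense:
  assumes J: "finite J" and q: "\<And>x. (\<forall>r. x r \<in> \<rat>) \<Longrightarrow> (\<forall>r. r \<notin> J \<longrightarrow> x r = 0) \<Longrightarrow>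
      \<bar>ip J x (mv J A x)\<bar> \<le> c * sqn J x"
  shows "\<bar>ip J x (mv J A x)\<bar> \<le> c * sqn J x"
proof -
  have "\<exists>y. (\<forall>n. y n \<in> \<rat>) \<and> y \<longlonglongrightarrow> x r" for r
    using closure_sequential[of "x r" \<rat>] by (simp add: Rats_closure_real)
  then obtain y where y: "\<And>r n. y r n \<in> \<rat>" "\<And>r. y r \<longlonglongrightarrow> x r" by metis
  let ?z = "\<lambda>n r. if r \<in> J then y r n else 0"
  have z: "(\<lambda>n. ?z n r) \<longlonglongrightarrow> x r" if "r \<in> J" for r using that y(2) by simp
  have "(\<lambda>n. \<bar>ip J (?z n) (mv J A (?z n))\<bar>) \<longlonglongrightarrow> \<bar>ip J x (mv J A x)\<bar>"
    unfolding ip_def mv_def by (intro tendsto_intros z)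
  moreover have "(\<lambda>n. c * sqn J (?z n)) \<longlonglongrightarrow> c * sqn J x"
    unfolding sqn_def by (intro tendsto_intros z)
  moreover have "\<bar>ip J (?z n) (mv J A (?z n))\<bar> \<le> c * sqn J (?z n)" for n
    by (rule q) (auto simp: y)
  ultimately show ?thesis by (intro LIMSEQ_le) auto
qed

text \<open>The quadratic-form criterion makes the event a countable intersection over rational test
  vectors, so nothing has to be said about how eigenvalues depend on the sample point.\<close>

lemma measurable_eig_norm_le:
  fixes A :: "'w \<Rightarrow> 'i \<Rightarrow> 'i \<Rightarrow> real"
  assumes J: "finite J" "J \<noteq> {}" and sym: "\<And>\<omega> r s. A \<omega> r s = A \<omega> s r"
    and m: "\<And>r s. r \<in> J \<Longrightarrow> s \<in> J \<Longrightarrow> (\<lambda>\<omega>. A \<omega> r s) \<in> borel_measurable M"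
  shows "{\<omega> \<in> space M. eig_norm J (A \<omega>) \<le> c} \<in> sets M"
proof -
  let ?D = "{x :: 'i \<Rightarrow> real. (\<forall>r. x r \<in> \<rat>) \<and> (\<forall>r. r \<notin> J \<longrightarrow> x r = 0)}"
  have zero: "(\<lambda>_. 0) \<in> ?D" by simp
  have "?D \<subseteq> (\<lambda>g r. if r \<in> J then g r else 0) ` (PiE J (\<lambda>_. \<rat>))"
  proof
    fix x assume "x \<in> ?D"
    then have x: "x r \<in> \<rat>" "r \<notin> J \<Longrightarrow> x r = 0" for r by blast+
    have "x = (\<lambda>r. if r \<in> J then restrict x J r else 0)"
      by (rule ext) (simp add: x(2))
    moreover have "restrict x J \<in> PiE J (\<lambda>_. \<rat>)"
      using x(1) by (simp add: restrict_PiE_iff)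
    ultimately show "x \<in> (\<lambda>g r. if r \<in> J then g r else 0) ` (PiE J (\<lambda>_. \<rat>))"
      by (rule image_eqI)
  qed
  moreover have "countable (PiE J (\<lambda>_. \<rat> :: real set))"
    by (rule countable_PiE[OF J(1)]) (rule countable_rat)
  ultimately have "countable ?D" by (rule countable_subset[OF _ countable_image])
  moreover have "?D \<noteq> {}" using zero by (metis empty_iff)
  moreover define X where "X = from_nat_into ?D"
  ultimately have X: "range X = ?D" unfolding X_def by (intro range_from_nat_into)
  have "{\<omega> \<in> space M. eig_norm J (A \<omega>) \<le> c} =
    {\<omega> \<in> space M. \<forall>x\<in>?D. \<bar>ip J x (mv J (A \<omega>) x)\<bar> \<le> c * sqn J x}"
  proof (rule Collect_cong, rule conj_cong[OF refl])
    fix \<omega>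
    show "eig_norm J (A \<omega>) \<le> c \<longleftrightarrow> (\<forall>x\<in>?D. \<bar>ip J x (mv J (A \<omega>) x)\<bar> \<le> c * sqn J x)"
      unfolding eig_norm_le_iff[OF J, of "A \<omega>" c, OF sym]
    proof (intro iffI allI ballI)
      fix x assume "\<forall>x\<in>?D. \<bar>ip J x (mv J (A \<omega>) x)\<bar> \<le> c * sqn J x"
      then show "\<bar>ip J x (mv J (A \<omega>) x)\<bar> \<le> c * sqn J x"
        by - (rule quadratic_form_le_dense[OF J(1)], blast)
    qed blast
  qed
  also have "\<dots> = {\<omega> \<in> space M. \<forall>n. \<bar>ip J (X n) (mv J (A \<omega>) (X n))\<bar> \<le> c * sqn J (X n)}"
    unfolding X[symmetric] by simp
  also have "\<dots> \<in> sets M"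
  proof (rule sets.sets_Collect_countable_All)
    have "(\<lambda>\<omega>. \<bar>ip J x (mv J (A \<omega>) x)\<bar>) \<in> borel_measurable M" for x
      unfolding ip_def mv_def
      by (intro borel_measurable_abs borel_measurable_sum borel_measurable_times
          borel_measurable_const m)
    from borel_measurable_le[OF this borel_measurable_const]
    show "{\<omega> \<in> space M. \<bar>ip J (X n) (mv J (A \<omega>) (X n))\<bar> \<le> c * sqn J (X n)} \<in> sets M" for n .
  qed
  finally show ?thesis .
qed

section \<open>Empirical averages and Gram matrices\<close>

definition avg :: "nat \<Rightarrow> (nat \<Rightarrow> real) \<Rightarrow> real" where
  "avg M g = (\<Sum>m=1..M. g m) / real M"

lemma avg_mono: "(\<And>m. m \<in> {1..M} \<Longrightarrow> f m \<le> g m) \<Longrightarrow> avg M f \<le> avg M g"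
  unfolding avg_def by (intro divide_right_mono sum_mono) auto

lemma avg_nonneg: "(\<And>m. m \<in> {1..M} \<Longrightarrow> 0 \<le> g m) \<Longrightarrow> 0 \<le> avg M g"
  unfolding avg_def by (intro divide_nonneg_nonneg sum_nonneg) auto

lemma avg_add: "avg M (\<lambda>m. f m + g m) = avg M f + avg M g"
  by (simp add: avg_def sum.distrib add_divide_distrib)

lemma avg_diff: "avg M (\<lambda>m. f m - g m) = avg M f - avg M g"
  by (simp add: avg_def sum_subtractf diff_divide_distrib)

lemma avg_mult: "avg M (\<lambda>m. c * f m) = c * avg M f"
  by (simp add: avg_def sum_distrib_left)

lemma avg_sum: "avg M (\<lambda>m. \<Sum>r\<in>J. f r m) = (\<Sum>r\<in>J. avg M (f r))"
  unfolding avg_def by (subst sum.swap) (simp add: sum_divide_distrib)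

lemma avg_Cauchy_Schwarz: "(avg M (\<lambda>m. f m * g m))\<^sup>2 \<le> avg M (\<lambda>m. (f m)\<^sup>2) * avg M (\<lambda>m. (g m)\<^sup>2)"
  unfolding avg_def power_divide times_divide_times_eq power2_eq_square[of "real M"]
  by (rule divide_right_mono[OF Cauchy_Schwarz_ineq_sum]) simp

text \<open>The product V^M x for the empirical Gram matrix V^M of the samples \<open>u\<close>,
  written as an average so that Cauchy-Schwarz can be applied over the samples directly.\<close>

definition gram :: "nat \<Rightarrow> 'i set \<Rightarrow> (nat \<Rightarrow> 'i \<Rightarrow> real) \<Rightarrow> ('i \<Rightarrow> real) \<Rightarrow> 'i \<Rightarrow> real" where
  "gram M J u x r = avg M (\<lambda>m. u m r * ip J (u m) x)"

lemma ip_avg: "ip J x (\<lambda>r. avg M (\<lambda>m. u m r * g m)) = avg M (\<lambda>m. ip J (u m) x * g m)"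
  by (simp add: ip_def avg_sum[symmetric] avg_mult[symmetric] sum_distrib_right sum_distrib_left
      mult_ac)

lemma ip_gram: "ip J x (gram M J u x) = avg M (\<lambda>m. (ip J (u m) x)\<^sup>2)"
  unfolding gram_def ip_avg by (simp add: power2_eq_square)

lemma gram_diff: "gram M J u (\<lambda>r. x r - y r) r = gram M J u x r - gram M J u y r"
  by (simp add: gram_def ip_diff_right avg_diff algebra_simps)

lemma ip_emp_dev:
  assumes "finite J"
  shows "ip J x (mv J (emp_dev M u) x) = avg M (\<lambda>m. (ip J (u m) x)\<^sup>2) - sqn J x"
proof -
  have "mv J (emp_dev M u) x r = gram M J u x r - x r" if "r \<in> J" for r
  proof -
    have "mv J (emp_dev M u) x r = (\<Sum>s\<in>J. avg M (\<lambda>m. u m r * u m s) * x s) -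
        (\<Sum>s\<in>J. id_mat r s * x s)"
      by (simp add: mv_def emp_dev_def avg_def outer_def left_diff_distrib sum_subtractf)
    also have "(\<Sum>s\<in>J. id_mat r s * x s) = x r"
      using that assms by (simp add: id_mat_def if_distrib[where f="\<lambda>c. c * _"] cong: if_cong)
    also have "(\<Sum>s\<in>J. avg M (\<lambda>m. u m r * u m s) * x s) = gram M J u x r"
      by (simp add: gram_def ip_def sum_distrib_left avg_sum avg_mult[symmetric] mult_ac)
    finally show ?thesis .
  qed
  then have "ip J x (mv J (emp_dev M u) x) = ip J x (\<lambda>r. gram M J u x r - x r)"
    by (intro ip_cong) auto
  then show ?thesis by (simp add: ip_diff_right ip_gram ip_self)
qed

text \<open>The bound \<open>c\<close> on the spectral norm of V^M - Id, read as a statement on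
  empirical second moments: the lower half gives coercivity of V^M, the upper half its
  boundedness.\<close>

definition near_id :: "nat \<Rightarrow> 'i set \<Rightarrow> (nat \<Rightarrow> 'i \<Rightarrow> real) \<Rightarrow> real \<Rightarrow> bool" where
  "near_id M J u c \<longleftrightarrow> (\<forall>x. (1 - c) * sqn J x \<le> avg M (\<lambda>m. (ip J (u m) x)\<^sup>2) \<and>
     avg M (\<lambda>m. (ip J (u m) x)\<^sup>2) \<le> (1 + c) * sqn J x)"

lemma emp_dev_symmetric: "emp_dev M u r s = emp_dev M u s r"
  by (simp add: emp_dev_def outer_def id_mat_def mult.commute)

lemma eig_norm_emp_dev_le_iff:
  assumes "finite J" "J \<noteq> {}"
  shows "eig_norm J (emp_dev M u) \<le> c \<longleftrightarrow> near_id M J u c"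
proof -
  have "eig_norm J (emp_dev M u) \<le> c \<longleftrightarrow>
      (\<forall>x. \<bar>ip J x (mv J (emp_dev M u) x)\<bar> \<le> c * sqn J x)"
    by (rule eig_norm_le_iff[OF assms]) (rule emp_dev_symmetric)
  also have "\<dots> \<longleftrightarrow> near_id M J u c"
    unfolding near_id_def ip_emp_dev[OF assms(1)] abs_le_iff by (auto simp: algebra_simps)
  finally show ?thesis .
qed

text \<open>Duality: for \<open>w\<close> the averaged vector, \<open>sqn J w\<close> is the average
  of \<open>ip J (u m) w * g m\<close>. Cauchy-Schwarz and the upper half of \<open>near_id\<close>
  bound its square by \<open>(1 + c) * sqn J w\<close> times the mean of \<open>g\<^sup>2\<close>,
  and one factor \<open>sqn J w\<close> cancels.\<close>

lemma sqn_avg_le: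
  assumes "near_id M J u c" and c: "0 \<le> c"
  shows "sqn J (\<lambda>r. avg M (\<lambda>m. u m r * g m)) \<le> (1 + c) * avg M (\<lambda>m. (g m)\<^sup>2)"
proof -
  define w where "w = (\<lambda>r. avg M (\<lambda>m. u m r * g m))"
  have "ip J w w = avg M (\<lambda>m. ip J (u m) w * g m)"
    unfolding ip_avg[symmetric] w_def[symmetric] ..
  then have "sqn J w * sqn J w = (avg M (\<lambda>m. ip J (u m) w * g m))\<^sup>2"
    by (simp add: ip_self power2_eq_square)
  also have "\<dots> \<le> avg M (\<lambda>m. (ip J (u m) w)\<^sup>2) * avg M (\<lambda>m. (g m)\<^sup>2)"
    by (rule avg_Cauchy_Schwarz)
  also have "\<dots> \<le> (1 + c) * sqn J w * avg M (\<lambda>m. (g m)\<^sup>2)"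
    using assms by (intro mult_right_mono avg_nonneg) (auto simp: near_id_def)
  finally have "sqn J w * sqn J w \<le> sqn J w * ((1 + c) * avg M (\<lambda>m. (g m)\<^sup>2))"
    by (simp add: mult_ac)
  moreover have nn: "0 \<le> (1 + c) * avg M (\<lambda>m. (g m)\<^sup>2)"
    using c by (intro mult_nonneg_nonneg avg_nonneg) auto
  ultimately have "sqn J w \<le> (1 + c) * avg M (\<lambda>m. (g m)\<^sup>2)"
    by (cases "sqn J w = 0") (simp, use sqn_nonneg[of J w] in \<open>simp add: mult_le_cancel_left\<close>)
  then show ?thesis by (simp only: w_def)
qed

text \<open>Coercivity turns into a lower bound for the image through Cauchy-Schwarz; this replaces
  a bound for the inverse of V^M.\<close>

lemma sqn_gram_ge:
  assumes "near_id M J u c" and c: "c \<le> 1"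
  shows "(1 - c)\<^sup>2 * sqn J x \<le> sqn J (gram M J u x)"
proof (cases "sqn J x = 0")
  case False
  then have pos: "sqn J x > 0" using sqn_nonneg[of J x] by linarith
  have "(1 - c) * sqn J x \<le> ip J x (gram M J u x)"
    unfolding ip_gram using assms by (auto simp: near_id_def)
  then have "((1 - c) * sqn J x)\<^sup>2 \<le> (ip J x (gram M J u x))\<^sup>2"
    using c pos by (intro power_mono) auto
  also have "\<dots> \<le> sqn J x * sqn J (gram M J u x)" by (rule ip_square_le)
  finally have "sqn J x * ((1 - c)\<^sup>2 * sqn J x) \<le> sqn J x * sqn J (gram M J u x)"
    by (simp add: power2_eq_square mult_ac)
  then show ?thesis using pos by simp
qed simp

lemma sqn_add_le: "0 < e \<Longrightarrow> sqn J (\<lambda>r. x r + y r) \<le> (1 + e) * sqn J x + (1 + 1 / e) * sqn J y"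
proof -
  assume e: "0 < e"
  have "(a + b)\<^sup>2 \<le> (1 + e) * a\<^sup>2 + (1 + 1 / e) * b\<^sup>2" for a b :: real
  proof -
    have "0 \<le> (e * a - b)\<^sup>2 / e" using e by simp
    also have "\<dots> = e * a\<^sup>2 - 2 * a * b + b\<^sup>2 / e"
      using e by (simp add: field_simps power2_eq_square)
    finally show ?thesis by (simp add: power2_eq_square algebra_simps)
  qed
  then show ?thesis
    unfolding sqn_def sum_distrib_left sum.distrib[symmetric] by (intro sum_mono)
qed

lemma sqn_add_le2: "sqn J (\<lambda>r. x r + y r) \<le> 2 * sqn J x + 2 * sqn J y"
  using sqn_add_le[of 1 J x y] by simp

lemma sqn_diff_le2: "sqn J (\<lambda>r. x r - y r) \<le> 2 * sqn J x + 2 * sqn J y"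
  using sqn_add_le2[of J x "\<lambda>r. - y r"] by (simp add: sqn_def)

lemma sqn_Un_disjoint: "finite A \<Longrightarrow> finite B \<Longrightarrow> A \<inter> B = {} \<Longrightarrow> sqn (A \<union> B) x = sqn A x + sqn B x"
  by (simp add: sqn_def sum.union_disjoint)

text \<open>Dictionary: \<open>a\<close>, \<open>b\<close> are the Y- and Z-parts of the squared
  coefficient error of iterate \<open>I\<close>, and \<open>a'\<close>, \<open>b'\<close> those of
  iterate \<open>I - 1\<close>; \<open>e\<close> is the squared norm of the difference of these two
  errors and \<open>d1\<close> that of the first error; \<open>Y'\<close> is the error at the next
  time, \<open>t1\<close> and \<open>tI\<close> the noise, \<open>q\<close> the squared norm of the
  first projected iterate. Only half of \<open>b\<close> survives, which pays for the
  driver.\<close>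

lemma one_step_arith:
  fixes h K g :: real
  assumes h: "0 < h" "h \<le> 1/8" and K: "0 \<le> K" "64 * K * h \<le> 1" and I: "2 \<le> I"
    and g: "g = 64 * K + 1" and L: "L = (8 * K) ^ (I - 1)"
    and n: "0 \<le> a" "0 \<le> b" "0 \<le> t1" "0 \<le> tI" "0 \<le> Y'" "0 \<le> q"
    and main: "(1 - h)\<^sup>2 * (a + b) \<le>
        (1 + g * h) * ((1 + h)\<^sup>2 * Y') + (1 + 1 / (g * h)) * (2 * tI + 4 * K * h * (h * a' + b'))"
    and a': "a' \<le> 2 * a + 2 * e" and b': "b' \<le> 2 * b + 2 * e"
    and e: "e \<le> 2 * (8 * K * h) ^ (I - 1) * (3 * q + 2 * d1)" and d1: "d1 \<le> 32 * Y' + 8 * t1"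
    and e0: "0 \<le> e"
  shows "a + b / 2 \<le> (1 + (2 * (4 * g + 3 + 64 * L) + 6) * h) * Y' +
    (8 + 32 * L) / h * (tI + t1) + (8 + 32 * L) * h ^ (I - 1) * q"
proof -
  have gpos: "g \<ge> 1" using K g by simp
  have L0: "L \<ge> 0" using K L by simp
  have hI: "h ^ (I - 1) \<le> h" using h I power_decreasing[of 1 "I - 1" h] by simp
  have hI0: "0 \<le> h ^ (I - 1)" using h by simp
  \<comment> \<open>Both summands \<open>4 * K * h\<close> and \<open>4 * K / g\<close> are at most
    1/16: the first by the smallness of \<open>h\<close>, the second by the choice of
    \<open>g\<close>.\<close>
  have c: "(1 + 1 / (g * h)) * (4 * K * h) \<le> 1/8"
  proof -
    have "(1 + 1 / (g * h)) * (4 * K * h) = 4 * K * h + 4 * K / g"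
      using gpos h by (simp add: field_simps)
    moreover have "4 * K / g \<le> 1/16" using gpos g by (simp add: field_simps)
    ultimately show ?thesis using K by simp
  qed
  have c2: "1 + 1 / (g * h) \<le> 2 / h"
  proof -
    have "1 / (g * h) \<le> 1 / h" using gpos h by (intro divide_left_mono) auto
    moreover have "1 \<le> 1 / h" using h by simp
    ultimately show ?thesis by (simp add: field_simps)
  qed
  have eL: "e \<le> 2 * L * h ^ (I - 1) * (3 * q + 64 * Y' + 16 * t1)"
  proof -
    have "e \<le> 2 * (8 * K * h) ^ (I - 1) * (3 * q + 2 * d1)" by (rule e)
    also have "\<dots> \<le> 2 * (8 * K * h) ^ (I - 1) * (3 * q + 64 * Y' + 16 * t1)"
      using d1 K h by (intro mult_left_mono) auto
    finally show ?thesis by (simp add: L power_mult_distrib)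
  qed
  define w where "w = 1 + 1 / (g * h)"
  have w0: "0 \<le> w * (4 * K * h)" using gpos h K by (simp add: w_def)
  have he: "h * e \<le> e" using h e0 by (intro mult_left_le_one_le) auto
  have ab': "w * (4 * K * h * (h * a' + b')) \<le> h * a / 4 + b / 4 + e / 2"
  proof -
    have le: "h * a' + b' \<le> h * (2 * a + 2 * e) + (2 * b + 2 * e)"
      using a' b' h by (intro add_mono mult_left_mono) auto
    have "w * (4 * K * h * (h * a' + b')) = w * (4 * K * h) * (h * a' + b')"
      by (simp only: mult.assoc)
    also have "\<dots> \<le> w * (4 * K * h) * (h * (2 * a + 2 * e) + (2 * b + 2 * e))"
      by (rule mult_left_mono[OF le w0])
    also have "\<dots> \<le> 1/8 * (h * (2 * a + 2 * e) + (2 * b + 2 * e))"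
      using n e0 h by (intro mult_right_mono[OF c[folded w_def]]) auto
    also have "\<dots> = h * a / 4 + b / 4 + (h * e + e) / 4" by (simp add: field_simps)
    also have "\<dots> \<le> h * a / 4 + b / 4 + e / 2"
      by (intro add_left_mono) (use he in \<open>simp add: mult.commute\<close>)
    finally show ?thesis .
  qed
  have tI: "w * (2 * tI) \<le> 4 / h * tI"
  proof -
    have "w * (2 * tI) \<le> 2 / h * (2 * tI)"
      by (rule mult_right_mono[OF c2[folded w_def]]) (use n in simp)
    then show ?thesis by simp
  qed
  have main2: "(1 - h)\<^sup>2 * (a + b) \<le>
      (1 + g * h) * ((1 + h)\<^sup>2 * Y') + 4 / h * tI + (h * a / 4 + b / 4 + e / 2)"
    using main[folded w_def, unfolded distrib_left[of w]] ab' tI by linarith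
  \<comment> \<open>The power of \<open>h\<close> is estimated in three ways: by \<open>h\<close> at
    \<open>Y'\<close>, which needs \<open>I\<close> at least 2 and keeps the growth factor 1 + O(h);
    by \<open>1 / h\<close> at the noise, which carries that factor anyway; and not at all at
    \<open>q\<close>.\<close>
  have eY: "e / 2 \<le> 64 * L * h * Y' + 16 * L / h * t1 + 3 * L * h ^ (I - 1) * q"
  proof -
    have "L * h ^ (I - 1) * (64 * Y') \<le> L * h * (64 * Y')"
      using hI n L0 by (intro mult_right_mono mult_left_mono) auto
    moreover have "h ^ (I - 1) \<le> 1 / h"
    proof -
      have "h ^ (I - 1) \<le> 1" using h by (intro power_le_one) auto
      also have "1 \<le> 1 / h" using h by simp
      finally show ?thesis .
    qed
    then have "L * h ^ (I - 1) * (16 * t1) \<le> L * (1 / h) * (16 * t1)"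
      using n L0 by (intro mult_right_mono mult_left_mono) auto
    moreover have "2 * L * h ^ (I - 1) * (3 * q + 64 * Y' + 16 * t1) =
        2 * (3 * L * h ^ (I - 1) * q) +
        2 * (L * h ^ (I - 1) * (64 * Y')) + 2 * (L * h ^ (I - 1) * (16 * t1))"
      by (simp add: algebra_simps)
    moreover have "L * h * (64 * Y') = 64 * L * h * Y'" "L * (1 / h) * (16 * t1) = 16 * L / h * t1"
      by simp_all
    ultimately show ?thesis using eL by linarith
  qed
  \<comment> \<open>The losses \<open>h * a / 4\<close> and \<open>b / 4\<close> caused by the
    driver are moved to the left; the quarter of \<open>b\<close> lost there fits into the half that
    is given up.\<close>
  have l: "(1 - 3 * h) * (a + b / 2) \<le> (1 - h)\<^sup>2 * (a + b) - h * a / 4 - b / 4"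
  proof -
    have "1 - 2 * h \<le> (1 - h)\<^sup>2" by (simp add: power2_eq_square algebra_simps)
    then have "(1 - 2 * h) * (a + b) \<le> (1 - h)\<^sup>2 * (a + b)" using n by (intro mult_right_mono) auto
    moreover have "0 \<le> h * a" "0 \<le> h * b" using h n by simp_all
    moreover have "h * b \<le> 1/8 * b" using h n by (intro mult_right_mono) auto
    moreover have "(1 - 2 * h) * (a + b) = a + b - 2 * (h * a) - 2 * (h * b)"
      "(1 - 3 * h) * (a + b / 2) = a + b / 2 - 3 * (h * a) - 3 / 2 * (h * b)"
          by (simp_all add: algebra_simps)
    ultimately show ?thesis using n by linarith
  qed
  have gY: "(1 + g * h) * (1 + h)\<^sup>2 \<le> 1 + (4 * g + 3) * h"
  proof -
    have hh: "h * h \<le> h / 8" using h mult_left_mono[of h "1/8" h] by simp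
    then have "(1 + h)\<^sup>2 \<le> 1 + 3 * h" using h by (simp add: power2_eq_square algebra_simps)
    then have "(1 + g * h) * (1 + h)\<^sup>2 \<le> (1 + g * h) * (1 + 3 * h)"
      using gpos h by (intro mult_left_mono) auto
    also have "\<dots> = 1 + g * h + 3 * h + 3 * g * (h * h)" by (simp add: algebra_simps)
    also have "3 * g * (h * h) \<le> 3 * g * (h / 8)" using gpos hh by (intro mult_left_mono) auto
    also have "1 + g * h + 3 * h + 3 * g * (h / 8) \<le> 1 + (4 * g + 3) * h"
      using mult_nonneg_nonneg[of g h] gpos h by (simp add: algebra_simps)
    finally show ?thesis by simp
  qed
  define c where "c = 4 * g + 3 + 64 * L"
  have c0: "0 \<le> c" using gpos L0 by (simp add: c_def)
  \<comment> \<open>The quotient of \<open>1 + c * h\<close> by \<open>1 - 3 * h\<close> is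
    \<open>1 + (c + 3) * h / (1 - 3 * h)\<close>, and \<open>1 / (1 - 3 * h)\<close> is at most
    2.\<close>
  have C1: "1 + c * h \<le> (1 - 3 * h) * (1 + (2 * c + 6) * h)"
  proof -
    have "3 * h * (2 * c + 6) \<le> 3 / 8 * (2 * c + 6)"
      using h c0 by (intro mult_right_mono) auto
    then have "0 \<le> h * (c + 3 - 3 * h * (2 * c + 6))" using h c0 by simp
    also have "\<dots> = (1 - 3 * h) * (1 + (2 * c + 6) * h) - (1 + c * h)"
      by (simp add: algebra_simps)
    finally show ?thesis by simp
  qed
  have tot: "(1 - 3 * h) * (a + b / 2) \<le>
      (1 + c * h) * Y' + (4 + 16 * L) / h * (tI + t1) + (4 + 16 * L) * h ^ (I - 1) * q"
  proof -
    have "(1 + g * h) * ((1 + h)\<^sup>2 * Y') \<le> (1 + (4 * g + 3) * h) * Y'"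
      using mult_right_mono[OF gY, of Y'] n by (simp only: mult.assoc)
    moreover have "4 / h * tI + 16 * L / h * t1 \<le> (4 + 16 * L) / h * (tI + t1)"
    proof -
      have "4 / h * tI \<le> (4 + 16 * L) / h * tI" "16 * L / h * t1 \<le> (4 + 16 * L) / h * t1"
        using n L0 h by (intro mult_right_mono divide_right_mono; simp)+
      then show ?thesis by (simp only: distrib_left add_mono)
    qed
    moreover have "3 * L * h ^ (I - 1) * q \<le> (4 + 16 * L) * h ^ (I - 1) * q"
      using n L0 hI0 by (intro mult_right_mono) auto
    moreover have "(1 + c * h) * Y' = (1 + (4 * g + 3) * h) * Y' + 64 * L * h * Y'"
      by (simp add: algebra_simps c_def)
    \<comment> \<open>The final combination is stated over plain variables, so that linear
      arithmetic sees atoms instead of products.\<close>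
    moreover have "A \<le> R + TV + W'"
      if "A \<le> B - p - r" "B \<le> P + T + (p + r + E)" "E \<le> U + V + W" "P \<le> P'" "T + V \<le> TV"
        "W \<le> W'" "R = P' + U" for A B p r P T E U V W P' TV W' R :: real
      using that by linarith
    ultimately show ?thesis using l main2 eY by blast
  qed
  have p: "1/2 \<le> 1 - 3 * h" using h by simp
  define R where "R = (4 + 16 * L) / h * (tI + t1) + (4 + 16 * L) * h ^ (I - 1) * q"
  have R0: "0 \<le> R" using n L0 h hI0 by (simp add: R_def)
  have "(1 + c * h) * Y' \<le> (1 - 3 * h) * ((1 + (2 * c + 6) * h) * Y')"
    using mult_right_mono[OF C1 n(5)] by (simp only: mult.assoc)
  moreover have "R \<le> (1 - 3 * h) * (2 * R)"
    using mult_right_mono[OF p, of "2 * R"] R0 by simp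
  moreover have "(1 - 3 * h) * (a + b / 2) \<le> (1 + c * h) * Y' + R"
    using tot by (simp only: R_def add.assoc)
  ultimately have "(1 - 3 * h) * (a + b / 2) \<le>
      (1 - 3 * h) * ((1 + (2 * c + 6) * h) * Y') + (1 - 3 * h) * (2 * R)"
    by (meson add_mono order_trans)
  then have "(1 - 3 * h) * (a + b / 2) \<le> (1 - 3 * h) * ((1 + (2 * c + 6) * h) * Y' + 2 * R)"
    by (simp only: distrib_left[of "1 - 3 * h" "(1 + (2 * c + 6) * h) * Y'" "2 * R"])
  then have fin: "a + b / 2 \<le> (1 + (2 * c + 6) * h) * Y' + 2 * R"
    by (rule mult_left_le_imp_le) (use p in simp)
  have R2: "2 * R = (8 + 32 * L) / h * (tI + t1) + (8 + 32 * L) * h ^ (I - 1) * q"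
  proof -
    have d: "2 * (x * s + y * q) = (2 * x) * s + (2 * y) * q" for x y s :: real
      by (simp add: algebra_simps)
    have "2 * ((4 + 16 * L) / h) = (8 + 32 * L) / h" "2 * ((4 + 16 * L) * h ^ (I - 1)) =
        (8 + 32 * L) * h ^ (I - 1)"
      by (simp_all add: field_simps)
    then show ?thesis unfolding R_def d by (simp only:)
  qed
  show ?thesis using fin unfolding R2 c_def add.assoc .
qed

section \<open>The backward error recursion\<close>

text \<open>A deterministic statement: \<open>\<phi>\<close> and \<open>\<phi>'\<close> are the
  drivers along the samples at the projected and the empirical iterates, \<open>y\<close> and
  \<open>y'\<close> the values at the next time. The projected coefficients \<open>\<theta>\<close>
  solve no empirical equation, and \<open>\<tau>\<close> records by how much they fail. The constant
  \<open>K\<close> comes from the Lipschitz bounds \<open>lip\<close> and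
  \<open>lip'\<close>.\<close>

lemma one_step:
  fixes v :: "nat \<Rightarrow> 'i \<Rightarrow> real" and \<theta> \<theta>' :: "nat \<Rightarrow> 'i \<Rightarrow> real" and \<phi> \<phi>' :: "nat \<Rightarrow> nat \<Rightarrow> real"
    and y y' :: "nat \<Rightarrow> real"
  assumes J: "finite J0" "finite J1" "J0 \<inter> J1 = {}" "J = J0 \<union> J1"
    and h: "0 < h" "h \<le> 1/8" and K: "0 \<le> K" "64 * K * h \<le> 1" and I: "2 \<le> I"
    and near: "near_id M J v h" and Y0: "0 \<le> Y'"
    and start: "\<And>r. r \<in> J \<Longrightarrow> \<theta> 0 r = 0" "\<And>r. r \<in> J \<Longrightarrow> \<theta>' 0 r = 0"
    and sim: "\<And>i r. 1 \<le> i \<Longrightarrow> i \<le> I \<Longrightarrow> r \<in> J \<Longrightarrow>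
      gram M J v (\<theta>' i) r = avg M (\<lambda>m. v m r * (y' m + h * \<phi>' (i - 1) m))"
    and D: "avg M (\<lambda>m. (y m - y' m)\<^sup>2) \<le> (1 + h) * Y'"
    and lip: "\<And>i. i < I \<Longrightarrow> h\<^sup>2 * avg M (\<lambda>m. (\<phi> i m - \<phi>' i m)\<^sup>2) \<le>
      K * h * (h * sqn J0 (\<lambda>r. \<theta> i r - \<theta>' i r) + sqn J1 (\<lambda>r. \<theta> i r - \<theta>' i r))"
    and lip': "\<And>i. 1 \<le> i \<Longrightarrow> i < I \<Longrightarrow> h\<^sup>2 * avg M (\<lambda>m. (\<phi>' i m - \<phi>' (i - 1) m)\<^sup>2) \<le>
      K * h * (h * sqn J0 (\<lambda>r. \<theta>' i r - \<theta>' (i - 1) r) + sqn J1 (\<lambda>r. \<theta>' i r - \<theta>' (i - 1) r))"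
    and proj: "sqn J (\<lambda>r. \<theta> I r - \<theta> (I - 1) r) \<le> (8 * K * h) ^ (I - 1) * sqn J (\<theta> 1)"
    and \<tau>: "\<And>i r. \<tau> i r = avg M (\<lambda>m. v m r * (ip J (v m) (\<theta> i) - (y m + h * \<phi> (i - 1) m)))"
    and L: "L = (8 * K) ^ (I - 1)"
  shows "sqn J0 (\<lambda>r. \<theta> I r - \<theta>' I r) + sqn J1 (\<lambda>r. \<theta> I r - \<theta>' I r) / 2 \<le>
    (1 + (2 * (4 * (64 * K + 1) + 3 + 64 * L) + 6) * h) * Y' +
    (8 + 32 * L) / h * (sqn J (\<tau> I) + sqn J (\<tau> 1)) + (8 + 32 * L) * h ^ (I - 1) * sqn J (\<theta> 1)"
proof -
  define d where "d = (\<lambda>i r. \<theta> i r - \<theta>' i r)"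
  have sqnJ: "sqn J x = sqn J0 x + sqn J1 x" for x
    unfolding J(4) by (rule sqn_Un_disjoint[OF J(1-3)])
  have hq: "1/4 \<le> (1 - h)\<^sup>2" "1/2 \<le> (1 - h)\<^sup>2" "(1 + h)\<^sup>2 \<le> 2" "1 + h \<le> 2"
  proof -
    have "(7/8)\<^sup>2 \<le> (1 - h)\<^sup>2" using h by (intro power_mono) auto
    then show "1/4 \<le> (1 - h)\<^sup>2" "1/2 \<le> (1 - h)\<^sup>2" by (simp_all add: power2_eq_square)
    have "(1 + h)\<^sup>2 \<le> (9/8)\<^sup>2" using h by (intro power_mono) auto
    then show "(1 + h)\<^sup>2 \<le> 2" by (simp add: power2_eq_square)
  qed (use h in simp)
  have h0: "0 \<le> h" "h \<le> 1" using h by auto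
  have Kh: "0 \<le> K * h" using K h by simp
  have scal: "avg M (\<lambda>m. (h * f m)\<^sup>2) = h\<^sup>2 * avg M (\<lambda>m. (f m)\<^sup>2)" for f
    by (simp add: power_mult_distrib avg_mult)
  define \<beta> where "\<beta> = (\<lambda>r. avg M (\<lambda>m. v m r * (y m - y' m)))"
  define \<psi> where "\<psi> = (\<lambda>i r. avg M (\<lambda>m. v m r * (h * (\<phi> (i - 1) m - \<phi>' (i - 1) m))))"
  have b: "sqn J \<beta> \<le> (1 + h)\<^sup>2 * Y'"
  proof -
    have "sqn J \<beta> \<le> (1 + h) * avg M (\<lambda>m. (y m - y' m)\<^sup>2)"
      unfolding \<beta>_def by (rule sqn_avg_le[OF near h0(1)])
    also have "\<dots> \<le> (1 + h) * ((1 + h) * Y')" using D h by (intro mult_left_mono) auto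
    finally show ?thesis by (simp add: power2_eq_square mult.assoc)
  qed
  have ps: "sqn J (\<psi> i) \<le> 2 * K * h * (h * sqn J0 (d (i - 1)) + sqn J1 (d (i - 1)))" if "1 \<le>
      i" "i \<le> I" for i
  proof -
    have nn: "0 \<le> K * h * (h * sqn J0 (d (i - 1)) + sqn J1 (d (i - 1)))"
      using K h by (intro mult_nonneg_nonneg add_nonneg_nonneg) auto
    have "sqn J (\<psi> i) \<le> (1 + h) * avg M (\<lambda>m. (h * (\<phi> (i - 1) m - \<phi>' (i - 1) m))\<^sup>2)"
      unfolding \<psi>_def by (rule sqn_avg_le[OF near h0(1)])
    also have "\<dots> \<le> (1 + h) * (K * h * (h * sqn J0 (d (i - 1)) + sqn J1 (d (i - 1))))"
      unfolding scal d_def using lip[of "i - 1"] h that by (intro mult_left_mono) auto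
    also have "\<dots> \<le> 2 * (K * h * (h * sqn J0 (d (i - 1)) + sqn J1 (d (i - 1))))"
      by (rule mult_right_mono[OF hq(4) nn])
    finally show ?thesis by (simp only: mult.assoc)
  qed
  \<comment> \<open>The Young parameter \<open>e\<close> stays free: it is 1 for the first iterate,
    where a constant factor is harmless, and \<open>(64 * K + 1) * h\<close> for the last
    one.\<close>
  have key: "(1 - h)\<^sup>2 * sqn J (d i) \<le> (1 + e) * ((1 + h)\<^sup>2 * Y') +
      (1 + 1 / e) * (2 * sqn J (\<tau> i) + 4 * K * h * (h * sqn J0 (d (i - 1)) + sqn J1 (d (i - 1))))"
    if i: "1 \<le> i" "i \<le> I" and e: "0 < e" for i e
  proof -
    have "gram M J v (d i) r = \<beta> r + (\<tau> i r + \<psi> i r)" if "r \<in> J" for r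
    proof -
      have "gram M J v (\<theta> i) r = avg M (\<lambda>m. v m r * ip J (v m) (\<theta> i))"
        by (simp add: gram_def)
      then show ?thesis
        unfolding d_def gram_diff sim[OF i that] \<tau> \<beta>_def \<psi>_def avg_add[symmetric]
            avg_diff[symmetric]
        by (simp add: avg_add[symmetric] avg_diff[symmetric] algebra_simps)
    qed
    then have "sqn J (gram M J v (d i)) = sqn J (\<lambda>r. \<beta> r + (\<tau> i r + \<psi> i r))"
      by (intro sqn_cong) auto
    then have "(1 - h)\<^sup>2 * sqn J (d i) \<le> sqn J (\<lambda>r. \<beta> r + (\<tau> i r + \<psi> i r))"
      using sqn_gram_ge[OF near h0(2), of "d i"] by simp
    also have "\<dots> \<le> (1 + e) * sqn J \<beta> + (1 + 1 / e) * sqn J (\<lambda>r. \<tau> i r + \<psi> i r)"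
      by (rule sqn_add_le[OF e])
    also have "\<dots> \<le> (1 + e) * ((1 + h)\<^sup>2 * Y') +
      (1 + 1 / e) * (2 * sqn J (\<tau> i) + 4 * K * h * (h * sqn J0 (d (i - 1)) + sqn J1 (d (i - 1))))"
    proof (intro add_mono mult_left_mono b)
      have "sqn J (\<lambda>r. \<tau> i r + \<psi> i r) \<le> 2 * sqn J (\<tau> i) + 2 * sqn J (\<psi> i)" by (rule sqn_add_le2)
      with ps[OF i] show "sqn J (\<lambda>r. \<tau> i r + \<psi> i r) \<le> 2 * sqn J (\<tau> i) +
          4 * K * h * (h * sqn J0 (d (i - 1)) + sqn J1 (d (i - 1)))"
        by (simp add: mult.assoc)
    qed (use e in auto)
    finally show ?thesis .
  qed
  \<comment> \<open>Both Picard iterations start from 0, so the driver contributes nothing to the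
    first error.\<close>
  have d1: "sqn J (d 1) \<le> 32 * Y' + 8 * sqn J (\<tau> 1)"
  proof -
    have "sqn J0 (d 0) = 0" "sqn J1 (d 0) = 0"
      using start J by (auto simp: d_def sqn_def)
    then have "(1 - h)\<^sup>2 * sqn J (d 1) \<le> 2 * ((1 + h)\<^sup>2 * Y') + 4 * sqn J (\<tau> 1)"
      using key[of 1 1] I by simp
    moreover have "1/2 * sqn J (d 1) \<le> (1 - h)\<^sup>2 * sqn J (d 1)"
      by (rule mult_right_mono[OF hq(2)]) simp
    moreover have "(1 + h)\<^sup>2 * Y' \<le> 2 * Y'" by (rule mult_right_mono[OF hq(3) Y0])
    ultimately show ?thesis using Y0 by linarith
  qed
  define \<delta> where "\<delta> = (\<lambda>i r. \<theta>' i r - \<theta>' (i - 1) r)"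
  \<comment> \<open>Subtracting consecutive normal equations removes \<open>y'\<close> and leaves
    only the driver difference. The rate 8 is 2 from \<open>1 + h\<close> times 4 from inverting
    \<open>(1 - h)\<^sup>2\<close>.\<close>
  have contr: "sqn J (\<delta> (Suc i)) \<le> 8 * K * h * sqn J (\<delta> i)" if i: "1 \<le> i" "i < I" for i
  proof -
    have "gram M J v (\<delta> (Suc i)) r =
        avg M (\<lambda>m. v m r * (h * (\<phi>' i m - \<phi>' (i - 1) m)))" if r: "r \<in> J" for r
      using sim[of "Suc i" r] sim[of i r] i r unfolding \<delta>_def gram_diff
      by (simp add: avg_diff[symmetric] algebra_simps)
    then have "sqn J (gram M J v (\<delta> (Suc i))) =
        sqn J (\<lambda>r. avg M (\<lambda>m. v m r * (h * (\<phi>' i m - \<phi>' (i - 1) m))))"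
      by (intro sqn_cong) auto
    also have "\<dots> \<le> (1 + h) * avg M (\<lambda>m. (h * (\<phi>' i m - \<phi>' (i - 1) m))\<^sup>2)"
      by (rule sqn_avg_le[OF near h0(1)])
    also have "\<dots> \<le> 2 * (K * h * (h * sqn J0 (\<delta> i) + sqn J1 (\<delta> i)))"
      unfolding scal \<delta>_def
      by (rule mult_mono[OF hq(4) lip'[OF i]]) (auto intro!: mult_nonneg_nonneg avg_nonneg)
    also have "\<dots> \<le> 2 * (K * h * sqn J (\<delta> i))"
    proof -
      have "h * sqn J0 (\<delta> i) \<le> sqn J0 (\<delta> i)" using h by (intro mult_left_le_one_le) auto
      then show ?thesis unfolding sqnJ using Kh by (intro mult_left_mono) auto
    qed
    finally have "(1 - h)\<^sup>2 * sqn J (\<delta> (Suc i)) \<le> 2 * (K * h * sqn J (\<delta> i))"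
      using sqn_gram_ge[OF near h0(2), of "\<delta> (Suc i)"] by linarith
    moreover have "1/4 * sqn J (\<delta> (Suc i)) \<le> (1 - h)\<^sup>2 * sqn J (\<delta> (Suc i))"
      by (rule mult_right_mono[OF hq(1)]) simp
    ultimately show ?thesis by (simp add: mult.assoc)
  qed
  have pw: "sqn J (\<delta> (Suc i)) \<le> (8 * K * h) ^ i * sqn J (\<delta> 1)" if "i < I" for i
    using that
  proof (induction i)
    case (Suc i)
    have "sqn J (\<delta> (Suc (Suc i))) \<le> 8 * K * h * sqn J (\<delta> (Suc i))"
      using contr[of "Suc i"] Suc.prems by simp
    also have "\<dots> \<le> 8 * K * h * ((8 * K * h) ^ i * sqn J (\<delta> 1))"
      using Suc Kh by (intro mult_left_mono) auto
    finally show ?case by (simp only: power_Suc mult.assoc)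
  qed simp
  define e where "e = sqn J (\<lambda>r. d I r - d (I - 1) r)"
  \<comment> \<open>The change of the error between the last two iterates is the difference of two
    Picard increments, and both are small. The first empirical increment is
    \<open>\<theta> 1 - d 1\<close>, whence the combination of \<open>\<theta> 1\<close> and
    \<open>d 1\<close>.\<close>
  have e: "e \<le> 2 * (8 * K * h) ^ (I - 1) * (3 * sqn J (\<theta> 1) + 2 * sqn J (d 1))"
  proof -
    have "e = sqn J (\<lambda>r. (\<theta> I r - \<theta> (I - 1) r) - \<delta> I r)"
      unfolding e_def d_def \<delta>_def by (intro sqn_cong) simp
    also have "\<dots> \<le> 2 * sqn J (\<lambda>r. \<theta> I r - \<theta> (I - 1) r) + 2 * sqn J (\<delta> I)" by (rule sqn_diff_le2)
    also have "\<dots> \<le> 2 * ((8 * K * h) ^ (I - 1) * sqn J (\<theta> 1)) +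
        2 * ((8 * K * h) ^ (I - 1) * sqn J (\<delta> 1))"
      using proj pw[of "I - 1"] I by (intro add_mono mult_left_mono) auto
    also have "\<dots> = 2 * (8 * K * h) ^ (I - 1) * (sqn J (\<theta> 1) + sqn J (\<delta> 1))"
      by (simp add: algebra_simps)
    also have "\<dots> \<le> 2 * (8 * K * h) ^ (I - 1) * (3 * sqn J (\<theta> 1) + 2 * sqn J (d 1))"
    proof (rule mult_left_mono)
      have "sqn J (\<delta> 1) = sqn J (\<lambda>r. \<theta> 1 r - d 1 r)"
        using start by (intro sqn_cong) (simp add: \<delta>_def d_def)
      then show "sqn J (\<theta> 1) + sqn J (\<delta> 1) \<le> 3 * sqn J (\<theta> 1) + 2 * sqn J (d 1)"
        using sqn_diff_le2[of J "\<theta> 1" "d 1"] by simp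
    qed (use K h in simp)
    finally show ?thesis .
  qed
  have split: "sqn A (d (I - 1)) \<le> 2 * sqn A (d I) + 2 * sqn A (\<lambda>r. d I r - d (I - 1) r)" for A
    using sqn_diff_le2[of A "d I" "\<lambda>r. d I r - d (I - 1) r"] by simp
  have e0: "sqn J0 (\<lambda>r. d I r - d (I - 1) r) \<le> e" "sqn J1 (\<lambda>r. d I r - d (I - 1) r) \<le> e" "0 \<le> e"
    unfolding e_def sqnJ by auto
  have g: "0 < (64 * K + 1) * h" using K h by simp
  have "sqn J0 (d I) + sqn J1 (d I) / 2 \<le> (1 + (2 * (4 * (64 * K + 1) + 3 + 64 * L) + 6) * h) * Y' +
    (8 + 32 * L) / h * (sqn J (\<tau> I) + sqn J (\<tau> 1)) + (8 + 32 * L) * h ^ (I - 1) * sqn J (\<theta> 1)"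
  proof (rule one_step_arith[OF h K I refl L])
    show "(1 - h)\<^sup>2 * (sqn J0 (d I) + sqn J1 (d I)) \<le> (1 + (64 * K + 1) * h) * ((1 + h)\<^sup>2 * Y') +
      (1 + 1 / ((64 * K + 1) * h)) * (2 * sqn J (\<tau> I) + 4 * K * h * (h * sqn J0 (d (I - 1)) +
          sqn J1 (d (I - 1))))"
      using key[OF _ _ g, of I] I unfolding sqnJ[of "d I"] by simp
    show "sqn J0 (d (I - 1)) \<le> 2 * sqn J0 (d I) + 2 * e" using split[of J0] e0 by linarith
    show "sqn J1 (d (I - 1)) \<le> 2 * sqn J1 (d I) + 2 * e" using split[of J1] e0 by linarith
  qed (use e e0 d1 Y0 in auto)
  then show ?thesis unfolding d_def .
qed

text \<open>The sum of the later \<open>z\<close> travels through the induction together with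
  \<open>y\<close>, which only costs further factors \<open>1 + c\<close> on the right. The factor 2
  undoes the halving of \<open>z\<close>. With \<open>c\<close> of order 1/N the exponential does
  not depend on the number of steps.\<close>

lemma backward_Gronwall:
  fixes y z R :: "nat \<Rightarrow> real"
  assumes step: "\<And>j. k \<le> j \<Longrightarrow> j < N \<Longrightarrow> y j + z j / 2 \<le> (1 + c) * y (Suc j) + R j"
    and "y N = 0" "0 \<le> c" "k \<le> N"
    and nn: "\<And>j. 0 \<le> y j" "\<And>j. 0 \<le> z j" "\<And>j. 0 \<le> R j"
  shows "y k + (\<Sum>j=k..<N. z j) \<le> 2 * exp (c * real N) * (\<Sum>j=k..<N. R j)"
proof -
  have "y k + (\<Sum>j=k..<N. z j) / 2 \<le> (1 + c) ^ (N - k) * (\<Sum>j=k..<N. R j)"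
    using \<open>k \<le> N\<close> step
  proof (induction k rule: inc_induct)
    case base
    then show ?case using \<open>y N = 0\<close> by simp
  next
    case (step n)
    have IH: "y (Suc n) + (\<Sum>j=Suc n..<N. z j) / 2 \<le> (1 + c) ^ (N - Suc n) * (\<Sum>j=Suc n..<N. R j)"
      using step by simp
    have zs: "0 \<le> (\<Sum>j=Suc n..<N. z j)" "0 \<le> (\<Sum>j=Suc n..<N. R j)" using nn
        by (auto intro: sum_nonneg)
    have "y n + (\<Sum>j=n..<N. z j) / 2 = y n + z n / 2 + (\<Sum>j=Suc n..<N. z j) / 2"
      using step.hyps by (simp add: sum.atLeast_Suc_lessThan add_divide_distrib)
    also have "\<dots> \<le> (1 + c) * y (Suc n) + R n + (1 + c) * ((\<Sum>j=Suc n..<N. z j) / 2)"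
      by (rule add_mono) (use step.prems[of n] step.hyps \<open>0 \<le> c\<close> zs
          mult_right_mono[of 1 "1 + c" "(\<Sum>j=Suc n..<N. z j) / 2"] in auto)
    also have "\<dots> = (1 + c) * (y (Suc n) + (\<Sum>j=Suc n..<N. z j) / 2) + R n"
        by (simp add: algebra_simps)
    also have "\<dots> \<le> (1 + c) * ((1 + c) ^ (N - Suc n) * (\<Sum>j=Suc n..<N. R j)) + (1 +
        c) ^ (N - n) * R n"
      using IH \<open>0 \<le> c\<close> nn(3)[of n] mult_right_mono[of 1 "(1 + c) ^ (N - n)" "R n"]
      by (intro add_mono mult_left_mono) (auto simp: one_le_power)
    also have "\<dots> = (1 + c) ^ (N - n) * (\<Sum>j=n..<N. R j)"
      using step.hyps by (simp add: sum.atLeast_Suc_lessThan algebra_simps Suc_diff_Suc[symmetric])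
    finally show ?case .
  qed
  also have "\<dots> \<le> exp (c * real N) * (\<Sum>j=k..<N. R j)"
  proof (rule mult_right_mono)
    have "(1 + c) ^ (N - k) \<le> (1 + c) ^ N" using \<open>0 \<le> c\<close> by (intro power_increasing) auto
    also have "\<dots> \<le> exp c ^ N" using \<open>0 \<le> c\<close> by (intro power_mono exp_ge_add_one_self) auto
    also have "\<dots> = exp (c * real N)" by (simp add: exp_of_nat2_mult)
    finally show "(1 + c) ^ (N - k) \<le> exp (c * real N)" .
  qed (use nn in \<open>auto intro: sum_nonneg\<close>)
  finally show ?thesis using nn(1)[of k] by (simp add: mult.assoc)
qed

section \<open>Least squares, independence and decoupling\<close>

lemma integrable_mult_of_squares:
  fixes f g :: "'a \<Rightarrow> real"
  assumes [measurable]: "f \<in> borel_measurable M" "g \<in> borel_measurable M"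
    and "integrable M (\<lambda>x. (f x)\<^sup>2)" "integrable M (\<lambda>x. (g x)\<^sup>2)"
  shows "integrable M (\<lambda>x. f x * g x)"
proof (rule Bochner_Integration.integrable_bound)
  show "integrable M (\<lambda>x. (f x)\<^sup>2 + (g x)\<^sup>2)" using assms by simp
  have "\<bar>a * b\<bar> \<le> a\<^sup>2 + b\<^sup>2" for a b :: real
  proof -
    have "2 * (\<bar>a\<bar> * \<bar>b\<bar>) \<le> a\<^sup>2 + b\<^sup>2" using sum_squares_bound[of "\<bar>a\<bar>" "\<bar>b\<bar>"] by simp
    moreover have "0 \<le> \<bar>a\<bar> * \<bar>b\<bar>" by simp
    ultimately show ?thesis unfolding abs_mult by linarith
  qed
  then show "AE x in M. norm (f x * g x) \<le> norm ((f x)\<^sup>2 + (g x)\<^sup>2)"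
    by (intro AE_I2) (simp add: abs_of_nonneg)
qed simp

lemma integrable_square_add:
  fixes f g :: "'a \<Rightarrow> real"
  assumes [measurable]: "f \<in> borel_measurable M" "g \<in> borel_measurable M"
    and "integrable M (\<lambda>x. (f x)\<^sup>2)" "integrable M (\<lambda>x. (g x)\<^sup>2)"
  shows "integrable M (\<lambda>x. (f x + g x)\<^sup>2)"
  unfolding power2_sum using assms integrable_mult_of_squares[OF assms] by (simp add: mult.assoc)

lemma integrable_square_scale:
  fixes f :: "'a \<Rightarrow> real"
  shows "integrable M (\<lambda>x. (f x)\<^sup>2) \<Longrightarrow> integrable M (\<lambda>x. (c * f x)\<^sup>2)"
  by (simp add: power_mult_distrib)

lemma integrable_square_diff:
  fixes f g :: "'a \<Rightarrow> real"
  assumes "f \<in> borel_measurable M" "g \<in> borel_measurable M"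
    and "integrable M (\<lambda>x. (f x)\<^sup>2)" "integrable M (\<lambda>x. (g x)\<^sup>2)"
  shows "integrable M (\<lambda>x. (f x - g x)\<^sup>2)"
  using integrable_square_add[of f M "\<lambda>x. - g x"] assms by simp

lemma integrable_square_sum:
  fixes f :: "'i \<Rightarrow> 'a \<Rightarrow> real"
  assumes "finite J" "\<And>r. r \<in> J \<Longrightarrow> f r \<in> borel_measurable M"
    and "\<And>r. r \<in> J \<Longrightarrow> integrable M (\<lambda>x. (f r x)\<^sup>2)"
  shows "integrable M (\<lambda>x. (\<Sum>r\<in>J. f r x)\<^sup>2)"
  using assms by (induction J rule: finite_induct)
      (auto intro!: integrable_square_add borel_measurable_sum)

lemma borel_measurable_ip [measurable (raw)]:
  assumes "\<And>r. r \<in> J \<Longrightarrow> (\<lambda>\<omega>. v \<omega> r) \<in> borel_measurable M" "\<And>r. r \<in> J \<Longrightarrow>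
      (\<lambda>\<omega>. w \<omega> r) \<in> borel_measurable M"
  shows "(\<lambda>\<omega>. ip J (v \<omega>) (w \<omega>)) \<in> borel_measurable M"
  unfolding ip_def using assms by measurable

lemma borel_measurable_sqn [measurable (raw)]:
  assumes "\<And>r. r \<in> J \<Longrightarrow> (\<lambda>\<omega>. v \<omega> r) \<in> borel_measurable M"
  shows "(\<lambda>\<omega>. sqn J (v \<omega>)) \<in> borel_measurable M"
  unfolding sqn_def using assms by measurable

lemma integrable_ip_square:
  assumes "finite J" "\<And>r. r \<in> J \<Longrightarrow> (\<lambda>\<omega>. v \<omega> r) \<in> borel_measurable M"
    and "\<And>r. r \<in> J \<Longrightarrow> integrable M (\<lambda>\<omega>. (v \<omega> r)\<^sup>2)"
  shows "integrable M (\<lambda>\<omega>. (ip J (v \<omega>) x)\<^sup>2)"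
  unfolding ip_def using assms
  by (intro integrable_square_sum) (auto simp: power_mult_distrib)

lemma ip_upd: "finite J \<Longrightarrow> r \<in> J \<Longrightarrow> ip J v (\<lambda>s. x s + (if s = r then t else 0)) = ip J v x + t * v r"
  by (simp add: ip_def distrib_left sum.distrib if_distrib[where f="\<lambda>c. _ * c"] mult.commute cong:
      if_cong)

text \<open>Minimality is given for values in [0, infinity]. Perturbing the coordinate
  \<open>r\<close> alone keeps all of them finite, and they become a real quadratic polynomial in
  \<open>t\<close> whose linear coefficient has to vanish.\<close>

lemma least_squares_integral:
  assumes J: "finite J" "r \<in> J" and v: "\<And>r. r \<in> J \<Longrightarrow> (\<lambda>\<omega>. v \<omega> r) \<in> borel_measurable M"
      "\<And>r. r \<in> J \<Longrightarrow> integrable M (\<lambda>\<omega>. (v \<omega> r)\<^sup>2)"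
    and g: "g \<in> borel_measurable M" "integrable M (\<lambda>\<omega>. (g \<omega>)\<^sup>2)"
    and min: "\<And>x. (\<integral>\<^sup>+\<omega>. ennreal ((g \<omega> - ip J (v \<omega>) x0)\<^sup>2) \<partial>M) \<le>
        (\<integral>\<^sup>+\<omega>. ennreal ((g \<omega> - ip J (v \<omega>) x)\<^sup>2) \<partial>M)"
  shows "(\<integral>\<omega>. v \<omega> r * (g \<omega> - ip J (v \<omega>) x0) \<partial>M) = 0"
proof -
  define u where "u = (\<lambda>\<omega>. g \<omega> - ip J (v \<omega>) x0)"
  have u: "u \<in> borel_measurable M" "integrable M (\<lambda>\<omega>. (u \<omega>)\<^sup>2)"
    unfolding u_def using J v g by (auto intro!: integrable_square_diff integrable_ip_square)
  have uv: "integrable M (\<lambda>\<omega>. v \<omega> r * u \<omega>)"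
    by (intro integrable_mult_of_squares u v J)
  let ?D = "\<integral>\<omega>. (v \<omega> r)\<^sup>2 \<partial>M" and ?B = "- (\<integral>\<omega>. v \<omega> r * u \<omega> \<partial>M)"
  have "?B = 0"
  proof (rule quadratic_min_linear_zero)
    fix t
    let ?w = "\<lambda>\<omega>. g \<omega> - ip J (v \<omega>) (\<lambda>s. x0 s + (if s = r then t else 0))"
    have w: "(?w \<omega>)\<^sup>2 = (u \<omega>)\<^sup>2 - 2 * t * (v \<omega> r * u \<omega>) + t\<^sup>2 * (v \<omega> r)\<^sup>2" for \<omega>
      unfolding ip_upd[OF J] u_def by (simp add: power2_eq_square algebra_simps)
    have wi: "integrable M (\<lambda>\<omega>. (?w \<omega>)\<^sup>2)"
      unfolding w using u uv v J by simp
    have "ennreal (\<integral>\<omega>. (u \<omega>)\<^sup>2 \<partial>M) \<le> ennreal (\<integral>\<omega>. (?w \<omega>)\<^sup>2 \<partial>M)"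
      using min[of "\<lambda>s. x0 s + (if s = r then t else 0)"] u wi
      by (simp add: nn_integral_eq_integral u_def)
    then have "(\<integral>\<omega>. (u \<omega>)\<^sup>2 \<partial>M) \<le> (\<integral>\<omega>. (?w \<omega>)\<^sup>2 \<partial>M)"
      by (subst (asm) ennreal_le_iff) auto
    also have "\<dots> = (\<integral>\<omega>. (u \<omega>)\<^sup>2 \<partial>M) + 2 * t * ?B + t\<^sup>2 * ?D"
      unfolding w using u uv v J by simp
    finally show "0 \<le> 2 * t * ?B + t\<^sup>2 * ?D" by simp
  qed
  then show ?thesis by (simp add: u_def)
qed

text \<open>The same first-order condition for the empirical measure. It holds for every minimizer,
  whichever one has been selected.\<close>

lemma least_squares_avg:
  assumes J: "finite J" "r \<in> J"
    and min: "\<And>x. avg M (\<lambda>m. (g m - ip J (v m) x0)\<^sup>2) \<le> avg M (\<lambda>m. (g m - ip J (v m) x)\<^sup>2)"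
  shows "gram M J v x0 r = avg M (\<lambda>m. v m r * g m)"
proof -
  define u where "u = (\<lambda>m. g m - ip J (v m) x0)"
  let ?D = "avg M (\<lambda>m. (v m r)\<^sup>2)" and ?B = "- avg M (\<lambda>m. v m r * u m)"
  have "?B = 0"
  proof (rule quadratic_min_linear_zero)
    fix t
    let ?w = "\<lambda>m. g m - ip J (v m) (\<lambda>s. x0 s + (if s = r then t else 0))"
    have w: "(?w m)\<^sup>2 = (u m)\<^sup>2 - 2 * t * (v m r * u m) + t\<^sup>2 * (v m r)\<^sup>2" for m
      unfolding ip_upd[OF J] u_def by (simp add: power2_eq_square algebra_simps)
    show "0 \<le> 2 * t * ?B + t\<^sup>2 * ?D"
      using min[of "\<lambda>s. x0 s + (if s = r then t else 0)"]
      unfolding w by (simp add: avg_add avg_diff avg_mult u_def)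
  qed
  then show ?thesis by (simp add: u_def gram_def avg_diff algebra_simps)
qed

section \<open>Orthonormal families of random variables\<close>

definition orthonormal_on :: "'a measure \<Rightarrow> 'i set \<Rightarrow> ('a \<Rightarrow> 'i \<Rightarrow> real) \<Rightarrow> bool" where
  "orthonormal_on M J v \<longleftrightarrow> (\<forall>r\<in>J. (\<lambda>\<omega>. v \<omega> r) \<in> borel_measurable M) \<and>
     (\<forall>r\<in>J. \<forall>s\<in>J. integrable M (\<lambda>\<omega>. v \<omega> r * v \<omega> s) \<and> (\<integral>\<omega>. v \<omega> r * v \<omega> s \<partial>M) = id_mat r s)"

lemma orthonormal_onD:
  assumes "orthonormal_on M J v" "r \<in> J"
  shows "(\<lambda>\<omega>. v \<omega> r) \<in> borel_measurable M" "integrable M (\<lambda>\<omega>. (v \<omega> r)\<^sup>2)" "(\<integral>\<omega>. (v \<omega> r)\<^sup>2 \<partial>M) = 1"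
    "s \<in> J \<Longrightarrow> integrable M (\<lambda>\<omega>. v \<omega> r * v \<omega> s)" "s \<in> J \<Longrightarrow> (\<integral>\<omega>. v \<omega> r * v \<omega> s \<partial>M) = id_mat r s"
  using assms by (auto simp: orthonormal_on_def power2_eq_square id_mat_def)

lemma sum_id_mat: "finite J \<Longrightarrow> r \<in> J \<Longrightarrow> (\<Sum>s\<in>J. id_mat r s * x s) = (x r :: real)"
  by (simp add: id_mat_def if_distrib[where f="\<lambda>c. c * _"] cong: if_cong)

lemma orthonormal_mult_ip:
  assumes o: "orthonormal_on M J v" and J: "finite J" "r \<in> J"
  shows "integrable M (\<lambda>\<omega>. v \<omega> r * ip J (v \<omega>) x)" "(\<integral>\<omega>. v \<omega> r * ip J (v \<omega>) x \<partial>M) = x r"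
proof -
  have eq: "v \<omega> r * ip J (v \<omega>) x = (\<Sum>s\<in>J. v \<omega> r * v \<omega> s * x s)" for \<omega>
    by (simp add: ip_def sum_distrib_left mult.assoc)
  have i: "integrable M (\<lambda>\<omega>. v \<omega> r * v \<omega> s * x s)" if "s \<in> J" for s
    using orthonormal_onD(4)[OF o J(2) that] by simp
  show "integrable M (\<lambda>\<omega>. v \<omega> r * ip J (v \<omega>) x)"
    unfolding eq using i by (rule Bochner_Integration.integrable_sum)
  have "(\<integral>\<omega>. v \<omega> r * ip J (v \<omega>) x \<partial>M) = (\<Sum>s\<in>J. id_mat r s * x s)"
    unfolding eq using i orthonormal_onD(5)[OF o J(2)]
    by (simp add: Bochner_Integration.integral_sum)
  then show "(\<integral>\<omega>. v \<omega> r * ip J (v \<omega>) x \<partial>M) = x r" using J by (simp add: sum_id_mat)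
qed

lemma orthonormal_ip_square:
  assumes o: "orthonormal_on M J v" and J: "finite J"
  shows "integrable M (\<lambda>\<omega>. (ip J (v \<omega>) x)\<^sup>2)" "(\<integral>\<omega>. (ip J (v \<omega>) x)\<^sup>2 \<partial>M) = sqn J x"
proof -
  have eq: "(ip J (v \<omega>) x)\<^sup>2 = (\<Sum>r\<in>J. x r * (v \<omega> r * ip J (v \<omega>) x))" for \<omega>
    by (simp add: power2_eq_square ip_def sum_distrib_right mult_ac)
  note i = orthonormal_mult_ip[OF o J]
  show "integrable M (\<lambda>\<omega>. (ip J (v \<omega>) x)\<^sup>2)"
    unfolding eq using i by (intro Bochner_Integration.integrable_sum) simp
  show "(\<integral>\<omega>. (ip J (v \<omega>) x)\<^sup>2 \<partial>M) = sqn J x"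
    unfolding eq using i by (simp add: Bochner_Integration.integral_sum sqn_def power2_eq_square)
qed

text \<open>Expansion of the nonnegative mean square of \<open>g\<close> minus its projection. It
  serves as the population counterpart of \<open>sqn_avg_le\<close>, with constant 1.\<close>

lemma Bessel:
  assumes o: "orthonormal_on M J v" and J: "finite J"
    and g: "g \<in> borel_measurable M" "integrable M (\<lambda>\<omega>. (g \<omega>)\<^sup>2)"
  shows "sqn J (\<lambda>r. \<integral>\<omega>. v \<omega> r * g \<omega> \<partial>M) \<le> (\<integral>\<omega>. (g \<omega>)\<^sup>2 \<partial>M)"
proof -
  define w where "w = (\<lambda>r. \<integral>\<omega>. v \<omega> r * g \<omega> \<partial>M)"
  have i: "integrable M (\<lambda>\<omega>. v \<omega> r * g \<omega>)" if "r \<in> J" for r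
    using orthonormal_onD(1,2)[OF o that] g by (intro integrable_mult_of_squares) auto
  have eq: "ip J (v \<omega>) w * g \<omega> = (\<Sum>r\<in>J. w r * (v \<omega> r * g \<omega>))" for \<omega>
    by (simp add: ip_def sum_distrib_right sum_distrib_left mult_ac)
  have ig: "integrable M (\<lambda>\<omega>. ip J (v \<omega>) w * g \<omega>)"
    unfolding eq using i by (intro Bochner_Integration.integrable_sum) simp
  have iw: "(\<integral>\<omega>. ip J (v \<omega>) w * g \<omega> \<partial>M) = sqn J w"
    unfolding eq using i by (simp add: Bochner_Integration.integral_sum sqn_def power2_eq_square
        w_def)
  have "0 \<le> (\<integral>\<omega>. (g \<omega> - ip J (v \<omega>) w)\<^sup>2 \<partial>M)" by simp
  also have "\<dots> = (\<integral>\<omega>. (g \<omega>)\<^sup>2 - 2 * (ip J (v \<omega>) w * g \<omega>) + (ip J (v \<omega>) w)\<^sup>2 \<partial>M)"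
    by (simp add: power2_diff algebra_simps)
  also have "\<dots> = (\<integral>\<omega>. (g \<omega>)\<^sup>2 \<partial>M) - sqn J w"
    using g ig iw orthonormal_ip_square[OF o J, of w] by simp
  finally show ?thesis by (simp add: w_def)
qed

text \<open>Variance of a mean of independent centred copies. Only integrability of \<open>Y\<close>
  is assumed: if its second moment is infinite, so is the right side, and otherwise the mixed terms
  vanish by independence.\<close>

lemma (in prob_space) nn_integral_avg_square_le:
  assumes ind: "indep_vars (\<lambda>_. borel) X {1..n}" and n: "n \<ge> 1"
    and d: "\<And>m. m \<in> {1..n} \<Longrightarrow> distr M borel (X m) = distr M borel Y"
    and Y: "integrable M Y" "expectation Y = 0"
  shows "(\<integral>\<^sup>+\<omega>. ennreal ((avg n (\<lambda>m. X m \<omega>))\<^sup>2) \<partial>M) \<le>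
      ennreal (1 / real n) * (\<integral>\<^sup>+\<omega>. ennreal ((Y \<omega>)\<^sup>2) \<partial>M)"
proof (cases "(\<integral>\<^sup>+\<omega>. ennreal ((Y \<omega>)\<^sup>2) \<partial>M) = \<infinity>")
  case True
  then show ?thesis using n by (simp add: ennreal_mult_top)
next
  case False
  have mX: "X m \<in> borel_measurable M" if "m \<in> {1..n}" for m
    using ind that unfolding indep_vars_def by auto
  have mY [measurable]: "Y \<in> borel_measurable M" using Y by auto
  have Y2: "integrable M (\<lambda>\<omega>. (Y \<omega>)\<^sup>2)"
    using False by (intro integrableI_nonneg) (auto simp: less_top)
  have tr: "integrable M (\<lambda>\<omega>. \<phi> (X m \<omega>)) \<longleftrightarrow> integrable M (\<lambda>\<omega>. \<phi> (Y \<omega>))"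
       "(\<integral>\<omega>. \<phi> (X m \<omega>) \<partial>M) = (\<integral>\<omega>. \<phi> (Y \<omega>) \<partial>M)"
    if "m \<in> {1..n}" "\<phi> \<in> borel_measurable borel" for m and \<phi> :: "real \<Rightarrow> real"
    using integrable_distr_eq[OF mX[OF that(1)] that(2)] integrable_distr_eq[OF mY that(2)]
      integral_distr[OF mX[OF that(1)] that(2)] integral_distr[OF mY that(2)] d[OF that(1)]
          by simp_all
  have X1: "integrable M (X m)" "expectation (X m) = 0" if "m \<in> {1..n}" for m
    using tr[OF that, of "\<lambda>x. x"] Y by simp_all
  have X2: "integrable M (\<lambda>\<omega>. (X m \<omega>)\<^sup>2)" "expectation (\<lambda>\<omega>. (X m \<omega>)\<^sup>2) = expectation (\<lambda>\<omega>. (Y \<omega>)\<^sup>2)"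
    if "m \<in> {1..n}" for m
    using tr[OF that, of "\<lambda>x. x\<^sup>2"] Y2 by simp_all
  have XX: "integrable M (\<lambda>\<omega>. X a \<omega> * X b \<omega>)" if "a \<in> {1..n}" "b \<in> {1..n}" for a b
    using that by (intro integrable_mult_of_squares mX X2)
  have X0: "expectation (\<lambda>\<omega>. X a \<omega> * X b \<omega>) = (if a = b then expectation (\<lambda>\<omega>. (Y \<omega>)\<^sup>2) else 0)"
    if ab: "a \<in> {1..n}" "b \<in> {1..n}" for a b
  proof (cases "a = b")
    case True
    then show ?thesis using X2(2)[OF ab(1)] by (simp add: power2_eq_square)
  next
    case False
    have "indep_vars (\<lambda>_. borel) X {a, b}"
      using ab by (intro indep_vars_subset[OF ind]) auto
    then have "expectation (\<lambda>\<omega>. \<Prod>i\<in>{a, b}. X i \<omega>) = (\<Prod>i\<in>{a, b}. expectation (X i))"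
      using X1(1) ab by (intro indep_vars_lebesgue_integral) auto
    then show ?thesis using X1(2)[OF ab(1)] False by simp
  qed
  have sq: "(avg n (\<lambda>m. X m \<omega>))\<^sup>2 = (\<Sum>a=1..n. \<Sum>b=1..n. X a \<omega> * X b \<omega>) / (real n)\<^sup>2" for \<omega>
    by (simp add: avg_def power_divide power2_eq_square sum_product)
  have int: "integrable M (\<lambda>\<omega>. (avg n (\<lambda>m. X m \<omega>))\<^sup>2)"
    unfolding sq using XX by (intro Bochner_Integration.integrable_divide
        Bochner_Integration.integrable_sum) auto
  have "expectation (\<lambda>\<omega>. (avg n (\<lambda>m. X m \<omega>))\<^sup>2) =
      (\<Sum>a=1..n. \<Sum>b=1..n. expectation (\<lambda>\<omega>. X a \<omega> * X b \<omega>)) / (real n)\<^sup>2"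
  proof -
    have "expectation (\<lambda>\<omega>. \<Sum>a=1..n. \<Sum>b=1..n. X a \<omega> * X b \<omega>) =
        (\<Sum>a=1..n. expectation (\<lambda>\<omega>. \<Sum>b=1..n. X a \<omega> * X b \<omega>))"
      by (rule Bochner_Integration.integral_sum) (intro Bochner_Integration.integrable_sum XX)
    also have "\<dots> = (\<Sum>a=1..n. \<Sum>b=1..n. expectation (\<lambda>\<omega>. X a \<omega> * X b \<omega>))"
      by (intro sum.cong refl Bochner_Integration.integral_sum XX)
    finally show ?thesis unfolding sq by simp
  qed
  also have "(\<Sum>a=1..n. \<Sum>b=1..n. expectation (\<lambda>\<omega>. X a \<omega> * X b \<omega>)) =
      real n * expectation (\<lambda>\<omega>. (Y \<omega>)\<^sup>2)"
    using X0 by simp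
  finally have "expectation (\<lambda>\<omega>. (avg n (\<lambda>m. X m \<omega>))\<^sup>2) = 1 / real n * expectation (\<lambda>\<omega>. (Y \<omega>)\<^sup>2)"
    using n by (simp add: power2_eq_square)
  then show ?thesis
    using int Y2 by (simp add: nn_integral_eq_integral ennreal_mult[symmetric])
qed

text \<open>Brownian increments are independent of the natural filtration, while the Markov chain is
  adapted to the augmented one. Every set of the augmented sigma-algebra agrees almost everywhere
  with a set of \<open>A\<close>, so probabilities do not change.\<close>

lemma (in prob_space) indep_set_null_sets:
  assumes A: "sigma_algebra (space M) A" and i: "indep_set A B"
  shows "indep_set (sigma_sets (space M) (A \<union> null_sets M)) B"
proof -
  interpret A: sigma_algebra "space M" A by (rule A)
  from i have sub: "A \<subseteq> events" "B \<subseteq> events"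
      by (auto simp: indep_set_def indep_sets_def split: bool.splits)
  \<comment> \<open>Induction over the generated sigma-algebra; the complement and union cases use
    that \<open>A\<close> is itself a sigma-algebra.\<close>
  have approx: "S \<in> events \<and> (\<exists>a\<in>A. AE \<omega> in M. \<omega> \<in> S \<longleftrightarrow> \<omega> \<in> a)"
    if "S \<in> sigma_sets (space M) (A \<union> null_sets M)" for S
    using that
  proof induction
    case (Basic S)
    then show ?case
    proof
      assume "S \<in> A" then show ?thesis using sub by auto
    next
      assume S: "S \<in> null_sets M"
      then have "AE \<omega> in M. \<omega> \<in> S \<longleftrightarrow> \<omega> \<in> {}" using AE_not_in[OF S] by simp
      then show ?thesis using S by blast
    qed
  next
    case Empty then show ?case by auto
  next
    case (Compl S)
    then obtain a where a: "a \<in> A" "AE \<omega> in M. \<omega> \<in> S \<longleftrightarrow> \<omega> \<in> a" by blast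
    from a(2) AE_space have "AE \<omega> in M. \<omega> \<in> space M - S \<longleftrightarrow> \<omega> \<in> space M - a" by eventually_elim auto
    then show ?case using a Compl by blast
  next
    case (Union S)
    then obtain a where a: "\<And>n. a n \<in> A" "\<And>n. AE \<omega> in M. \<omega> \<in> S n \<longleftrightarrow> \<omega> \<in> a n" by metis
    have "AE \<omega> in M. \<forall>n. \<omega> \<in> S n \<longleftrightarrow> \<omega> \<in> a n" using a(2) by (simp add: AE_all_countable)
    then have "AE \<omega> in M. \<omega> \<in> (\<Union>n. S n) \<longleftrightarrow> \<omega> \<in> (\<Union>n. a n)" by eventually_elim auto
    moreover have "(\<Union>n. a n) \<in> A" using a by blast
    moreover have "(\<Union>n. S n) \<in> events" using Union by blast
    ultimately show ?case by blast
  qed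
  show ?thesis
  proof (rule indep_setI)
    show "sigma_sets (space M) (A \<union> null_sets M) \<subseteq> events" using approx by blast
    show "B \<subseteq> events" by (rule sub)
    fix S b assume S: "S \<in> sigma_sets (space M) (A \<union> null_sets M)" and b: "b \<in> B"
    from approx[OF S] obtain a where S': "S \<in> events" and a: "a \<in> A" "AE \<omega> in M. \<omega> \<in> S \<longleftrightarrow> \<omega> \<in> a"
        by blast
    have bE: "b \<in> events" "a \<in> events" using b a sub by auto
    have "prob (S \<inter> b) = prob (a \<inter> b)"
      using a(2) S' bE by (intro finite_measure_eq_AE) auto
    also have "\<dots> = prob a * prob b" by (rule indep_setD[OF i a(1) b])
    also have "prob a = prob S" using a(2) S' bE by (intro finite_measure_eq_AE) auto
    finally show "prob (S \<inter> b) = prob S * prob b" .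
  qed
qed

lemma (in prob_space) indep_varI_indep_set:
  assumes "indep_set A B" and X: "X \<in> measurable M S" "Y \<in> measurable M T"
    and "\<And>D. D \<in> sets S \<Longrightarrow> X -` D \<inter> space M \<in> A" "\<And>D. D \<in> sets T \<Longrightarrow> Y -` D \<inter> space M \<in> B"
  shows "indep_var S X T Y"
  unfolding indep_var_eq
proof (intro conjI X)
  have "sigma_sets (space M) {X -` D \<inter> space M |D. D \<in> sets S} = {X -` D \<inter> space M |D. D \<in> sets S}"
    unfolding sets_vimage_algebra[symmetric]
    by (rule sets_vimage_algebra2) (use measurable_space[OF X(1)] in blast)
  moreover have "sigma_sets (space M) {Y -` D \<inter> space M |D. D \<in> sets T} =
      {Y -` D \<inter> space M |D. D \<in> sets T}"
    unfolding sets_vimage_algebra[symmetric]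
    by (rule sets_vimage_algebra2) (use measurable_space[OF X(2)] in blast)
  moreover have "indep_set {X -` D \<inter> space M |D. D \<in> sets S} {Y -` D \<inter> space M |D. D \<in> sets T}"
  proof (rule indep_setI)
    fix a b assume "a \<in> {X -` D \<inter> space M |D. D \<in> sets S}" "b \<in> {Y -` D \<inter> space M |D. D \<in> sets T}"
    then show "prob (a \<inter> b) = prob a * prob b"
      using assms(4,5) by (intro indep_setD[OF assms(1)]) blast+
  qed (use X in \<open>auto intro: measurable_sets\<close>)
  ultimately show "indep_set (sigma_sets (space M) {X -` A \<inter> space M |A. A \<in> sets S})
     (sigma_sets (space M) {Y -` A \<inter> space M |A. A \<in> sets T})" by simp
qed

lemma (in prob_space) indep_set_distr_pair:
  assumes ind: "indep_set A B" and X: "X \<in> measurable M S" "Y \<in> measurable M T"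
    and XA: "\<And>D. D \<in> sets S \<Longrightarrow> X -` D \<inter> space M \<in> A"
    and YB: "\<And>D. D \<in> sets T \<Longrightarrow> Y -` D \<inter> space M \<in> B"
  shows "distr M S X \<Otimes>\<^sub>M distr M T Y = distr M (S \<Otimes>\<^sub>M T) (\<lambda>\<omega>. (X \<omega>, Y \<omega>))"
proof (rule pair_measure_eqI)
  interpret S: prob_space "distr M S X" by (rule prob_space_distr[OF X(1)])
  interpret T: prob_space "distr M T Y" by (rule prob_space_distr[OF X(2)])
  show "sigma_finite_measure (distr M S X)" "sigma_finite_measure (distr M T Y)"
    by unfold_locales
  show "sets (distr M S X \<Otimes>\<^sub>M distr M T Y) = sets (distr M (S \<Otimes>\<^sub>M T) (\<lambda>\<omega>. (X \<omega>, Y \<omega>)))"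
    by (simp cong: sets_pair_measure_cong)
  fix D E assume D: "D \<in> sets (distr M S X)" and E: "E \<in> sets (distr M T Y)"
  have XY: "(\<lambda>\<omega>. (X \<omega>, Y \<omega>)) \<in> measurable M (S \<Otimes>\<^sub>M T)" using X by measurable
  have "(\<lambda>\<omega>. (X \<omega>, Y \<omega>)) -` (D \<times> E) \<inter> space M = (X -` D \<inter> space M) \<inter> (Y -` E \<inter> space M)" by blast
  then have "emeasure (distr M (S \<Otimes>\<^sub>M T) (\<lambda>\<omega>. (X \<omega>, Y \<omega>))) (D \<times> E) =
      emeasure M ((X -` D \<inter> space M) \<inter> (Y -` E \<inter> space M))"
    using D E by (subst emeasure_distr[OF XY]) auto
  also have "\<dots> = emeasure M (X -` D \<inter> space M) * emeasure M (Y -` E \<inter> space M)"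
    using D E indep_setD[OF ind XA YB, of D E]
        by (simp add: emeasure_eq_measure ennreal_mult[symmetric])
  finally show "emeasure (distr M S X) D * emeasure (distr M T Y) E =
      emeasure (distr M (S \<Otimes>\<^sub>M T) (\<lambda>\<omega>. (X \<omega>, Y \<omega>))) (D \<times> E)"
    using D E X by (simp add: emeasure_distr)
qed

lemma (in prob_space) decoupled_square:
  fixes U :: "'a \<Rightarrow> 'i \<Rightarrow> real"
  assumes J: "finite J" and ind: "indep_set A B"
    and U: "(\<lambda>\<omega>. \<lambda>r\<in>J. U \<omega> r) \<in> measurable M (PiM J (\<lambda>_. borel))" and X: "X \<in> measurable M S"
    and UA: "\<And>D. D \<in> sets (PiM J (\<lambda>_. borel)) \<Longrightarrow> (\<lambda>\<omega>. \<lambda>r\<in>J. U \<omega> r) -` D \<inter> space M \<in> A"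
    and XB: "\<And>D. D \<in> sets S \<Longrightarrow> X -` D \<inter> space M \<in> B"
    and f: "\<And>r. r \<in> J \<Longrightarrow> f r \<in> borel_measurable S"
    and o: "orthonormal_on M J (\<lambda>\<omega> r. f r (X \<omega>))"
  shows "(\<integral>\<^sup>+\<omega>. ennreal ((\<Sum>r\<in>J. U \<omega> r * f r (X \<omega>))\<^sup>2) \<partial>M) = (\<integral>\<^sup>+\<omega>. ennreal (sqn J (U \<omega>)) \<partial>M)"
proof -
  let ?B = "PiM J (\<lambda>_. borel) :: ('i \<Rightarrow> real) measure" and ?U = "\<lambda>\<omega>. \<lambda>r\<in>J. U \<omega> r"
  have eq: "distr M ?B ?U \<Otimes>\<^sub>M distr M S X = distr M (?B \<Otimes>\<^sub>M S) (\<lambda>\<omega>. (?U \<omega>, X \<omega>))"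
    by (intro indep_set_distr_pair[OF ind U X] UA XB)
  interpret B: prob_space "distr M ?B ?U" by (rule prob_space_distr[OF U])
  interpret S: prob_space "distr M S X" by (rule prob_space_distr[OF X])
  have [measurable]: "f r \<in> borel_measurable S" if "r \<in> J" for r by (rule f[OF that])
  define F where "F = (\<lambda>(u, x). ennreal ((\<Sum>r\<in>J. u r * f r x)\<^sup>2))"
  have F: "F \<in> borel_measurable (?B \<Otimes>\<^sub>M S)"
    unfolding F_def by measurable
  have "(\<lambda>u. sqn J u) \<in> borel_measurable ?B" unfolding sqn_def by measurable
  then have m: "(\<lambda>u. ennreal (sqn J u)) \<in> borel_measurable ?B"
    by (rule measurable_compose[OF _ measurable_ennreal])
  have inner: "(\<integral>\<^sup>+x. F (u, x) \<partial>distr M S X) = ennreal (sqn J u)" if u: "u \<in> space ?B" for u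
  proof -
    have "(\<integral>\<^sup>+x. F (u, x) \<partial>distr M S X) = (\<integral>\<^sup>+\<omega>. F (u, X \<omega>) \<partial>M)"
      using u F X by (intro nn_integral_distr) (auto intro: measurable_compose_Pair1)
    also have "\<dots> = (\<integral>\<^sup>+\<omega>. ennreal ((ip J (\<lambda>r. f r (X \<omega>)) u)\<^sup>2) \<partial>M)"
      by (simp add: F_def ip_def mult.commute)
    also have "\<dots> = ennreal (sqn J u)"
      using orthonormal_ip_square[OF o J, of u] by (simp add: nn_integral_eq_integral)
    finally show ?thesis .
  qed
  have "(\<integral>\<^sup>+\<omega>. ennreal ((\<Sum>r\<in>J. U \<omega> r * f r (X \<omega>))\<^sup>2) \<partial>M) = (\<integral>\<^sup>+\<omega>. F (?U \<omega>, X \<omega>) \<partial>M)"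
    by (simp add: F_def)
  also have "\<dots> = (\<integral>\<^sup>+z. F z \<partial>distr M (?B \<Otimes>\<^sub>M S) (\<lambda>\<omega>. (?U \<omega>, X \<omega>)))"
    using U X F by (subst nn_integral_distr) auto
  also have "\<dots> = (\<integral>\<^sup>+u. \<integral>\<^sup>+x. F (u, x) \<partial>distr M S X \<partial>distr M ?B ?U)"
    unfolding eq[symmetric] using F by (intro S.nn_integral_fst[symmetric]) simp
  also have "\<dots> = (\<integral>\<^sup>+u. ennreal (sqn J u) \<partial>distr M ?B ?U)"
    by (intro nn_integral_cong) (simp add: inner)
  also have "\<dots> = (\<integral>\<^sup>+\<omega>. ennreal (sqn J (?U \<omega>)) \<partial>M)"
    by (rule nn_integral_distr[OF U]) (use m in simp)
  also have "\<dots> = (\<integral>\<^sup>+\<omega>. ennreal (sqn J (U \<omega>)) \<partial>M)" by (simp add: sqn_def)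
  finally show ?thesis .
qed

section \<open>Function bases and the driver\<close>

definition vecs :: "'x basis \<Rightarrow> 'x \<Rightarrow> nat \<Rightarrow> real" where
  "vecs p x = (\<lambda>i. (p ! i) x)"

lemma bdot_eq_ip: "bdot a p x = ip {..<length p} (vecs p x) a"
  by (simp add: bdot_def ip_def vecs_def mult.commute)

lemma bdot_diff: "bdot a p x - bdot a' p x = bdot (\<lambda>i. a i - a' i) p x"
  by (simp add: bdot_def sum_subtractf left_diff_distrib)

lemma bnorm_square: "(bnorm p x)\<^sup>2 = sqn {..<length p} (vecs p x)"
  by (simp add: bnorm_def L2_set_def sqn_def vecs_def sum_nonneg)

lemma bdot_square_le: "(bdot a p x)\<^sup>2 \<le> (bnorm p x)\<^sup>2 * sqn {..<length p} a"
  unfolding bdot_eq_ip bnorm_square by (rule ip_square_le)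

definition scl :: "real \<Rightarrow> 'q option \<Rightarrow> real" where
  "scl h l = (case l of None \<Rightarrow> 1 | Some _ \<Rightarrow> sqrt h)"

text \<open>In the coordinates \<open>(\<alpha>\<^sub>0, sqrt h \<alpha>\<^sub>1, \<dots>, sqrt h \<alpha>\<^sub>q)\<close>,
    both schemes are regressions on the vector \<open>v\<^sub>k\<close>,
  whose population Gram matrix is the identity.\<close>

definition cvec :: "real \<Rightarrow> 'q coeffs \<Rightarrow> 'q option \<times> nat \<Rightarrow> real" where
  "cvec h a = (\<lambda>(l, i). scl h l * a l i)"

definition idx0 :: "('q option \<Rightarrow> 'x basis) \<Rightarrow> ('q option \<times> nat) set" where
  "idx0 p = {None} \<times> {..<length (p None)}"

definition idx1 :: "('q option \<Rightarrow> 'x basis) \<Rightarrow> ('q option \<times> nat) set" where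
  "idx1 p = (SIGMA l:range Some. {..<length (p l)})"

lemma finite_idx:
  fixes p :: "('q::finite) option \<Rightarrow> 'x basis"
  shows "finite (idx0 p)" "finite (idx1 p)" "finite (v_index p)"
  by (auto simp: idx0_def idx1_def v_index_def)

lemma idx_disjoint: "idx0 p \<inter> idx1 p = {}"
  by (auto simp: idx0_def idx1_def)

lemma v_index_eq: "v_index p = idx0 p \<union> idx1 p"
  by (auto simp: v_index_def idx0_def idx1_def notin_range_Some)

lemma sqn_v_index:
  fixes p :: "('q::finite) option \<Rightarrow> 'x basis"
  shows "sqn (v_index p) x = sqn (idx0 p) x + sqn (idx1 p) x"
  unfolding v_index_eq by (rule sqn_Un_disjoint[OF finite_idx(1,2) idx_disjoint])

lemma sum_option: "(\<Sum>l\<in>UNIV. g l) =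
    g None + (\<Sum>l\<in>UNIV. g (Some l))" for g :: "('q::finite) option \<Rightarrow> real"
  by (simp add: UNIV_option_conv sum.reindex)

lemma sum_v_index:
  fixes p :: "('q::finite) option \<Rightarrow> 'x basis" and g :: "'q option \<times> nat \<Rightarrow> real"
  shows "(\<Sum>r\<in>v_index p. g r) =
      (\<Sum>i<length (p None). g (None, i)) + (\<Sum>l\<in>UNIV. \<Sum>i<length (p (Some l)). g (Some l, i))"
proof -
  have "(\<Sum>r\<in>v_index p. g r) = (\<Sum>l\<in>UNIV. \<Sum>i<length (p l). g (l, i))"
    unfolding v_index_def by (subst sum.Sigma) auto
  then show ?thesis by (simp add: sum_option)
qed

lemma cvec_diff: "cvec h a r - cvec h a' r = cvec h (\<lambda>l i. a l i - a' l i) r"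
  by (cases r) (simp add: cvec_def right_diff_distrib)

lemma sqn_idx0_cvec: "sqn (idx0 p) (cvec h a) = sqn {..<length (p None)} (a None)"
proof -
  have "idx0 p = Pair None ` {..<length (p None)}" by (auto simp: idx0_def)
  then show ?thesis by (simp add: sqn_def sum.reindex inj_on_def cvec_def scl_def)
qed

lemma sqn_idx1_cvec:
  fixes p :: "('q::finite) option \<Rightarrow> 'x basis"
  assumes "0 \<le> h"
  shows "sqn (idx1 p) (cvec h a) = h * (\<Sum>l\<in>UNIV. sqn {..<length (p (Some l))} (a (Some l)))"
proof -
  have "sqn (idx1 p) (cvec h a) = (\<Sum>l\<in>range Some. \<Sum>i<length (p l). (scl h l * a l i)\<^sup>2)"
    unfolding sqn_def idx1_def by (subst sum.Sigma) (auto simp: cvec_def split_def)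
  also have "\<dots> = (\<Sum>l\<in>UNIV. \<Sum>i<length (p (Some l)). (sqrt h * a (Some l) i)\<^sup>2)"
    by (subst sum.reindex) (auto simp: scl_def)
  also have "\<dots> = (\<Sum>l\<in>UNIV. \<Sum>i<length (p (Some l)). h * (a (Some l) i)\<^sup>2)"
    using assms by (simp add: power_mult_distrib)
  finally show ?thesis by (simp add: sqn_def sum_distrib_left)
qed

lemma cvec_surj:
  assumes "0 < h"
  obtains a where "cvec h a = x"
proof
  show "cvec h (\<lambda>l i. x (l, i) / scl h l) = x"
    using assms by (auto simp: cvec_def scl_def fun_eq_iff split: option.splits)
qed

text \<open>The factor \<open>sqrt h\<close> in \<open>cvec\<close> cancels the one in
  \<open>v_vec\<close>. The minimizations of both schemes thereby become ordinary least squares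
  problems with regressor \<open>v_vec\<close>.\<close>

lemma residual_eq:
  fixes p :: "nat \<Rightarrow> ('q::finite) option \<Rightarrow> ('d::finite) state basis"
  assumes "0 < h"
  shows "residual f h k p ap a y x dw =
    (y + h * driver f (real k * h) (p k) ap x) - ip (v_index (p k)) (v_vec h (p k) x dw) (cvec h a)"
proof -
  have "ip (v_index (p k)) (v_vec h (p k) x dw) (cvec h a) =
    bdot (a None) (p k None) x + (\<Sum>l\<in>UNIV. bdot (a (Some l)) (p k (Some l)) x * dw $ l)"
    using assms unfolding ip_def sum_v_index
    by (simp add: v_vec_def cvec_def scl_def bdot_def sum_distrib_right sum_distrib_left mult_ac)
  then show ?thesis by (simp add: residual_def)
qed

lemma norm_vec_square: "(norm (x :: real^'n))\<^sup>2 = (\<Sum>l\<in>UNIV. (x $ l)\<^sup>2)"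
  by (simp add: norm_vec_def L2_set_def sum_nonneg)

lemma norm_matrix_vector_mult_le: "norm (A *v x) \<le> norm A * norm x" for A :: "real^'n^'m"
proof -
  have "(norm (A *v x))\<^sup>2 = (\<Sum>i\<in>UNIV. (A $ i \<bullet> x)\<^sup>2)"
    by (simp add: norm_vec_square matrix_vector_mult_def inner_vec_def)
  also have "\<dots> \<le> (\<Sum>i\<in>UNIV. (norm (A $ i))\<^sup>2 * (norm x)\<^sup>2)"
    by (intro sum_mono) (metis Cauchy_Schwarz_ineq2 abs_ge_zero power2_abs power_mono
        power_mult_distrib)
  also have "\<dots> = (norm A * norm x)\<^sup>2"
    by (simp add: norm_vec_def[of A] L2_set_def sum_nonneg power_mult_distrib sum_distrib_right)
  finally show ?thesis by (rule power2_le_imp_le) simp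
qed

lemma abs_le_imp_square_le: "\<bar>x\<bar> \<le> y \<Longrightarrow> x\<^sup>2 \<le> (y::real)\<^sup>2"
  using power_mono[of "\<bar>x\<bar>" y 2] by simp

lemma square_add3_le: "((a::real) + b + c)\<^sup>2 \<le> 3 * (a\<^sup>2 + b\<^sup>2 + c\<^sup>2)"
proof -
  have "0 \<le> (a - b)\<^sup>2 + (b - c)\<^sup>2 + (a - c)\<^sup>2" by simp
  then show ?thesis by (simp add: power2_eq_square algebra_simps)
qed

lemma square_add2_le: "((a::real) + b)\<^sup>2 \<le> 2 * (a\<^sup>2 + b\<^sup>2)"
proof -
  have "0 \<le> (a - b)\<^sup>2" by simp
  then show ?thesis by (simp add: power2_eq_square algebra_simps)
qed

lemma (in prob_space) normal_moments:
  assumes "0 < s" "distributed M lborel X (normal_density 0 s)"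
  shows "integrable M X" "expectation X =
      0" "integrable M (\<lambda>\<omega>. (X \<omega>)\<^sup>2)" "expectation (\<lambda>\<omega>. (X \<omega>)\<^sup>2) = s\<^sup>2"
proof -
  show "integrable M X"
    using integrable_normal_moment_nz_1[OF assms(1), of 0]
    by (rule distributed_integrable_var[OF assms(2), rotated]) simp
  show 0: "expectation X = 0" by (rule normal_distributed_expectation[OF assms])
  have "integrable lborel (\<lambda>x. normal_density 0 s x * x\<^sup>2)"
    using integrable_normal_moment[OF assms(1), of 0 2] by simp
  then show "integrable M (\<lambda>\<omega>. (X \<omega>)\<^sup>2)"
    by (subst (asm) distributed_integrable[OF assms(2), of "\<lambda>x. x\<^sup>2"]) auto
  show "expectation (\<lambda>\<omega>. (X \<omega>)\<^sup>2) = s\<^sup>2"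
    using normal_distributed_variance[OF assms] 0 by simp
qed

locale Lipschitz_driver =
  fixes T Cf :: real and f :: "real \<Rightarrow> real^'d::finite \<Rightarrow> real \<Rightarrow> real^'q::finite \<Rightarrow> real"
  assumes T: "T > 0"
    and f_Lip: "\<And>t1 t2 x1 x2 y1 y2 z1 z2. t1 \<in> {0..T} \<Longrightarrow> t2 \<in> {0..T} \<Longrightarrow>
           \<bar>f t2 x2 y2 z2 - f t1 x1 y1 z1\<bar>
             \<le> Cf * (sqrt \<bar>t2 - t1\<bar> + norm (x2 - x1) + \<bar>y2 - y1\<bar> + norm (z2 - z1))"
begin

lemma Cf_nonneg: "0 \<le> Cf"
  using order_trans[OF abs_ge_zero f_Lip[of 0 0 0 1 0 0 0 0]] T by simp

lemma f_measurable:
  assumes t: "t \<in> {0..T}"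
  shows "(\<lambda>(x, y, z). f t x y z) \<in> borel_measurable borel"
proof (rule borel_measurable_continuous_onI)
  have d: "\<bar>f t x2 y2 z2 - f t x1 y1 z1\<bar> \<le>
      Cf * 3 * dist (x2, y2, z2) (x1, y1, z1)" for x1 x2 y1 y2 z1 z2
  proof -
    let ?D = "dist (x2, y2, z2) (x1, y1, z1)"
    have "norm (x2 - x1) \<le> ?D" "\<bar>y2 - y1\<bar> \<le> ?D" "norm (z2 - z1) \<le> ?D"
      using dist_fst_le[of "(x2, y2, z2)" "(x1, y1, z1)"] dist_snd_le[of "(x2, y2, z2)"
          "(x1, y1, z1)"]
        dist_fst_le[of "(y2, z2)" "(y1, z1)"] dist_snd_le[of "(y2, z2)" "(y1, z1)"]
      by (auto simp: dist_norm[symmetric] dist_real_def[symmetric])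
    then have "sqrt \<bar>t - t\<bar> + norm (x2 - x1) + \<bar>y2 - y1\<bar> + norm (z2 - z1) \<le> 3 * ?D" by simp
    from mult_left_mono[OF this Cf_nonneg] f_Lip[OF t t, of x2 y2 z2 x1 y1 z1] show ?thesis by simp
  qed
  have "(Cf * 3)-lipschitz_on UNIV (\<lambda>(x, y, z). f t x y z)"
    using Cf_nonneg d by (intro lipschitz_onI) (auto simp: dist_real_def)
  then show "continuous_on UNIV (\<lambda>(x, y, z). f t x y z)"
    by (rule lipschitz_on_continuous_on)
qed

lemma driver_measurable:
  assumes t: "t \<in> {0..T}" and p: "\<And>l. set (p l) \<subseteq> borel_measurable (state_space e)"
    and X: "X \<in> measurable M (state_space e)"
    and a: "\<And>l i. i < length (p l) \<Longrightarrow> (\<lambda>\<omega>. a \<omega> l i) \<in> borel_measurable M"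
  shows "(\<lambda>\<omega>. driver f t p (a \<omega>) (X \<omega>)) \<in> borel_measurable M"
proof -
  have b: "(\<lambda>\<omega>. bdot (a \<omega> l) (p l) (X \<omega>)) \<in> borel_measurable M" for l
  proof -
    have "(\<lambda>\<omega>. (p l ! i) (X \<omega>)) \<in> borel_measurable M" if "i < length (p l)" for i
      using p[of l] nth_mem[OF that] by (intro measurable_compose[OF X]) blast
    then show ?thesis
      unfolding bdot_def using a by (intro borel_measurable_sum borel_measurable_times) auto
  qed
  have z: "(\<lambda>\<omega>. \<chi> l. bdot (a \<omega> (Some l)) (p (Some l)) (X \<omega>)) \<in> borel_measurable M"
    using b by (subst borel_measurable_euclidean_space) (auto simp: Basis_vec_def inner_axis)
  have x: "(\<lambda>\<omega>. fst (X \<omega>)) \<in> borel_measurable M"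
    using X unfolding state_space_def by measurable
  have "(\<lambda>\<omega>. (fst (X \<omega>), bdot (a \<omega> None) (p None) (X \<omega>),
      \<chi> l. bdot (a \<omega> (Some l)) (p (Some l)) (X \<omega>))) \<in> borel_measurable M"
    by (intro borel_measurable_Pair x b z)
  from measurable_compose[OF this f_measurable[OF t]] show ?thesis
    by (simp add: driver_def)
qed

lemma driver_diff_square:
  assumes t: "t \<in> {0..T}"
  shows "(driver f t p a x - driver f t p a' x)\<^sup>2 \<le>
    2 * Cf\<^sup>2 * ((bdot (\<lambda>i. a None i - a' None i) (p None) x)\<^sup>2 +
      (\<Sum>l\<in>UNIV. (bdot (\<lambda>i. a (Some l) i - a' (Some l) i) (p (Some l)) x)\<^sup>2))"
proof -
  let ?y = "bdot (\<lambda>i. a None i - a' None i) (p None) x"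
    and ?z = "(\<chi> l. bdot (\<lambda>i. a (Some l) i - a' (Some l) i) (p (Some l)) x) :: real^'q"
  have z: "(\<chi> l. bdot (a (Some l)) (p (Some l)) x) - (\<chi> l. bdot (a' (Some l)) (p (Some l)) x) = ?z"
    by (simp add: vec_eq_iff bdot_diff)
  have "\<bar>driver f t p a x - driver f t p a' x\<bar> \<le> Cf * (\<bar>?y\<bar> + norm ?z)"
    unfolding driver_def
    using f_Lip[OF t t, of "fst x" "bdot (a None) (p None) x"
        "\<chi> l. bdot (a (Some l)) (p (Some l)) x"
        "fst x" "bdot (a' None) (p None) x" "\<chi> l. bdot (a' (Some l)) (p (Some l)) x"]
    by (simp add: z bdot_diff)
  then have "(driver f t p a x - driver f t p a' x)\<^sup>2 \<le> (Cf * (\<bar>?y\<bar> + norm ?z))\<^sup>2"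
    by (rule abs_le_imp_square_le)
  also have "\<dots> = Cf\<^sup>2 * (\<bar>?y\<bar> + norm ?z)\<^sup>2" by (rule power_mult_distrib)
  also have "\<dots> \<le> Cf\<^sup>2 * (2 * (\<bar>?y\<bar>\<^sup>2 + (norm ?z)\<^sup>2))"
    by (intro mult_left_mono square_add2_le) simp
  also have "\<dots> = 2 * Cf\<^sup>2 * (?y\<^sup>2 + (norm ?z)\<^sup>2)"
      by (simp only: power2_abs mult.assoc mult.left_commute)
  also have "(norm ?z)\<^sup>2 = (\<Sum>l\<in>UNIV. (bdot (\<lambda>i. a (Some l) i - a' (Some l) i) (p (Some l)) x)\<^sup>2)"
    by (simp add: norm_vec_square)
  finally show ?thesis .
qed

text \<open>Origin of \<open>K = 4 * Cf\<^sup>2\<close>: a factor 2 from squaring a sum of two terms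
  and a factor 2 from the empirical Gram matrices of the bases. The Z-coefficients enter
  \<open>cvec\<close> with weight \<open>sqrt h\<close>, so one of the two factors \<open>h\<close>
  is used up for them; hence the extra \<open>h\<close> on the Y-part only.\<close>

lemma driver_diff_avg_le:
  fixes p :: "'q option \<Rightarrow> 'd state basis"
  assumes t: "t \<in> {0..T}" and h: "0 \<le> h" "h \<le> 1"
    and n0: "near_id M {..<length (p None)} (\<lambda>m. vecs (p None) (xs m)) h"
    and n1: "\<And>l. near_id M {..<length (p (Some l))} (\<lambda>m. vecs (p (Some l)) (xs m)) 1"
  shows "h\<^sup>2 * avg M (\<lambda>m. (driver f t p a (xs m) - driver f t p a' (xs m))\<^sup>2) \<le>
    4 * Cf\<^sup>2 * h * (h * sqn (idx0 p) (\<lambda>r. cvec h a r - cvec h a' r) +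
        sqn (idx1 p) (\<lambda>r. cvec h a r - cvec h a' r))"
proof -
  let ?d = "\<lambda>l i. a l i - a' l i"
  have "avg M (\<lambda>m. (driver f t p a (xs m) - driver f t p a' (xs m))\<^sup>2) \<le>
     avg M (\<lambda>m. 2 * Cf\<^sup>2 * ((bdot (?d None) (p None) (xs m))\<^sup>2 +
         (\<Sum>l\<in>UNIV. (bdot (?d (Some l)) (p (Some l)) (xs m))\<^sup>2)))"
    by (intro avg_mono driver_diff_square t)
  also have "\<dots> = 2 * Cf\<^sup>2 * (avg M (\<lambda>m. (bdot (?d None) (p None) (xs m))\<^sup>2) +
      (\<Sum>l\<in>UNIV. avg M (\<lambda>m. (bdot (?d (Some l)) (p (Some l)) (xs m))\<^sup>2)))"
    by (simp only: avg_mult avg_add avg_sum)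
  also have "\<dots> \<le> 2 * Cf\<^sup>2 * (2 * sqn {..<length (p None)} (?d None) +
      (\<Sum>l\<in>UNIV. 2 * sqn {..<length (p (Some l))} (?d (Some l))))"
  proof (intro mult_left_mono add_mono sum_mono)
    have "avg M (\<lambda>m. (bdot (?d None) (p None) (xs m))\<^sup>2) \<le>
        (1 + h) * sqn {..<length (p None)} (?d None)"
      using n0 unfolding near_id_def bdot_eq_ip by simp
    also have "\<dots> \<le> 2 * sqn {..<length (p None)} (?d None)" using h by (intro mult_right_mono) auto
    finally show "avg M (\<lambda>m. (bdot (?d None) (p None) (xs m))\<^sup>2) \<le>
        2 * sqn {..<length (p None)} (?d None)" .
    show "avg M (\<lambda>m. (bdot (?d (Some l)) (p (Some l)) (xs m))\<^sup>2) \<le>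
        2 * sqn {..<length (p (Some l))} (?d (Some l))" for l
      using n1[of l] unfolding near_id_def bdot_eq_ip by simp
  qed simp
  finally have "h\<^sup>2 * avg M (\<lambda>m. (driver f t p a (xs m) - driver f t p a' (xs m))\<^sup>2) \<le> h\<^sup>2 * \<dots>"
    by (rule mult_left_mono) simp
  also have "\<dots> = 4 * Cf\<^sup>2 * h * (h * sqn (idx0 p) (cvec h ?d) + sqn (idx1 p) (cvec h ?d))"
    unfolding sqn_idx0_cvec sqn_idx1_cvec[OF h(1)]
    by (simp add: power2_eq_square algebra_simps sum_distrib_left)
  finally show ?thesis by (simp only: cvec_diff)
qed

lemma driver_growth:
  assumes t: "t \<in> {0..T}"
  shows "(driver f t p a x)\<^sup>2 \<le> 4 * ((\<bar>f 0 0 0 0\<bar> + Cf * sqrt T)\<^sup>2 + Cf\<^sup>2) * (1 + (norm (fst x))\<^sup>2 +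
    (bdot (a None) (p None) x)\<^sup>2 + (\<Sum>l\<in>UNIV. (bdot (a (Some l)) (p (Some l)) x)\<^sup>2))"
proof -
  let ?y = "bdot (a None) (p None) x" and ?z = "(\<chi> l. bdot (a (Some l)) (p (Some l)) x) :: real^'q"
  define F where "F = \<bar>f 0 0 0 0\<bar> + Cf * sqrt T"
  have F0: "0 \<le> F" using Cf_nonneg T by (simp add: F_def)
  have "\<bar>f t (fst x) ?y ?z - f 0 0 0 0\<bar> \<le>
      Cf * (sqrt \<bar>t - 0\<bar> + norm (fst x - 0) + \<bar>?y - 0\<bar> + norm (?z - 0))"
    by (rule f_Lip) (use t T in auto)
  also have "\<dots> \<le> Cf * (sqrt T + norm (fst x) + \<bar>?y\<bar> + norm ?z)"
    using t Cf_nonneg by (intro mult_left_mono add_mono) auto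
  finally have "\<bar>driver f t p a x\<bar> \<le> F + Cf * (norm (fst x) + \<bar>?y\<bar> + norm ?z)"
    unfolding driver_def F_def by (simp add: distrib_left)
  then have "(driver f t p a x)\<^sup>2 \<le> (F + Cf * (norm (fst x) + \<bar>?y\<bar> + norm ?z))\<^sup>2"
    by (rule abs_le_imp_square_le)
  also have "\<dots> \<le> 4 * (F\<^sup>2 + Cf\<^sup>2 * ((norm (fst x))\<^sup>2 + \<bar>?y\<bar>\<^sup>2 + (norm ?z)\<^sup>2))"
  proof -
    have "(u + c * (a + b + d))\<^sup>2 \<le> 4 * (u\<^sup>2 + c\<^sup>2 * (a\<^sup>2 + b\<^sup>2 + d\<^sup>2))" for u c a b d :: real
    proof -
      \<comment> \<open>Lagrange identity: four times the sum of four squares exceeds the square of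
        the sum by the six squared differences.\<close>
      have "0 \<le> (u - c * a)\<^sup>2 + (u - c * b)\<^sup>2 + (u - c * d)\<^sup>2 + (c * a - c * b)\<^sup>2 +
          (c * b - c * d)\<^sup>2 + (c * a - c * d)\<^sup>2"
        by simp
      also have "\<dots> = 4 * (u\<^sup>2 + c\<^sup>2 * (a\<^sup>2 + b\<^sup>2 + d\<^sup>2)) - (u + c * (a + b + d))\<^sup>2"
        by (simp add: power2_eq_square algebra_simps)
      finally show ?thesis by simp
    qed
    then show ?thesis .
  qed
  also have "\<dots> \<le> 4 * ((F\<^sup>2 + Cf\<^sup>2) * (1 + (norm (fst x))\<^sup>2 + ?y\<^sup>2 + (norm ?z)\<^sup>2))"
  proof -
    have "0 \<le> F\<^sup>2 * ((norm (fst x))\<^sup>2 + ?y\<^sup>2 + (norm ?z)\<^sup>2)" "0 \<le> Cf\<^sup>2" by simp_all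
    then show ?thesis by (simp add: algebra_simps)
  qed
  also have "(norm ?z)\<^sup>2 = (\<Sum>l\<in>UNIV. (bdot (a (Some l)) (p (Some l)) x)\<^sup>2)"
    by (simp add: norm_vec_square)
  finally show ?thesis by (simp only: F_def mult.assoc)
qed

end

section \<open>The projected scheme\<close>

text \<open>The constant may depend on \<open>h\<close> and \<open>t\<close>: it is used only to see
  that the Euler scheme has finite second moments. The product form on the right suits the
  independence of state and increment.\<close>

lemma euler_growth:
  fixes b :: "real \<Rightarrow> real^'d \<Rightarrow> real^'d" and \<sigma> :: "real \<Rightarrow> real^'d \<Rightarrow> real^'q^'d"
  assumes "\<exists>L. L-lipschitz_on ({0..T} \<times> UNIV) (\<lambda>(t, x). b t x)"
    and "\<exists>L. L-lipschitz_on ({0..T} \<times> UNIV) (\<lambda>(t, x). \<sigma> t x)" and t: "t \<in> {0..T}"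
  obtains c where "0 \<le> c" "\<And>s w. (norm (s + h *\<^sub>R b t s + \<sigma> t s *v w))\<^sup>2 \<le>
      c * (1 + (norm s)\<^sup>2) * (1 + (norm w)\<^sup>2)"
proof -
  from assms obtain L1 L2 where L: "L1-lipschitz_on ({0..T} \<times> UNIV) (\<lambda>(t, x). b t x)"
    "L2-lipschitz_on ({0..T} \<times> UNIV) (\<lambda>(t, x). \<sigma> t x)" by blast
  define B where "B = norm (b t 0) + norm (\<sigma> t 0) + L1 + L2"
  have L0: "0 \<le> L1" "0 \<le> L2" using L lipschitz_on_nonneg by blast+
  have B0: "0 \<le> B" using L0 by (simp add: B_def)
  have db: "norm (b t s) \<le> B * (1 + norm s)" and ds: "norm (\<sigma> t s) \<le> B * (1 + norm s)" for s
  proof -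
    have "dist (b t s) (b t 0) \<le> L1 * norm s" "dist (\<sigma> t s) (\<sigma> t 0) \<le> L2 * norm s"
      using lipschitz_onD[OF L(1), of "(t, s)" "(t, 0)"] lipschitz_onD[OF L(2), of "(t, s)"
          "(t, 0)"] t
      by (simp_all add: dist_Pair_Pair)
    then have "norm (b t s) \<le> norm (b t 0) + L1 * norm s" "norm (\<sigma> t s) \<le>
        norm (\<sigma> t 0) + L2 * norm s"
      using norm_triangle_sub[of "b t s" "b t 0"] norm_triangle_sub[of "\<sigma> t s" "\<sigma> t 0"]
      by (simp_all add: dist_norm)
    moreover have "norm (b t 0) + L1 * norm s \<le> B + B * norm s" "norm (\<sigma> t 0) + L2 * norm s \<le>
        B + B * norm s"
      using L0 by (intro add_mono mult_right_mono; simp add: B_def)+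
    ultimately show "norm (b t s) \<le> B * (1 + norm s)" "norm (\<sigma> t s) \<le> B * (1 + norm s)"
      by (simp_all add: distrib_left)
  qed
  have sq: "(1 + u)\<^sup>2 \<le> 2 * (1 + u\<^sup>2)" for u :: real using square_add2_le[of 1 u] by simp
  show ?thesis
  proof
    show "0 \<le> 3 * (1 + 2 * h\<^sup>2 * B\<^sup>2 + 2 * B\<^sup>2)" by simp
    fix s :: "real^'d" and w :: "real^'q"
    let ?S = "1 + (norm s)\<^sup>2" and ?W = "1 + (norm w)\<^sup>2"
    have "norm (s + h *\<^sub>R b t s + \<sigma> t s *v w) \<le> norm s + norm (h *\<^sub>R b t s) + norm (\<sigma> t s *v w)"
      by (meson norm_triangle_le norm_triangle_ineq add_mono order_refl order_trans)
    also have "\<dots> \<le> norm s + \<bar>h\<bar> * (B * (1 + norm s)) + B * (1 + norm s) * norm w"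
      using db[of s] ds[of s] norm_matrix_vector_mult_le[of "\<sigma> t s" w]
      by (intro add_mono order_refl) (auto intro!: mult_left_mono order_trans[OF
          norm_matrix_vector_mult_le] mult_right_mono)
    finally have "(norm (s + h *\<^sub>R b t s + \<sigma> t s *v w))\<^sup>2 \<le>
        (norm s + \<bar>h\<bar> * (B * (1 + norm s)) + B * (1 + norm s) * norm w)\<^sup>2"
      by (rule power_mono) simp
    also have "\<dots> \<le> 3 * ((norm s)\<^sup>2 + (\<bar>h\<bar> * (B * (1 + norm s)))\<^sup>2 + (B * (1 + norm s) * norm w)\<^sup>2)"
      by (rule square_add3_le)
    also have "\<dots> = 3 * ((norm s)\<^sup>2 + h\<^sup>2 * B\<^sup>2 * (1 + norm s)\<^sup>2 + B\<^sup>2 * (1 +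
        norm s)\<^sup>2 * (norm w)\<^sup>2)"
      by (simp add: power_mult_distrib)
    also have "\<dots> \<le> 3 * (?S * ?W + h\<^sup>2 * B\<^sup>2 * (2 * ?S * ?W) + B\<^sup>2 * (2 * ?S) * ?W)"
    proof (intro mult_left_mono add_mono)
      have SW: "?S * 1 \<le> ?S * ?W" by (rule mult_left_mono) auto
      then show "(norm s)\<^sup>2 \<le> ?S * ?W" by simp
      show "(1 + norm s)\<^sup>2 \<le> 2 * ?S * ?W" using sq[of "norm s"] SW by linarith
      show "B\<^sup>2 * (1 + norm s)\<^sup>2 * (norm w)\<^sup>2 \<le> B\<^sup>2 * (2 * ?S) * ?W"
        using sq[of "norm s"] by (intro mult_mono) auto
    qed auto
    also have "\<dots> = 3 * (1 + 2 * h\<^sup>2 * B\<^sup>2 + 2 * B\<^sup>2) * ?S * ?W" by (simp add: algebra_simps)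
    finally show "(norm (s + h *\<^sub>R b t s + \<sigma> t s *v w))\<^sup>2 \<le>
        3 * (1 + 2 * h\<^sup>2 * B\<^sup>2 + 2 * B\<^sup>2) * ?S * ?W" .
  qed
qed

locale projected_regression = Lipschitz_driver T Cf f
  for T Cf :: real and f :: "real \<Rightarrow> real^'d::finite \<Rightarrow> real \<Rightarrow> real^'q::finite \<Rightarrow> real" +
  fixes I N e :: nat and h C0 :: real and S0 :: "real^'d"
    and b :: "real \<Rightarrow> real^'d \<Rightarrow> real^'d"
    and \<sigma> :: "real \<Rightarrow> real^'d \<Rightarrow> real^'q^'d"
    and \<Omega> :: "'w measure" and W :: "real \<Rightarrow> 'w \<Rightarrow> real^'q" and P :: "nat \<Rightarrow> 'w \<Rightarrow> 'd state"
    and \<Phi>N :: "'d state \<Rightarrow> real" and p :: "nat \<Rightarrow> 'q option \<Rightarrow> 'd state basis"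
    and \<alpha> :: "nat \<Rightarrow> nat \<Rightarrow> 'q coeffs"
  assumes I: "2 \<le> I"
    and b_Lip: "\<exists>L. L-lipschitz_on ({0..T} \<times> UNIV) (\<lambda>(t, x). b t x)"
    and \<sigma>_Lip: "\<exists>L. L-lipschitz_on ({0..T} \<times> UNIV) (\<lambda>(t, x). \<sigma> t x)"
    and BM: "brownian_motion \<Omega> T W"
    and N: "N \<ge> 1" and h_eq: "h = T / real N"
    and P: "\<And>k. k \<le> N \<Longrightarrow> P k \<in> measurable \<Omega> (state_space e)"
    and adapted: "\<And>k. k \<le> N \<Longrightarrow>
        P k \<in> measurable (augmented_filtration \<Omega> W (real k * h)) (state_space e)"
    and euler: "\<And>k \<omega>. k \<le> N \<Longrightarrow> \<omega> \<in> space \<Omega> \<Longrightarrow> fst (P k \<omega>) = euler b \<sigma> S0 h (\<lambda>j. increment W h j \<omega>) k"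
    and \<Phi>N: "\<Phi>N \<in> borel_measurable (state_space e)" "integrable \<Omega> (\<lambda>\<omega>. (\<Phi>N (P N \<omega>))\<^sup>2)"
    and basis: "\<And>k l. k < N \<Longrightarrow> p k l \<noteq> []" "\<And>k l. k < N \<Longrightarrow>
        set (p k l) \<subseteq> borel_measurable (state_space e)"
      "\<And>k l. k < N \<Longrightarrow> orthonormal_basis \<Omega> (P k) (p k l)"
    and scheme: "projected_scheme \<Omega> f h N I W P \<Phi>N p \<alpha>"
    and C0: "C0 > 0"
    and dominated: "\<And>k i. k < N \<Longrightarrow> AE \<omega> in \<Omega>.
         \<bar>Y_proj \<Phi>N N p \<alpha> i k (P k \<omega>)\<bar> \<le> rho C0 (p k None) (P k \<omega>) \<and>
         (\<forall>l. sqrt h * \<bar>Z_proj p \<alpha> i k (P k \<omega>) $ l\<bar> \<le> rho C0 (p k (Some l)) (P k \<omega>))"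
    and h1: "h \<le> 1"
begin

sublocale prob_space \<Omega>
  using BM by (simp add: brownian_motion_def)

lemma h_pos: "0 < h"
  using T N by (simp add: h_eq)

lemma time_le: "k \<le> N \<Longrightarrow> real k * h \<in> {0..T}"
  using T N by (auto simp: h_eq field_simps)

abbreviation dW :: "nat \<Rightarrow> 'w \<Rightarrow> real^'q" where
  "dW \<equiv> increment W h"

lemma increment_facts:
  assumes k: "k < N"
  shows "indep_set (sets (natural_filtration \<Omega> W (real k * h))) (sets (sigma_of \<Omega> borel (dW k)))"
    and "indep_vars (\<lambda>_. borel) (\<lambda>l \<omega>. dW k \<omega> $ l) UNIV"
    and "distributed \<Omega> lborel (\<lambda>\<omega>. dW k \<omega> $ l) (normal_density 0 (sqrt h))"
proof -
  have st: "0 \<le> real k * h \<and> real k * h < real (Suc k) * h \<and> real (Suc k) * h \<le> T"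
    using time_le[of k] time_le[of "Suc k"] k h_pos by auto
  have d: "real (Suc k) * h - real k * h = h" by (simp add: algebra_simps)
  have "indep_set (sets (natural_filtration \<Omega> W (real k * h))) (sets (sigma_of \<Omega> borel (dW k))) \<and>
      indep_vars (\<lambda>_. borel) (\<lambda>l \<omega>. W (real (Suc k) * h) \<omega> $ l - W (real k * h) \<omega> $ l) UNIV \<and>
        (\<forall>l. distributed \<Omega> lborel (\<lambda>\<omega>. W (real (Suc k) * h) \<omega> $ l - W (real k * h) \<omega> $ l)
               (normal_density 0 (sqrt (real (Suc k) * h - real k * h))))"
    using BM st unfolding brownian_motion_def by blast
  then show "indep_set (sets (natural_filtration \<Omega> W (real k * h))) (sets (sigma_of \<Omega> borel
      (dW k)))"
    "indep_vars (\<lambda>_. borel) (\<lambda>l \<omega>. dW k \<omega> $ l) UNIV"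
    "distributed \<Omega> lborel (\<lambda>\<omega>. dW k \<omega> $ l) (normal_density 0 (sqrt h))"
    unfolding d by simp_all
qed

lemma W_measurable: "k \<le> N \<Longrightarrow> W (real k * h) \<in> borel_measurable \<Omega>"
  using BM time_le[of k] unfolding brownian_motion_def by auto

lemma dW_measurable: "k < N \<Longrightarrow> dW k \<in> borel_measurable \<Omega>"
  using W_measurable[of k] W_measurable[of "Suc k"] by (intro borel_measurable_diff) auto

lemma dW_moments:
  assumes k: "k < N"
  shows "integrable \<Omega> (\<lambda>\<omega>. dW k \<omega> $ l)" "expectation (\<lambda>\<omega>. dW k \<omega> $ l) = 0"
    "integrable \<Omega> (\<lambda>\<omega>. dW k \<omega> $ l * dW k \<omega> $ l')" "expectation (\<lambda>\<omega>. dW k \<omega> $ l * dW k \<omega> $ l') =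
        (if l = l' then h else 0)"
proof -
  have s: "0 < sqrt h" using h_pos by simp
  note nm = normal_moments[OF s increment_facts(3)[OF k]]
  show i: "integrable \<Omega> (\<lambda>\<omega>. dW k \<omega> $ l)" and ex: "expectation (\<lambda>\<omega>. dW k \<omega> $ l) = 0" for l
    by (rule nm(1), rule nm(2))
  show "integrable \<Omega> (\<lambda>\<omega>. dW k \<omega> $ l * dW k \<omega> $ l')"
    by (intro integrable_mult_of_squares nm(3) borel_measurable_integrable i)
  show "expectation (\<lambda>\<omega>. dW k \<omega> $ l * dW k \<omega> $ l') = (if l = l' then h else 0)"
  proof (cases "l = l'")
    case True
    then show ?thesis using nm(4)[of l] h_pos by (simp add: power2_eq_square)
  next
    case False
    have "indep_vars (\<lambda>_. borel) (\<lambda>l \<omega>. dW k \<omega> $ l) {l, l'}"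
      by (rule indep_vars_subset[OF increment_facts(2)[OF k]]) auto
    then have "expectation (\<lambda>\<omega>. \<Prod>i\<in>{l, l'}. dW k \<omega> $ i) =
        (\<Prod>i\<in>{l, l'}. expectation (\<lambda>\<omega>. dW k \<omega> $ i))"
      using i by (intro indep_vars_lebesgue_integral) auto
    then show ?thesis using False ex by simp
  qed
qed

lemma indep_augmented_dW:
  assumes k: "k < N"
  shows "indep_set (sets (augmented_filtration \<Omega> W (real k * h))) (sets (sigma_of \<Omega> borel (dW k)))"
proof -
  let ?F = "natural_filtration \<Omega> W (real k * h)"
  have sp: "space ?F = space \<Omega>" by (simp add: natural_filtration_def space_measure_of_conv)
  have "sigma_algebra (space \<Omega>) (sets ?F)" using sets.sigma_algebra_axioms[of ?F] by (simp add: sp)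
  from indep_set_null_sets[OF this increment_facts(1)[OF k]]
  have "indep_set (sigma_sets (space \<Omega>) (sets ?F \<union> null_sets \<Omega>)) (sets (sigma_of \<Omega> borel (dW k)))" .
  moreover have "sets (augmented_filtration \<Omega> W (real k * h)) =
      sigma_sets (space \<Omega>) (sets ?F \<union> null_sets \<Omega>)"
    unfolding augmented_filtration_def
    by (rule sets_measure_of) (use sets.sets_into_space[of _ ?F] sets.sets_into_space[of _ \<Omega>] sp
        in auto)
  ultimately show ?thesis by simp
qed

lemma indep_functions:
  fixes \<phi> :: "'d state \<Rightarrow> real" and \<psi> :: "real^'q \<Rightarrow> real"
  assumes k: "k < N" and "\<phi> \<in> borel_measurable (state_space e)" "\<psi> \<in> borel_measurable borel"
    and "integrable \<Omega> (\<lambda>\<omega>. \<phi> (P k \<omega>))" "integrable \<Omega> (\<lambda>\<omega>. \<psi> (dW k \<omega>))"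
  shows "integrable \<Omega> (\<lambda>\<omega>. \<phi> (P k \<omega>) * \<psi> (dW k \<omega>))"
    "expectation (\<lambda>\<omega>. \<phi> (P k \<omega>) * \<psi> (dW k \<omega>)) =
        expectation (\<lambda>\<omega>. \<phi> (P k \<omega>)) * expectation (\<lambda>\<omega>. \<psi> (dW k \<omega>))"
proof -
  have "indep_var borel (\<lambda>\<omega>. \<phi> (P k \<omega>)) borel (\<lambda>\<omega>. \<psi> (dW k \<omega>))"
  proof (rule indep_varI_indep_set[OF indep_augmented_dW[OF k]])
    have "(\<lambda>\<omega>. \<phi> (P k \<omega>)) \<in> borel_measurable (augmented_filtration \<Omega> W (real k * h))"
      using k by (intro measurable_compose[OF adapted assms(2)]) simp
    from measurable_sets[OF this]
    show "(\<lambda>\<omega>. \<phi> (P k \<omega>)) -` D \<inter> space \<Omega> \<in> sets (augmented_filtration \<Omega> W (real k * h))"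
      if "D \<in> sets borel" for D
      using that by (simp add: augmented_filtration_def space_measure_of_conv)
    have "(\<lambda>\<omega>. \<psi> (dW k \<omega>)) \<in> borel_measurable (sigma_of \<Omega> borel (dW k))"
      by (rule measurable_compose[OF measurable_vimage_algebra1 assms(3)]) simp
    from measurable_sets[OF this]
    show "(\<lambda>\<omega>. \<psi> (dW k \<omega>)) -` D \<inter> space \<Omega> \<in> sets (sigma_of \<Omega> borel (dW k))" if
        "D \<in> sets borel" for D
      using that by simp
  qed (use assms(4,5) in auto)
  from indep_var_integrable[OF this assms(4,5)] indep_var_lebesgue_integral[OF this assms(4,5)]
  show "integrable \<Omega> (\<lambda>\<omega>. \<phi> (P k \<omega>) * \<psi> (dW k \<omega>))"
    "expectation (\<lambda>\<omega>. \<phi> (P k \<omega>) * \<psi> (dW k \<omega>)) =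
        expectation (\<lambda>\<omega>. \<phi> (P k \<omega>)) * expectation (\<lambda>\<omega>. \<psi> (dW k \<omega>))" .
qed

lemma basis_measurable: "k < N \<Longrightarrow> i < length (p k l) \<Longrightarrow> p k l ! i \<in> borel_measurable (state_space e)"
  using basis(2) nth_mem by blast

lemma orthonormal_p:
  assumes "k < N"
  shows "orthonormal_on \<Omega> {..<length (p k l)} (\<lambda>\<omega>. vecs (p k l) (P k \<omega>))"
  using basis(3)[OF assms, of l] assms measurable_compose[OF P basis_measurable[OF assms], of k]
  unfolding orthonormal_on_def orthonormal_basis_def vecs_def id_mat_def by auto

abbreviation vv :: "nat \<Rightarrow> 'w \<Rightarrow> 'q option \<times> nat \<Rightarrow> real" where
  "vv k \<omega> \<equiv> v_vec h (p k) (P k \<omega>) (dW k \<omega>)"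

text \<open>Bases for different \<open>l\<close> are not assumed orthogonal to each other. The
  corresponding blocks vanish because the factors 1 and \<open>dW $ l / sqrt h\<close> are
  orthonormal and independent of the state; within a block the basis is orthonormal.\<close>

lemma orthonormal_v:
  assumes k: "k < N"
  shows "orthonormal_on \<Omega> (v_index (p k)) (vv k)"
proof -
  define c where "c = (\<lambda>(l :: 'q option) w. case l of None \<Rightarrow> 1 | Some l' \<Rightarrow>
      (w :: real^'q) $ l' / sqrt h)"
  have v: "vv k \<omega> (l, i) = (p k l ! i) (P k \<omega>) * c l (dW k \<omega>)" for \<omega> l i
    by (simp add: v_vec_def c_def)
  have c [measurable]: "c l \<in> borel_measurable borel" for l
    by (cases l) (simp_all add: c_def)
  have Pk: "P k \<in> measurable \<Omega> (state_space e)" using P k by simp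
  have dWk: "dW k \<in> borel_measurable \<Omega>" by (rule dW_measurable[OF k])
  have cc: "integrable \<Omega> (\<lambda>\<omega>. c l (dW k \<omega>) * c l' (dW k \<omega>))"
    "expectation (\<lambda>\<omega>. c l (dW k \<omega>) * c l' (dW k \<omega>)) = (if l = l' then 1 else 0)" for l l'
    using dW_moments[OF k] h_pos
    by (cases l; cases l'; auto simp: c_def prob_space real_sqrt_mult_self)+
  have pp: "integrable \<Omega> (\<lambda>\<omega>. (p k l ! i) (P k \<omega>) * (p k l' ! i') (P k \<omega>))"
    if "i < length (p k l)" "i' < length (p k l')" for l l' i i'
    using that orthonormal_onD(1,2)[OF orthonormal_p[OF k, of l],
        of i] orthonormal_onD(1,2)[OF orthonormal_p[OF k, of l'], of i']
    by (intro integrable_mult_of_squares) (auto simp: vecs_def)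
  show ?thesis
    unfolding orthonormal_on_def
  proof (intro conjI ballI)
    fix r assume "r \<in> v_index (p k)"
    then obtain l i where r: "r = (l, i)" "i < length (p k l)" by (auto simp: v_index_def)
    show "(\<lambda>\<omega>. vv k \<omega> r) \<in> borel_measurable \<Omega>"
      unfolding r v
      by (intro borel_measurable_times measurable_compose[OF Pk basis_measurable[OF k r(2)]]
          measurable_compose[OF dWk c])
    fix s assume "s \<in> v_index (p k)"
    then obtain l' i' where s: "s = (l', i')" "i' < length (p k l')" by (auto simp: v_index_def)
    have eq: "vv k \<omega> r * vv k \<omega> s =
        ((p k l ! i) (P k \<omega>) * (p k l' ! i') (P k \<omega>)) * (c l (dW k \<omega>) * c l' (dW k \<omega>))" for \<omega>
      unfolding r s v by (simp add: mult_ac)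
    note * = indep_functions[OF k, of "\<lambda>x. (p k l ! i) x * (p k l' ! i') x" "\<lambda>w. c l w * c l' w",
      OF borel_measurable_times[OF basis_measurable[OF k r(2)] basis_measurable[OF k s(2)]] _
          pp[OF r(2) s(2)] cc(1)]
    show "integrable \<Omega> (\<lambda>\<omega>. vv k \<omega> r * vv k \<omega> s)"
      unfolding eq by (rule *) measurable
    have "expectation (\<lambda>\<omega>. vv k \<omega> r * vv k \<omega> s) =
      expectation (\<lambda>\<omega>. (p k l ! i) (P k \<omega>) * (p k l' ! i') (P k \<omega>)) * (if l = l' then 1 else 0)"
      unfolding eq cc(2)[symmetric] by (rule *) measurable
    also have "\<dots> = id_mat r s"
      using orthonormal_onD(5)[OF orthonormal_p[OF k, of l], of i i'] r s
          by (auto simp: id_mat_def vecs_def)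
    finally show "expectation (\<lambda>\<omega>. vv k \<omega> r * vv k \<omega> s) = id_mat r s" .
  qed
qed

text \<open>The Euler step is dominated by a function of the state times a function of the
  increment. By independence this product is integrable as soon as both factors are.\<close>

lemma integrable_state_square: "k \<le> N \<Longrightarrow> integrable \<Omega> (\<lambda>\<omega>. (norm (fst (P k \<omega>)))\<^sup>2)"
proof (induction k)
  case 0
  have "integrable \<Omega> (\<lambda>_. (norm S0)\<^sup>2)" by simp
  then show ?case using euler[of 0] by (simp cong: Bochner_Integration.integrable_cong)
next
  case (Suc k)
  then have k: "k < N" "k \<le> N" by simp_all
  obtain c where c: "0 \<le> c" "\<And>s w. (norm (s + h *\<^sub>R b (real k * h) s + \<sigma> (real k * h) s *v w))\<^sup>2 \<le>
      c * (1 + (norm s)\<^sup>2) * (1 + (norm w)\<^sup>2)"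
    using euler_growth[OF b_Lip \<sigma>_Lip time_le[OF k(2)], of h] by blast
  have fm [measurable]: "fst \<in> borel_measurable (state_space e)" unfolding state_space_def
      by measurable
  have [measurable]: "P (Suc k) \<in> measurable \<Omega> (state_space e)" using P Suc.prems by simp
  have "integrable \<Omega> (\<lambda>\<omega>. (norm (dW k \<omega>))\<^sup>2)"
    unfolding norm_vec_square using dW_moments(3)[OF k(1)] by (simp add: power2_eq_square)
  then have int: "integrable \<Omega> (\<lambda>\<omega>. (c * (1 + (norm (fst (P k \<omega>)))\<^sup>2)) * (1 + (norm (dW k \<omega>))\<^sup>2))"
    using Suc.IH k by (intro indep_functions) auto
  show ?case
  proof (rule Bochner_Integration.integrable_bound[OF int])
    show "(\<lambda>\<omega>. (norm (fst (P (Suc k) \<omega>)))\<^sup>2) \<in> borel_measurable \<Omega>" by measurable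
    show "AE \<omega> in \<Omega>. norm ((norm (fst (P (Suc k) \<omega>)))\<^sup>2) \<le>
        norm (c * (1 + (norm (fst (P k \<omega>)))\<^sup>2) * (1 + (norm (dW k \<omega>))\<^sup>2))"
    proof (rule AE_I2)
      fix \<omega> assume \<omega>: "\<omega> \<in> space \<Omega>"
      have "fst (P (Suc k) \<omega>) =
          fst (P k \<omega>) + h *\<^sub>R b (real k * h) (fst (P k \<omega>)) + \<sigma> (real k * h) (fst (P k \<omega>)) *v dW k \<omega>"
        using euler[OF k(2) \<omega>] euler[OF Suc.prems \<omega>] by (simp add: Let_def)
      then show "norm ((norm (fst (P (Suc k) \<omega>)))\<^sup>2) \<le>
          norm (c * (1 + (norm (fst (P k \<omega>)))\<^sup>2) * (1 + (norm (dW k \<omega>))\<^sup>2))"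
        using c(2)[of "fst (P k \<omega>)" "dW k \<omega>"] by simp
    qed
  qed
qed

end

section \<open>Frobenius deviation and truncation levels\<close>

lemma frob_norm_outer_id:
  assumes J: "finite J"
  shows "(frob_norm J (\<lambda>r s. outer v r s - id_mat r s))\<^sup>2 =
      (sqn J v)\<^sup>2 - 2 * sqn J v + real (card J)"
proof -
  have "(frob_norm J (\<lambda>r s. outer v r s - id_mat r s))\<^sup>2 = (\<Sum>r\<in>J. \<Sum>s\<in>J. (v r * v s - id_mat r s)\<^sup>2)"
    by (simp add: frob_norm_def L2_set_def sum_nonneg outer_def sum.cartesian_product split_def)
  also have "\<dots> = (\<Sum>r\<in>J. \<Sum>s\<in>J. (v r)\<^sup>2 * (v s)\<^sup>2) - 2 * (\<Sum>r\<in>J. \<Sum>s\<in>J. id_mat r s * (v r * v s)) +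
      (\<Sum>r\<in>J. \<Sum>s\<in>J. id_mat r s * id_mat r s)"
    by (simp add: power2_diff power_mult_distrib sum.distrib sum_subtractf sum_distrib_left
        mult_ac power2_eq_square[of "id_mat _ _"])
  also have "(\<Sum>r\<in>J. \<Sum>s\<in>J. id_mat r s * (v r * v s)) = sqn J v"
    unfolding sqn_def using J by (intro sum.cong refl) (simp add: sum_id_mat power2_eq_square)
  also have "(\<Sum>r\<in>J. \<Sum>s\<in>J. id_mat r s * id_mat r s) = real (card J)"
  proof -
    have "(\<Sum>s\<in>J. id_mat r s * id_mat r s) = (1::real)" if "r \<in> J" for r
      using sum_id_mat[OF J that, of "id_mat r"] by (simp add: id_mat_def)
    then show ?thesis by simp
  qed
  also have "(\<Sum>r\<in>J. \<Sum>s\<in>J. (v r)\<^sup>2 * (v s)\<^sup>2) = (sqn J v)\<^sup>2"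
    by (simp add: sqn_def power2_eq_square[of "sum _ _"] sum_product)
  finally show ?thesis .
qed

text \<open>The left side is the squared norm of \<open>v v^T x\<close>, and \<open>v v^T\<close> is
  split into its deviation from the identity and the identity. The bound is thus in terms of the
  Frobenius deviation that appears in the theorem.\<close>

lemma sqn_outer_le:
  assumes J: "finite J"
  shows "sqn J v * (ip J v x)\<^sup>2 \<le>
      2 * ((frob_norm J (\<lambda>r s. outer v r s - id_mat r s))\<^sup>2 + 1) * sqn J x"
proof -
  let ?A = "\<lambda>r s. outer v r s - id_mat r s"
  have A: "v r * ip J v x = mv J ?A x r + x r" if "r \<in> J" for r
  proof -
    have "mv J ?A x r = (\<Sum>s\<in>J. v r * v s * x s) - (\<Sum>s\<in>J. id_mat r s * x s)"
      by (simp add: mv_def outer_def left_diff_distrib sum_subtractf)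
    then show ?thesis unfolding sum_id_mat[OF J that]
        by (simp add: ip_def sum_distrib_left mult.assoc)
  qed
  have "sqn J v * (ip J v x)\<^sup>2 = sqn J (\<lambda>r. v r * ip J v x)"
    by (simp add: sqn_def power_mult_distrib sum_distrib_right)
  also have "\<dots> = sqn J (\<lambda>r. mv J ?A x r + x r)" by (rule sqn_cong) (rule A)
  also have "\<dots> \<le> 2 * sqn J (mv J ?A x) + 2 * sqn J x" by (rule sqn_add_le2)
  also have "sqn J (mv J ?A x) \<le> (frob_norm J ?A)\<^sup>2 * sqn J x"
  proof -
    have "sqn J (mv J ?A x) \<le> (\<Sum>r\<in>J. (\<Sum>s\<in>J. (?A r s)\<^sup>2) * sqn J x)"
      unfolding sqn_def[of J "mv J ?A x"] mv_def sqn_def[of J x]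
      by (intro sum_mono Cauchy_Schwarz_ineq_sum)
    also have "\<dots> = (frob_norm J ?A)\<^sup>2 * sqn J x"
      by (simp add: frob_norm_def L2_set_def sum_nonneg sum.cartesian_product split_def
          sum_distrib_right)
    finally show ?thesis .
  qed
  finally show ?thesis by (simp add: algebra_simps)
qed

lemma rho_square_le: "0 < C0 \<Longrightarrow> (rho C0 p x)\<^sup>2 \<le> 1 + C0\<^sup>2 * (bnorm p x)\<^sup>2"
  by (simp add: rho_def max_def power_mult_distrib)

lemma rho_ge: "1 \<le> rho C0 p x" "C0 * bnorm p x \<le> rho C0 p x"
  by (simp_all add: rho_def)

lemma rho_norm_square: "(rho_norm C0 p x)\<^sup>2 = (\<Sum>l\<in>UNIV. (rho C0 (p l) x)\<^sup>2)"
  by (simp add: rho_norm_def L2_set_def sum_nonneg)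

section \<open>Coefficients of the projected scheme\<close>

context projected_regression
begin

abbreviation JJ :: "nat \<Rightarrow> ('q option \<times> nat) set" where "JJ k \<equiv> v_index (p k)"

definition drv :: "nat \<Rightarrow> nat \<Rightarrow> 'd state \<Rightarrow> real" where
  "drv k i x = driver f (real k * h) (p k) (\<alpha> k i) x"

definition \<theta> :: "nat \<Rightarrow> nat \<Rightarrow> 'q option \<times> nat \<Rightarrow> real" where
  "\<theta> k i = cvec h (\<alpha> k i)"

definition target :: "nat \<Rightarrow> nat \<Rightarrow> 'd state \<Rightarrow> 'd state \<Rightarrow> real" where
  "target k i x x' = Y_proj \<Phi>N N p \<alpha> I (Suc k) x' + h * drv k i x"

definition R :: "nat \<Rightarrow> 'q option \<Rightarrow> real" where
  "R k l = expectation (\<lambda>\<omega>. (rho C0 (p k l) (P k \<omega>))\<^sup>2)"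

lemma JJ_finite [simp]: "finite (JJ k)" by (rule finite_idx)

lemma Y_proj_measurable:
  assumes "k \<le> N"
  shows "Y_proj \<Phi>N N p \<alpha> i k \<in> borel_measurable (state_space e)"
proof (cases "k = N")
  case False
  then show ?thesis
    using assms basis_measurable[of k]
    unfolding Y_proj_def bdot_def by (auto intro!: borel_measurable_sum borel_measurable_times)
next
  case True
  then have "Y_proj \<Phi>N N p \<alpha> i k = \<Phi>N" by (intro ext) (simp add: Y_proj_def)
  then show ?thesis by (simp add: \<Phi>N)
qed

lemma integrable_bdot_square:
  assumes "k < N"
  shows "integrable \<Omega> (\<lambda>\<omega>. (bdot a (p k l) (P k \<omega>))\<^sup>2)"
    "expectation (\<lambda>\<omega>. (bdot a (p k l) (P k \<omega>))\<^sup>2) = sqn {..<length (p k l)} a"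
  unfolding bdot_eq_ip using orthonormal_ip_square[OF orthonormal_p[OF assms]] by auto

lemma integrable_Y_square:
  assumes "k \<le> N"
  shows "integrable \<Omega> (\<lambda>\<omega>. (Y_proj \<Phi>N N p \<alpha> i k (P k \<omega>))\<^sup>2)"
  using \<Phi>N(2) integrable_bdot_square[of k] assms by (cases "k = N") (auto simp: Y_proj_def)

lemma drv_measurable:
  assumes k: "k < N" and X: "X \<in> measurable M (state_space e)"
  shows "(\<lambda>\<omega>. drv k i (X \<omega>)) \<in> borel_measurable M"
  unfolding drv_def using time_le[of k] k basis(2)[OF k] X by (intro driver_measurable) auto

lemma P_fst_measurable: "k \<le> N \<Longrightarrow> (\<lambda>\<omega>. fst (P k \<omega>)) \<in> borel_measurable \<Omega>"
  using P unfolding state_space_def by measurable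

lemma integrable_drv_square:
  assumes k: "k < N"
  shows "integrable \<Omega> (\<lambda>\<omega>. (drv k i (P k \<omega>))\<^sup>2)"
proof (rule Bochner_Integration.integrable_bound)
  let ?K = "4 * ((\<bar>f 0 0 0 0\<bar> + Cf * sqrt T)\<^sup>2 + Cf\<^sup>2)"
  let ?G = "\<lambda>\<omega>. ?K * (1 + (norm (fst (P k \<omega>)))\<^sup>2 + (bdot (\<alpha> k i None) (p k None) (P k \<omega>))\<^sup>2 +
    (\<Sum>l\<in>UNIV. (bdot (\<alpha> k i (Some l)) (p k (Some l)) (P k \<omega>))\<^sup>2))"
  show "integrable \<Omega> ?G"
    using integrable_bdot_square(1)[OF k] integrable_state_square[of k] k by simp
  show "(\<lambda>\<omega>. (drv k i (P k \<omega>))\<^sup>2) \<in> borel_measurable \<Omega>"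
    using drv_measurable[OF k P] k by simp
  show "AE \<omega> in \<Omega>. norm ((drv k i (P k \<omega>))\<^sup>2) \<le> norm (?G \<omega>)"
  proof (rule AE_I2)
    fix \<omega>
    have "(drv k i (P k \<omega>))\<^sup>2 \<le> ?G \<omega>"
      unfolding drv_def by (rule driver_growth) (use time_le[of k] k in simp)
    moreover have "0 \<le> (drv k i (P k \<omega>))\<^sup>2" by simp
    ultimately show "norm ((drv k i (P k \<omega>))\<^sup>2) \<le> norm (?G \<omega>)"
      unfolding real_norm_def by linarith
  qed
qed

lemma target_L2:
  assumes k: "k < N"
  shows "(\<lambda>\<omega>. target k i (P k \<omega>) (P (Suc k) \<omega>)) \<in> borel_measurable \<Omega>"
    "integrable \<Omega> (\<lambda>\<omega>. (target k i (P k \<omega>) (P (Suc k) \<omega>))\<^sup>2)"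
proof -
  have Y: "(\<lambda>\<omega>. Y_proj \<Phi>N N p \<alpha> I (Suc k) (P (Suc k) \<omega>)) \<in> borel_measurable \<Omega>"
    using k by (intro measurable_compose[OF P Y_proj_measurable]) auto
  have d: "(\<lambda>\<omega>. h * drv k i (P k \<omega>)) \<in> borel_measurable \<Omega>"
    using drv_measurable[OF k P] k by simp
  show "(\<lambda>\<omega>. target k i (P k \<omega>) (P (Suc k) \<omega>)) \<in> borel_measurable \<Omega>"
    unfolding target_def by (intro borel_measurable_add Y d)
  show "integrable \<Omega> (\<lambda>\<omega>. (target k i (P k \<omega>) (P (Suc k) \<omega>))\<^sup>2)"
    unfolding target_def using integrable_Y_square[of "Suc k" I] integrable_drv_square[OF k] k
    by (intro integrable_square_add Y d integrable_square_scale) auto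
qed

lemma \<alpha>_0: "k < N \<Longrightarrow> \<alpha> k 0 = (\<lambda>_ _. 0)"
  using scheme by (simp add: projected_scheme_def)

lemma \<theta>_0: "k < N \<Longrightarrow> \<theta> k 0 r = 0"
  by (simp add: \<theta>_def cvec_def \<alpha>_0 split_def)

text \<open>As the Gram matrix of \<open>vv k\<close> is the identity, the normal equation is
  already solved: the coefficients are the Fourier coefficients of the regression target.\<close>

lemma \<theta>_eq:
  assumes k: "k < N" and i: "1 \<le> i" and r: "r \<in> JJ k"
  shows "\<theta> k i r = expectation (\<lambda>\<omega>. vv k \<omega> r * target k (i - 1) (P k \<omega>) (P (Suc k) \<omega>))"
proof -
  let ?F = "\<lambda>a. expect_nn \<Omega> (\<lambda>\<omega>. (residual f h k p (\<alpha> k (i - 1)) a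
              (Y_proj \<Phi>N N p \<alpha> I (Suc k) (P (Suc k) \<omega>)) (P k \<omega>) (dW k \<omega>))\<^sup>2)"
  let ?g = "\<lambda>\<omega>. target k (i - 1) (P k \<omega>) (P (Suc k) \<omega>)"
  have F: "?F a = expect_nn \<Omega> (\<lambda>\<omega>. (?g \<omega> - ip (JJ k) (vv k \<omega>) (cvec h a))\<^sup>2)" for a
    unfolding residual_eq[OF h_pos] target_def drv_def ..
  have "is_arg_min ?F (\<lambda>_. True) (\<alpha> k i)"
    using scheme k i unfolding projected_scheme_def by blast
  then have le: "?F (\<alpha> k i) \<le> ?F a" for a
    unfolding is_arg_min_def by (meson not_less)
  note o = orthonormal_v[OF k]
  have min: "expect_nn \<Omega> (\<lambda>\<omega>. (?g \<omega> - ip (JJ k) (vv k \<omega>) (\<theta> k i))\<^sup>2) \<le>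
      expect_nn \<Omega> (\<lambda>\<omega>. (?g \<omega> - ip (JJ k) (vv k \<omega>) x)\<^sup>2)" for x
  proof -
    obtain a where "cvec h a = x" using cvec_surj[OF h_pos] by blast
    then show ?thesis using le[of a] unfolding F \<theta>_def by simp
  qed
  have "expectation (\<lambda>\<omega>. vv k \<omega> r * (?g \<omega> - ip (JJ k) (vv k \<omega>) (\<theta> k i))) = 0"
    by (rule least_squares_integral[OF JJ_finite r orthonormal_onD(1,2)[OF o] target_L2[OF k] min])
  moreover have "integrable \<Omega> (\<lambda>\<omega>. vv k \<omega> r * ?g \<omega>)"
    by (intro integrable_mult_of_squares orthonormal_onD(1,2)[OF o r] target_L2[OF k])
  ultimately show ?thesis
    using orthonormal_mult_ip[OF o JJ_finite r, of "\<theta> k i"] by (simp add: right_diff_distrib)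
qed

lemma drv_diff_expectation_le:
  assumes k: "k < N"
  shows "h\<^sup>2 * expectation (\<lambda>\<omega>. (drv k i (P k \<omega>) - drv k i' (P k \<omega>))\<^sup>2) \<le>
      4 * Cf\<^sup>2 * h * sqn (JJ k) (\<lambda>r. \<theta> k i r - \<theta> k i' r)"
proof -
  let ?d = "\<lambda>l j. \<alpha> k i l j - \<alpha> k i' l j"
  let ?G = "\<lambda>\<omega>. 2 * Cf\<^sup>2 * ((bdot (?d None) (p k None) (P k \<omega>))\<^sup>2 +
      (\<Sum>l\<in>UNIV. (bdot (?d (Some l)) (p k (Some l)) (P k \<omega>))\<^sup>2))"
  have G: "integrable \<Omega> ?G" using integrable_bdot_square(1)[OF k] by simp
  have "expectation (\<lambda>\<omega>. (drv k i (P k \<omega>) - drv k i' (P k \<omega>))\<^sup>2) \<le> expectation ?G"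
  proof (rule integral_mono[OF _ G])
    show "integrable \<Omega> (\<lambda>\<omega>. (drv k i (P k \<omega>) - drv k i' (P k \<omega>))\<^sup>2)"
      using k by (intro integrable_square_diff integrable_drv_square drv_measurable P) auto
    show "(drv k i (P k \<omega>) - drv k i' (P k \<omega>))\<^sup>2 \<le> ?G \<omega>" for \<omega>
      unfolding drv_def by (rule driver_diff_square) (use time_le[of k] k in simp)
  qed
  also have "\<dots> = 2 * Cf\<^sup>2 * (sqn {..<length (p k None)} (?d None) +
      (\<Sum>l\<in>UNIV. sqn {..<length (p k (Some l))} (?d (Some l))))"
    using integrable_bdot_square[OF k] by simp
  finally have "h\<^sup>2 * expectation (\<lambda>\<omega>. (drv k i (P k \<omega>) - drv k i' (P k \<omega>))\<^sup>2) \<le> h\<^sup>2 * \<dots>"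
    by (rule mult_left_mono) simp
  also have "\<dots> = 2 * Cf\<^sup>2 * h * (h * sqn (idx0 (p k)) (cvec h ?d) + sqn (idx1 (p k)) (cvec h ?d))"
    unfolding sqn_idx0_cvec sqn_idx1_cvec[OF less_imp_le[OF h_pos]]
    by (simp add: power2_eq_square algebra_simps)
  also have "\<dots> \<le> 4 * Cf\<^sup>2 * h * sqn (JJ k) (cvec h ?d)"
  proof (rule mult_mono)
    have "h * sqn (idx0 (p k)) (cvec h ?d) \<le> sqn (idx0 (p k)) (cvec h ?d)"
      using h1 h_pos by (intro mult_left_le_one_le) auto
    then show "h * sqn (idx0 (p k)) (cvec h ?d) + sqn (idx1 (p k)) (cvec h ?d) \<le>
        sqn (JJ k) (cvec h ?d)"
      unfolding sqn_v_index by simp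
  qed (use h_pos in auto)
  finally show ?thesis by (simp only: \<theta>_def cvec_diff)
qed

text \<open>Consecutive regression targets share the value at the next time and differ by
  \<open>h\<close> times the driver difference; Bessel bounds the coefficients of that
  difference.\<close>

lemma \<theta>_increment_contracts:
  assumes k: "k < N" and i: "1 \<le> i"
  shows "sqn (JJ k) (\<lambda>r. \<theta> k (Suc i) r - \<theta> k i r) \<le>
      4 * Cf\<^sup>2 * h * sqn (JJ k) (\<lambda>r. \<theta> k i r - \<theta> k (i - 1) r)"
proof -
  note o = orthonormal_v[OF k]
  let ?D = "\<lambda>\<omega>. drv k i (P k \<omega>) - drv k (i - 1) (P k \<omega>)"
  have D: "(\<lambda>\<omega>. h * ?D \<omega>) \<in> borel_measurable \<Omega>" "integrable \<Omega> (\<lambda>\<omega>. (h * ?D \<omega>)\<^sup>2)"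
    using k by (auto intro!: borel_measurable_times borel_measurable_diff integrable_square_scale
        integrable_square_diff integrable_drv_square drv_measurable P)
  have "\<theta> k (Suc i) r - \<theta> k i r = expectation (\<lambda>\<omega>. vv k \<omega> r * (h * ?D \<omega>))" if r: "r \<in> JJ k" for r
  proof -
    have int: "integrable \<Omega> (\<lambda>\<omega>. vv k \<omega> r * target k j (P k \<omega>) (P (Suc k) \<omega>))" for j
      by (intro integrable_mult_of_squares orthonormal_onD(1,2)[OF o r] target_L2[OF k])
    have "\<theta> k (Suc i) r - \<theta> k i r = expectation (\<lambda>\<omega>. vv k \<omega> r * target k i (P k \<omega>) (P (Suc k) \<omega>) -
      vv k \<omega> r * target k (i - 1) (P k \<omega>) (P (Suc k) \<omega>))"
      using \<theta>_eq[OF k _ r, of "Suc i"] \<theta>_eq[OF k i r] int by simp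
    also have "\<dots> = expectation (\<lambda>\<omega>. vv k \<omega> r * (h * ?D \<omega>))"
      by (simp add: target_def algebra_simps)
    finally show ?thesis .
  qed
  then have "sqn (JJ k) (\<lambda>r. \<theta> k (Suc i) r - \<theta> k i r) =
      sqn (JJ k) (\<lambda>r. expectation (\<lambda>\<omega>. vv k \<omega> r * (h * ?D \<omega>)))"
    by (intro sqn_cong)
  also have "\<dots> \<le> expectation (\<lambda>\<omega>. (h * ?D \<omega>)\<^sup>2)" by (rule Bessel[OF o JJ_finite D])
  also have "\<dots> = h\<^sup>2 * expectation (\<lambda>\<omega>. (?D \<omega>)\<^sup>2)" by (simp add: power_mult_distrib)
  also have "\<dots> \<le> 4 * Cf\<^sup>2 * h * sqn (JJ k) (\<lambda>r. \<theta> k i r - \<theta> k (i - 1) r)"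
    by (rule drv_diff_expectation_le[OF k])
  finally show ?thesis .
qed

lemma \<theta>_last_increment:
  assumes k: "k < N"
  shows "sqn (JJ k) (\<lambda>r. \<theta> k I r - \<theta> k (I - 1) r) \<le>
      (8 * (4 * Cf\<^sup>2) * h) ^ (I - 1) * sqn (JJ k) (\<theta> k 1)"
proof -
  have "sqn (JJ k) (\<lambda>r. \<theta> k (Suc i) r - \<theta> k i r) \<le> (4 * Cf\<^sup>2 * h) ^ i * sqn (JJ k) (\<theta> k 1)" for i
  proof (induction i)
    case 0
    then show ?case by (simp add: \<theta>_0[OF k])
  next
    case (Suc i)
    have "sqn (JJ k) (\<lambda>r. \<theta> k (Suc (Suc i)) r - \<theta> k (Suc i) r) \<le>
        4 * Cf\<^sup>2 * h * sqn (JJ k) (\<lambda>r. \<theta> k (Suc i) r - \<theta> k i r)"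
      using \<theta>_increment_contracts[OF k, of "Suc i"] by simp
    also have "\<dots> \<le> 4 * Cf\<^sup>2 * h * ((4 * Cf\<^sup>2 * h) ^ i * sqn (JJ k) (\<theta> k 1))"
      using Suc h_pos by (intro mult_left_mono) auto
    finally show ?case by (simp only: power_Suc mult.assoc)
  qed
  from this[of "I - 1"] have "sqn (JJ k) (\<lambda>r. \<theta> k I r - \<theta> k (I - 1) r) \<le>
      (4 * Cf\<^sup>2 * h) ^ (I - 1) * sqn (JJ k) (\<theta> k 1)"
    using I by simp
  \<comment> \<open>The rate is weakened to the one that \<open>one_step\<close> obtains for the
    empirical iterates, so that both increments have the same bound.\<close>
  also have "\<dots> \<le> (8 * (4 * Cf\<^sup>2) * h) ^ (I - 1) * sqn (JJ k) (\<theta> k 1)"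
    using h_pos by (intro mult_right_mono power_mono) auto
  finally show ?thesis .
qed

lemma bnorm_L2:
  assumes k: "k < N"
  shows "(\<lambda>\<omega>. bnorm (p k l) (P k \<omega>)) \<in> borel_measurable \<Omega>"
      "integrable \<Omega> (\<lambda>\<omega>. (bnorm (p k l) (P k \<omega>))\<^sup>2)"
    "expectation (\<lambda>\<omega>. (bnorm (p k l) (P k \<omega>))\<^sup>2) = real (length (p k l))"
proof -
  note o = orthonormal_onD[OF orthonormal_p[OF k, of l]]
  show "(\<lambda>\<omega>. bnorm (p k l) (P k \<omega>)) \<in> borel_measurable \<Omega>"
    unfolding bnorm_def L2_set_def using o(1) by (auto simp: vecs_def)
  show "integrable \<Omega> (\<lambda>\<omega>. (bnorm (p k l) (P k \<omega>))\<^sup>2)"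
    unfolding bnorm_square sqn_def using o(2) by (intro Bochner_Integration.integrable_sum) auto
  have "expectation (\<lambda>\<omega>. (bnorm (p k l) (P k \<omega>))\<^sup>2) =
      (\<Sum>i<length (p k l). expectation (\<lambda>\<omega>. (vecs (p k l) (P k \<omega>) i)\<^sup>2))"
    unfolding bnorm_square sqn_def using o(2) by (intro Bochner_Integration.integral_sum) auto
  then show "expectation (\<lambda>\<omega>. (bnorm (p k l) (P k \<omega>))\<^sup>2) = real (length (p k l))"
    using o(3) by simp
qed

lemma rho_measurable: "k < N \<Longrightarrow> (\<lambda>\<omega>. rho C0 (p k l) (P k \<omega>)) \<in> borel_measurable \<Omega>"
  unfolding rho_def using bnorm_L2(1) by simp

lemma integrable_rho_square:
  assumes k: "k < N"
  shows "integrable \<Omega> (\<lambda>\<omega>. (rho C0 (p k l) (P k \<omega>))\<^sup>2)"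
proof (rule Bochner_Integration.integrable_bound)
  show "integrable \<Omega> (\<lambda>\<omega>. 1 + C0\<^sup>2 * (bnorm (p k l) (P k \<omega>))\<^sup>2)" using bnorm_L2[OF k] by simp
  show "(\<lambda>\<omega>. (rho C0 (p k l) (P k \<omega>))\<^sup>2) \<in> borel_measurable \<Omega>" using rho_measurable[OF k] by simp
  show "AE \<omega> in \<Omega>. norm ((rho C0 (p k l) (P k \<omega>))\<^sup>2) \<le> norm (1 + C0\<^sup>2 * (bnorm (p k l) (P k \<omega>))\<^sup>2)"
    using rho_square_le[OF C0] by (intro AE_I2) simp
qed

lemma nn_rho: "k < N \<Longrightarrow> expect_nn \<Omega> (\<lambda>\<omega>. (rho C0 (p k l) (P k \<omega>))\<^sup>2) = ennreal (R k l)"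
  unfolding R_def by (rule nn_integral_eq_integral[OF integrable_rho_square]) auto

lemma nn_rho_norm: "k < N \<Longrightarrow>
    expect_nn \<Omega> (\<lambda>\<omega>. (rho_norm C0 (p k) (P k \<omega>))\<^sup>2) = ennreal (\<Sum>l\<in>UNIV. R k l)"
proof -
  assume k: "k < N"
  have "integrable \<Omega> (\<lambda>\<omega>. (rho_norm C0 (p k) (P k \<omega>))\<^sup>2)"
    unfolding rho_norm_square using integrable_rho_square[OF k] by simp
  then have "expect_nn \<Omega> (\<lambda>\<omega>. (rho_norm C0 (p k) (P k \<omega>))\<^sup>2) =
      ennreal (expectation (\<lambda>\<omega>. (rho_norm C0 (p k) (P k \<omega>))\<^sup>2))"
    by (rule nn_integral_eq_integral) simp
  then show ?thesis
    unfolding rho_norm_square R_def using integrable_rho_square[OF k] by simp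
qed

text \<open>By orthonormality the mean of \<open>bnorm\<^sup>2\<close> is the length of the basis,
  which is at least 1. The bound by \<open>C0\<^sup>2\<close> is what later keeps \<open>C0\<close>
  out of the constants.\<close>

lemma R_ge:
  assumes k: "k < N"
  shows "1 \<le> R k l" "C0\<^sup>2 \<le> R k l" "0 \<le> R k l"
proof -
  have "expectation (\<lambda>_. 1) \<le> R k l"
    unfolding R_def using integrable_rho_square[OF k]
        by (intro integral_mono) (auto intro!: one_le_power rho_ge(1))
  then show "1 \<le> R k l" by (simp add: prob_space)
  then show "0 \<le> R k l" by simp
  have "expectation (\<lambda>\<omega>. C0\<^sup>2 * (bnorm (p k l) (P k \<omega>))\<^sup>2) \<le> R k l"
    unfolding R_def
  proof (rule integral_mono)
    show "C0\<^sup>2 * (bnorm (p k l) (P k \<omega>))\<^sup>2 \<le> (rho C0 (p k l) (P k \<omega>))\<^sup>2" for \<omega>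
      using power_mono[OF rho_ge(2)[of C0 "p k l" "P k \<omega>"], of 2] C0
      by (simp add: power_mult_distrib bnorm_def L2_set_nonneg)
  qed (use integrable_rho_square[OF k] bnorm_L2[OF k] in auto)
  then have "C0\<^sup>2 * real (length (p k l)) \<le> R k l" using bnorm_L2[OF k] by simp
  moreover have "1 \<le> real (length (p k l))" using basis(1)[OF k, of l] by (cases "p k l") auto
  then have "C0\<^sup>2 * 1 \<le> C0\<^sup>2 * real (length (p k l))" by (intro mult_left_mono) auto
  ultimately show "C0\<^sup>2 \<le> R k l" by simp
qed

text \<open>By orthonormality the squared norm of the coefficients is the second moment of the
  projected Y or Z, and this is dominated by the truncation level.\<close>

lemma \<alpha>_norm_le:
  assumes k: "k < N"
  shows "sqn {..<length (p k None)} (\<alpha> k i None) \<le> R k None"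
    "h * sqn {..<length (p k (Some l))} (\<alpha> k i (Some l)) \<le> R k (Some l)"
proof -
  have "expectation (\<lambda>\<omega>. (bdot (\<alpha> k i None) (p k None) (P k \<omega>))\<^sup>2) \<le> R k None"
    unfolding R_def
  proof (rule integral_mono_AE[OF integrable_bdot_square(1)[OF k] integrable_rho_square[OF k]])
    show "AE \<omega> in \<Omega>. (bdot (\<alpha> k i None) (p k None) (P k \<omega>))\<^sup>2 \<le> (rho C0 (p k None) (P k \<omega>))\<^sup>2"
      using dominated[OF k, of i]
      by eventually_elim (rule abs_le_imp_square_le, use k in \<open>simp add: Y_proj_def\<close>)
  qed
  then show "sqn {..<length (p k None)} (\<alpha> k i None) \<le> R k None"
    unfolding integrable_bdot_square(2)[OF k] .
  have "expectation (\<lambda>\<omega>. h * (bdot (\<alpha> k i (Some l)) (p k (Some l)) (P k \<omega>))\<^sup>2) \<le> R k (Some l)"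
    unfolding R_def
  proof (rule integral_mono_AE[OF _ integrable_rho_square[OF k]])
    show "integrable \<Omega> (\<lambda>\<omega>. h * (bdot (\<alpha> k i (Some l)) (p k (Some l)) (P k \<omega>))\<^sup>2)"
      using integrable_bdot_square(1)[OF k] by simp
    show "AE \<omega> in \<Omega>. h * (bdot (\<alpha> k i (Some l)) (p k (Some l)) (P k \<omega>))\<^sup>2 \<le>
        (rho C0 (p k (Some l)) (P k \<omega>))\<^sup>2"
      using dominated[OF k, of i]
    proof eventually_elim
      case (elim \<omega>)
      then have "\<bar>sqrt h * bdot (\<alpha> k i (Some l)) (p k (Some l)) (P k \<omega>)\<bar> \<le>
          rho C0 (p k (Some l)) (P k \<omega>)"
        using h_pos by (simp add: Z_proj_def abs_mult)
      from abs_le_imp_square_le[OF this] show ?case using h_pos by (simp add: power_mult_distrib)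
    qed
  qed
  then show "h * sqn {..<length (p k (Some l))} (\<alpha> k i (Some l)) \<le> R k (Some l)"
    using integrable_bdot_square[OF k] by simp
qed

lemma \<theta>_norm_le: "k < N \<Longrightarrow> sqn (JJ k) (\<theta> k i) \<le> (\<Sum>l\<in>UNIV. R k l)"
  unfolding sqn_v_index \<theta>_def sqn_idx0_cvec sqn_idx1_cvec[OF less_imp_le[OF h_pos]] sum_option
      sum_distrib_left
  by (intro add_mono sum_mono \<alpha>_norm_le)

end

section \<open>Second moment of the centred residual\<close>

lemma L2_set_square: "(L2_set v J)\<^sup>2 = sqn J v"
  by (simp add: L2_set_def sqn_def sum_nonneg)

lemma (in prob_space) nn_integral_combination:
  fixes f1 f2 f3 f4 :: "'a \<Rightarrow> ennreal"
  assumes [measurable]: "f1 \<in> borel_measurable M" "f2 \<in> borel_measurable M"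
      "f3 \<in> borel_measurable M"
      "f4 \<in> borel_measurable M"
  shows "(\<integral>\<^sup>+\<omega>. c1 * (f1 \<omega> + 1) + 3 * (f2 \<omega> + f3 \<omega> * c2) + c3 * (c4 * f4 \<omega>) \<partial>M) =
    c1 * (integral\<^sup>N M f1 + 1) + 3 * (integral\<^sup>N M f2 + integral\<^sup>N M f3 * c2) +
        c3 * (c4 * integral\<^sup>N M f4)"
proof -
  have "(\<integral>\<^sup>+\<omega>. c1 * (f1 \<omega> + 1) + 3 * (f2 \<omega> + f3 \<omega> * c2) + c3 * (c4 * f4 \<omega>) \<partial>M) =
      (\<integral>\<^sup>+\<omega>. c1 * (f1 \<omega> + 1) \<partial>M) + (\<integral>\<^sup>+\<omega>. 3 * (f2 \<omega> + f3 \<omega> * c2) \<partial>M) + (\<integral>\<^sup>+\<omega>. c3 * (c4 * f4 \<omega>) \<partial>M)"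
    by (subst nn_integral_add; (subst nn_integral_add)?; measurable)
  also have "(\<integral>\<^sup>+\<omega>. c1 * (f1 \<omega> + 1) \<partial>M) = c1 * (integral\<^sup>N M f1 + 1)"
    by (subst nn_integral_cmult, measurable, subst nn_integral_add) (auto simp: emeasure_space_1)
  also have "(\<integral>\<^sup>+\<omega>. 3 * (f2 \<omega> + f3 \<omega> * c2) \<partial>M) = 3 * (integral\<^sup>N M f2 + integral\<^sup>N M f3 * c2)"
    by (subst nn_integral_cmult, measurable, subst nn_integral_add) (auto simp: nn_integral_multc)
  also have "(\<integral>\<^sup>+\<omega>. c3 * (c4 * f4 \<omega>) \<partial>M) = c3 * (c4 * integral\<^sup>N M f4)"
    by (simp add: nn_integral_cmult)
  finally show ?thesis .
qed

context projected_regression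
begin

text \<open>One summand of tau: the failure of the population normal equation on a single path. It
  has mean zero under the law of \<open>P\<close> and the increments.\<close>

definition resid :: "nat \<Rightarrow> nat \<Rightarrow> 'd state \<Rightarrow> 'd state \<Rightarrow> real^'q \<Rightarrow> 'q option \<times> nat \<Rightarrow> real" where
  "resid k i x x' w r = v_vec h (p k) x w r * (ip (JJ k) (v_vec h (p k) x w) (\<theta> k i) - target k
      (i - 1) x x')"

lemma resid_mean_zero:
  assumes k: "k < N" and i: "1 \<le> i" and r: "r \<in> JJ k"
  shows "integrable \<Omega> (\<lambda>\<omega>. resid k i (P k \<omega>) (P (Suc k) \<omega>) (dW k \<omega>) r)"
    "expectation (\<lambda>\<omega>. resid k i (P k \<omega>) (P (Suc k) \<omega>) (dW k \<omega>) r) = 0"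
proof -
  note o = orthonormal_v[OF k]
  have int: "integrable \<Omega> (\<lambda>\<omega>. vv k \<omega> r * target k (i - 1) (P k \<omega>) (P (Suc k) \<omega>))"
    by (intro integrable_mult_of_squares orthonormal_onD(1,2)[OF o r] target_L2[OF k])
  note ip = orthonormal_mult_ip[OF o JJ_finite r, of "\<theta> k i"]
  show "integrable \<Omega> (\<lambda>\<omega>. resid k i (P k \<omega>) (P (Suc k) \<omega>) (dW k \<omega>) r)"
    unfolding resid_def right_diff_distrib by (intro Bochner_Integration.integrable_diff int ip(1))
  show "expectation (\<lambda>\<omega>. resid k i (P k \<omega>) (P (Suc k) \<omega>) (dW k \<omega>) r) = 0"
    unfolding resid_def right_diff_distrib using \<theta>_eq[OF k i r] int ip by simp
qed

definition Fr :: "nat \<Rightarrow> ennreal" where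
  "Fr k = expect_nn \<Omega> (\<lambda>\<omega>. (frob_norm (JJ k) (\<lambda>r s. outer (vv k \<omega>) r s - id_mat r s))\<^sup>2)"

text \<open>The summand that is multiplied by C/(hM) in the theorem, with the moments of rho
  replaced by their real values \<open>R\<close>.\<close>

definition stat :: "nat \<Rightarrow> ennreal" where
  "stat k = Fr k * ennreal (\<Sum>l\<in>UNIV. R k l)
     + expect_nn \<Omega> (\<lambda>\<omega>. (L2_set (vv k \<omega>) (JJ k))\<^sup>2 * (p0_norm \<Phi>N N p (Suc k) (P
         (Suc k) \<omega>))\<^sup>2) * ennreal (R k None)
     + ennreal (h\<^sup>2) * (\<integral>\<^sup>+\<omega>. ennreal ((L2_set (vv k \<omega>) (JJ k))\<^sup>2) *
          (1 + ennreal ((norm (fst (P k \<omega>)))\<^sup>2)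
           + ennreal ((bnorm (p k None) (P k \<omega>))\<^sup>2) * ennreal (R k None)
           + ennreal (1 / h) * (\<Sum>l\<in>UNIV. ennreal ((bnorm (p k (Some l)) (P k \<omega>))\<^sup>2) * ennreal (R k
               (Some l)))) \<partial>\<Omega>)"

text \<open>One entry comes from \<open>None\<close> and one from some \<open>Some l\<close>, the
  index type of the Brownian motion being nonempty.\<close>

lemma card_JJ: "k < N \<Longrightarrow> 2 \<le> card (JJ k)"
proof -
  assume k: "k < N"
  let ?l = "Some undefined :: 'q option"
  have "0 < length (p k l)" for l using basis(1)[OF k, of l] by simp
  then have "{(None, 0), (?l, 0)} \<subseteq> JJ k" by (auto simp: v_index_def)
  from card_mono[OF JJ_finite this] show ?thesis by simp
qed

lemma sqn_vv:
  assumes k: "k < N"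
  shows "(\<lambda>\<omega>. sqn (JJ k) (vv k \<omega>)) \<in> borel_measurable \<Omega>" "integrable \<Omega> (\<lambda>\<omega>. sqn (JJ k) (vv k \<omega>))"
    "expectation (\<lambda>\<omega>. sqn (JJ k) (vv k \<omega>)) = real (card (JJ k))"
proof -
  note o = orthonormal_onD[OF orthonormal_v[OF k]]
  show i: "integrable \<Omega> (\<lambda>\<omega>. sqn (JJ k) (vv k \<omega>))"
    unfolding sqn_def using o(2) by (rule Bochner_Integration.integrable_sum)
  then show "(\<lambda>\<omega>. sqn (JJ k) (vv k \<omega>)) \<in> borel_measurable \<Omega>" by simp
  have "expectation (\<lambda>\<omega>. sqn (JJ k) (vv k \<omega>)) = (\<Sum>r\<in>JJ k. expectation (\<lambda>\<omega>. (vv k \<omega> r)\<^sup>2))"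
    unfolding sqn_def using o(2) by (rule Bochner_Integration.integral_sum)
  then show "expectation (\<lambda>\<omega>. sqn (JJ k) (vv k \<omega>)) = real (card (JJ k))" using o(3) by simp
qed

text \<open>Since \<open>v\<^sub>k\<close> has at least two entries, \<open>\<parallel>v v\<^sup>T - Id\<parallel>\<^sub>F\<^sup>2\<close> dominates \<open>|v|\<^sup>2\<close> in mean,
    although not pointwise.\<close>

lemma Fr_ge:
  assumes k: "k < N"
  shows "expect_nn \<Omega> (\<lambda>\<omega>. sqn (JJ k) (vv k \<omega>)) \<le> Fr k" "1 \<le> Fr k"
proof -
  let ?F = "\<lambda>\<omega>. (frob_norm (JJ k) (\<lambda>r s. outer (vv k \<omega>) r s - id_mat r s))\<^sup>2"
  let ?s = "\<lambda>\<omega>. sqn (JJ k) (vv k \<omega>)"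
  define n where "n = real (card (JJ k))"
  have n: "2 \<le> n" using card_JJ[OF k] by (simp add: n_def)
  have "ennreal n \<le> Fr k"
  proof (cases "Fr k = \<infinity>")
    case False
    have F: "integrable \<Omega> ?F"
    proof (rule integrableI_nonneg)
      show "?F \<in> borel_measurable \<Omega>"
        unfolding frob_norm_outer_id[OF JJ_finite] using sqn_vv(1)[OF k] by simp
      show "expect_nn \<Omega> ?F < \<infinity>" using False unfolding Fr_def by (simp add: less_top)
    qed simp
    \<comment> \<open>Tangent to the square at the mean: \<open>?F\<close> is
      \<open>?s\<^sup>2 - 2 * ?s + n\<close>, and \<open>?s\<^sup>2\<close> is at least
      \<open>2 * n * ?s - n\<^sup>2\<close>. In mean this leaves \<open>n\<^sup>2 - n\<close>, which
      is at least \<open>n\<close> for \<open>n\<close> at least 2.\<close>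
    have "expectation (\<lambda>\<omega>. (2 * n - 2) * ?s \<omega> - n\<^sup>2 + n) \<le> expectation ?F"
    proof (rule integral_mono[OF _ F])
      show "integrable \<Omega> (\<lambda>\<omega>. (2 * n - 2) * ?s \<omega> - n\<^sup>2 + n)" using sqn_vv(2)[OF k] by simp
      fix \<omega>
      have "0 \<le> (?s \<omega> - n)\<^sup>2" by simp
      then show "(2 * n - 2) * ?s \<omega> - n\<^sup>2 + n \<le> ?F \<omega>"
        unfolding frob_norm_outer_id[OF JJ_finite] n_def[symmetric]
        by (simp add: power2_eq_square algebra_simps)
    qed
    moreover have "expectation (\<lambda>\<omega>. (2 * n - 2) * ?s \<omega> - n\<^sup>2 + n) = (2 * n - 2) * n - n\<^sup>2 + n"
      using sqn_vv[OF k] by (simp add: prob_space n_def)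
    moreover have "n * 2 \<le> n * n" using n by (intro mult_left_mono) auto
    then have "n \<le> (2 * n - 2) * n - n\<^sup>2 + n" by (simp add: power2_eq_square algebra_simps)
    ultimately have "n \<le> expectation ?F" by linarith
    then show ?thesis unfolding Fr_def nn_integral_eq_integral[OF F AE_I2[OF zero_le_power2]]
        by (rule ennreal_leI)
  qed simp
  moreover have "expect_nn \<Omega> ?s = ennreal n"
    unfolding n_def sqn_vv(3)[OF k, symmetric]
        by (rule nn_integral_eq_integral[OF sqn_vv(2)[OF k]]) simp
  moreover have "1 \<le> ennreal n" using n ennreal_leI[of 1 n] by simp
  ultimately show "expect_nn \<Omega> ?s \<le> Fr k" "1 \<le> Fr k" using order_trans[of 1 "ennreal n" "Fr k"]
      by auto
qed

definition Kf :: real where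
  "Kf = 4 * ((\<bar>f 0 0 0 0\<bar> + Cf * sqrt T)\<^sup>2 + Cf\<^sup>2)"

lemma Kf_nonneg: "0 \<le> Kf"
  by (simp add: Kf_def)

text \<open>Before the terminal time the value is dominated by rho, and the resulting factor
  \<open>C0\<^sup>2\<close> is absorbed into \<open>R k None\<close>. At the terminal time the norm
  is that of the value itself, by the convention for p_{0,N}, and \<open>R k None\<close> at least 1
  suffices.\<close>

lemma next_value_square_le:
  assumes k: "k < N"
  shows "AE \<omega> in \<Omega>. (Y_proj \<Phi>N N p \<alpha> I (Suc k) (P (Suc k) \<omega>))\<^sup>2 \<le>
      1 + (p0_norm \<Phi>N N p (Suc k) (P (Suc k) \<omega>))\<^sup>2 * R k None"
proof (cases "Suc k = N")
  case True
  have "y\<^sup>2 \<le> 1 + y\<^sup>2 * R k None" for y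
    using mult_left_mono[OF R_ge(1)[OF k, of None], of "y\<^sup>2"] by simp
  then show ?thesis using True by (simp add: Y_proj_def p0_norm_def)
next
  case False
  then have k': "Suc k < N" using k by simp
  show ?thesis
    using dominated[OF k', of I]
  proof eventually_elim
    case (elim \<omega>)
    then have "(Y_proj \<Phi>N N p \<alpha> I (Suc k) (P (Suc k) \<omega>))\<^sup>2 \<le>
        (rho C0 (p (Suc k) None) (P (Suc k) \<omega>))\<^sup>2"
      by (intro abs_le_imp_square_le) simp
    also have "\<dots> \<le> 1 + C0\<^sup>2 * (bnorm (p (Suc k) None) (P (Suc k) \<omega>))\<^sup>2"
        by (rule rho_square_le[OF C0])
    also have "\<dots> \<le> 1 + R k None * (bnorm (p (Suc k) None) (P (Suc k) \<omega>))\<^sup>2"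
      using R_ge(2)[OF k] by (intro add_left_mono mult_right_mono) auto
    finally show ?case using False by (simp add: p0_norm_def mult.commute)
  qed
qed

lemma drv_square_le:
  assumes k: "k < N"
  shows "(drv k i x)\<^sup>2 \<le> Kf * (1 + (norm (fst x))\<^sup>2 + (bnorm (p k None) x)\<^sup>2 * R k None +
    1 / h * (\<Sum>l\<in>UNIV. (bnorm (p k (Some l)) x)\<^sup>2 * R k (Some l)))"
proof -
  have "(drv k i x)\<^sup>2 \<le> Kf * (1 + (norm (fst x))\<^sup>2 + (bdot (\<alpha> k i None) (p k None) x)\<^sup>2 +
      (\<Sum>l\<in>UNIV. (bdot (\<alpha> k i (Some l)) (p k (Some l)) x)\<^sup>2))"
    unfolding drv_def Kf_def by (rule driver_growth) (use time_le[of k] k in simp)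
  also have "\<dots> \<le> Kf * (1 + (norm (fst x))\<^sup>2 + (bnorm (p k None) x)\<^sup>2 * R k None +
      (\<Sum>l\<in>UNIV. 1 / h * ((bnorm (p k (Some l)) x)\<^sup>2 * R k (Some l))))"
  proof (intro mult_left_mono add_mono sum_mono order_refl Kf_nonneg)
    show "(bdot (\<alpha> k i None) (p k None) x)\<^sup>2 \<le> (bnorm (p k None) x)\<^sup>2 * R k None"
      by (rule order_trans[OF bdot_square_le]) (intro mult_left_mono \<alpha>_norm_le(1)[OF k]; simp)
    fix l
    have "sqn {..<length (p k (Some l))} (\<alpha> k i (Some l)) \<le> 1 / h * R k (Some l)"
      using \<alpha>_norm_le(2)[OF k, of l i] h_pos by (simp add: field_simps)
    from mult_left_mono[OF this, of "(bnorm (p k (Some l)) x)\<^sup>2"]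
    show "(bdot (\<alpha> k i (Some l)) (p k (Some l)) x)\<^sup>2 \<le>
        1 / h * ((bnorm (p k (Some l)) x)\<^sup>2 * R k (Some l))"
      using bdot_square_le[of "\<alpha> k i (Some l)" "p k (Some l)" x] by (simp add: mult_ac)
  qed
  finally show ?thesis by (simp only: sum_distrib_left)
qed

lemma sum_R_ge: "k < N \<Longrightarrow> 1 \<le> (\<Sum>l\<in>UNIV. R k l)"
  unfolding sum_option using R_ge(1)[of k None] R_ge(3)[of k]
      by (simp add: add_increasing2 sum_nonneg)

text \<open>The residual is \<open>vv k\<close> times a sum of three terms: the regression value,
  the next value and the driver. Each yields one term of \<open>stat\<close>; the stray moments of
  \<open>vv k\<close> are absorbed into the Frobenius term.\<close>

lemma nn_resid_le:
  assumes k: "k < N"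
  shows "expect_nn \<Omega> (\<lambda>\<omega>. sqn (JJ k) (resid k i (P k \<omega>) (P (Suc k) \<omega>) (dW k \<omega>))) \<le>
      ennreal (15 + 3 * Kf) * stat k"
proof -
  let ?s = "\<lambda>\<omega>. sqn (JJ k) (vv k \<omega>)" and ?RR = "\<Sum>l\<in>UNIV. R k l" and ?R0 = "R k None"
  let ?F = "\<lambda>\<omega>. (frob_norm (JJ k) (\<lambda>r s. outer (vv k \<omega>) r s - id_mat r s))\<^sup>2"
  let ?q = "\<lambda>\<omega>. (p0_norm \<Phi>N N p (Suc k) (P (Suc k) \<omega>))\<^sup>2"
  let ?G = "\<lambda>\<omega>. 1 + (norm (fst (P k \<omega>)))\<^sup>2 + (bnorm (p k None) (P k \<omega>))\<^sup>2 * R k None +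
    1 / h * (\<Sum>l\<in>UNIV. (bnorm (p k (Some l)) (P k \<omega>))\<^sup>2 * R k (Some l))"
  have RR: "0 \<le> ?RR" using sum_R_ge[OF k] by simp
  have R0: "0 \<le> ?R0" by (rule R_ge(3)[OF k])
  have G0: "0 \<le> ?G \<omega>" for \<omega>
    using R_ge(3)[OF k] h_pos by (intro add_nonneg_nonneg mult_nonneg_nonneg sum_nonneg) auto
  have ms [measurable]: "?s \<in> borel_measurable \<Omega>" by (rule sqn_vv(1)[OF k])
  have mF [measurable]: "?F \<in> borel_measurable \<Omega>" unfolding frob_norm_outer_id[OF JJ_finite]
      by measurable
  have mq [measurable]: "?q \<in> borel_measurable \<Omega>"
  proof (cases "Suc k = N")
    case True
    then show ?thesis using measurable_compose[OF P \<Phi>N(1), of N] by (simp add: p0_norm_def)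
  next
    case False
    then show ?thesis using bnorm_L2(1)[of "Suc k" None] k by (simp add: p0_norm_def)
  qed
  have [measurable]: "(\<lambda>\<omega>. fst (P k \<omega>)) \<in> borel_measurable \<Omega>" using P_fst_measurable k by simp
  have [measurable]: "(\<lambda>\<omega>. bnorm (p k l) (P k \<omega>)) \<in> borel_measurable \<Omega>" for l
      by (rule bnorm_L2(1)[OF k])
  have mG [measurable]: "?G \<in> borel_measurable \<Omega>" by measurable
  have "AE \<omega> in \<Omega>. sqn (JJ k) (resid k i (P k \<omega>) (P (Suc k) \<omega>) (dW k \<omega>)) \<le>
      6 * ?RR * (?F \<omega> + 1) + 3 * (?s \<omega> + ?s \<omega> * ?q \<omega> * ?R0) + 3 * Kf * (h\<^sup>2 * (?s \<omega> * ?G \<omega>))"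
    using next_value_square_le[OF k]
  proof eventually_elim
    case (elim \<omega>)
    let ?y = "Y_proj \<Phi>N N p \<alpha> I (Suc k) (P (Suc k) \<omega>)" and ?d = "drv k (i - 1) (P k \<omega>)" and ?ip =
        "ip (JJ k) (vv k \<omega>) (\<theta> k i)"
    have eq: "?ip - target k (i - 1) (P k \<omega>) (P (Suc k) \<omega>) = ?ip + - ?y + - (h * ?d)"
      by (simp add: target_def)
    have "sqn (JJ k) (resid k i (P k \<omega>) (P (Suc k) \<omega>) (dW k \<omega>)) =
        ?s \<omega> * (?ip + - ?y + - (h * ?d))\<^sup>2"
      unfolding sqn_def resid_def eq power_mult_distrib sum_distrib_right ..
    also have "\<dots> \<le> ?s \<omega> * (3 * (?ip\<^sup>2 + (- ?y)\<^sup>2 + (- (h * ?d))\<^sup>2))"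
      by (intro mult_left_mono square_add3_le) simp
    also have "\<dots> = 3 * (?s \<omega> * ?ip\<^sup>2) + 3 * (?s \<omega> * ?y\<^sup>2) + 3 * (h\<^sup>2 * (?s \<omega> * ?d\<^sup>2))"
      by (simp add: power_mult_distrib algebra_simps)
    also have "\<dots> \<le> 3 * (2 * (?F \<omega> + 1) * ?RR) + 3 * (?s \<omega> * (1 + ?q \<omega> * ?R0)) +
        3 * (h\<^sup>2 * (?s \<omega> * (Kf * ?G \<omega>)))"
    proof (intro add_mono mult_left_mono elim drv_square_le[OF k])
      have "?s \<omega> * ?ip\<^sup>2 \<le> 2 * (?F \<omega> + 1) * sqn (JJ k) (\<theta> k i)" by (rule sqn_outer_le[OF JJ_finite])
      also have "\<dots> \<le> 2 * (?F \<omega> + 1) * ?RR" by (intro mult_left_mono \<theta>_norm_le[OF k]) simp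
      finally show "?s \<omega> * ?ip\<^sup>2 \<le> 2 * (?F \<omega> + 1) * ?RR" .
    qed simp_all
    also have "\<dots> = 6 * ?RR * (?F \<omega> + 1) + 3 * (?s \<omega> + ?s \<omega> * ?q \<omega> * ?R0) +
        3 * Kf * (h\<^sup>2 * (?s \<omega> * ?G \<omega>))"
    proof -
      have "3 * (2 * (F + 1) * c) + 3 * (s * (1 + q * r)) + 3 * (u * (s * (K * G))) =
          6 * c * (F + 1) + 3 * (s + s * q * r) + 3 * K * (u * (s * G))" for F c s q r u K G :: real
        by (simp add: algebra_simps)
      then show ?thesis .
    qed
    finally show ?case .
  qed
  then have "expect_nn \<Omega> (\<lambda>\<omega>. sqn (JJ k) (resid k i (P k \<omega>) (P (Suc k) \<omega>) (dW k \<omega>))) \<le>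
     expect_nn \<Omega> (\<lambda>\<omega>. 6 * ?RR * (?F \<omega> + 1) + 3 * (?s \<omega> + ?s \<omega> * ?q \<omega> * ?R0) +
         3 * Kf * (h\<^sup>2 * (?s \<omega> * ?G \<omega>)))"
    by (intro nn_integral_mono_AE) (auto elim!: eventually_mono intro: ennreal_leI)
  also have "\<dots> = (\<integral>\<^sup>+\<omega>. ennreal (6 * ?RR) * (ennreal (?F \<omega>) + 1) + 3 * (ennreal (?s \<omega>) +
      ennreal (?s \<omega> * ?q \<omega>) * ennreal ?R0) +
      ennreal (3 * Kf) * (ennreal (h\<^sup>2) * ennreal (?s \<omega> * ?G \<omega>)) \<partial>\<Omega>)"
  proof (rule nn_integral_cong)
    fix \<omega>
    have "ennreal (6 * c * (F + 1) + 3 * (s + s * q * r) + 3 * K * (u * (s * G))) =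
       ennreal (6 * c) * (ennreal F + 1) + 3 * (ennreal s + ennreal (s * q) * ennreal r) +
           ennreal (3 * K) * (ennreal u * ennreal (s * G))"
      if "0 \<le> F" "0 \<le> c" "0 \<le> s" "0 \<le> q" "0 \<le> r" "0 \<le> u" "0 \<le> K" "0 \<le> G" for F c s q r u K G :: real
    proof -
      have "ennreal (6 * c * (F + 1)) = ennreal (6 * c) * (ennreal F + 1)"
        using that by (subst ennreal_mult) (auto simp: ennreal_plus)
      moreover have "ennreal (3 * (s + s * q * r)) = 3 * (ennreal s + ennreal (s * q) * ennreal r)"
        using that by (simp add: ennreal_mult ennreal_plus)
      moreover have "ennreal (3 * K * (u * (s * G))) =
          ennreal (3 * K) * (ennreal u * ennreal (s * G))"
        using that by (subst ennreal_mult) (auto simp: ennreal_mult)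
      moreover have "ennreal (6 * c * (F + 1) + 3 * (s + s * q * r) + 3 * K * (u * (s * G))) =
          ennreal (6 * c * (F + 1)) + ennreal (3 * (s + s * q * r)) +
              ennreal (3 * K * (u * (s * G)))"
        using that by (simp add: ennreal_plus)
      ultimately show ?thesis by simp
    qed
    from this[OF zero_le_power2 RR sqn_nonneg zero_le_power2 R0 zero_le_power2 Kf_nonneg G0]
    show "ennreal (6 * ?RR * (?F \<omega> + 1) + 3 * (?s \<omega> + ?s \<omega> * ?q \<omega> * ?R0) +
        3 * Kf * (h\<^sup>2 * (?s \<omega> * ?G \<omega>))) =
      ennreal (6 * ?RR) * (ennreal (?F \<omega>) + 1) + 3 * (ennreal (?s \<omega>) +
          ennreal (?s \<omega> * ?q \<omega>) * ennreal ?R0) +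
      ennreal (3 * Kf) * (ennreal (h\<^sup>2) * ennreal (?s \<omega> * ?G \<omega>))" .
  qed
  also have "\<dots> = ennreal (6 * ?RR) * (Fr k + 1) + 3 * (expect_nn \<Omega> ?s +
      expect_nn \<Omega> (\<lambda>\<omega>. ?s \<omega> * ?q \<omega>) * ennreal ?R0) +
      ennreal (3 * Kf) * (ennreal (h\<^sup>2) * expect_nn \<Omega> (\<lambda>\<omega>. ?s \<omega> * ?G \<omega>))"
    unfolding Fr_def by (rule nn_integral_combination) measurable
  \<comment> \<open>As \<open>Fr k\<close> is at least 1, \<open>6 * (Fr k + 1)\<close> is at most
    \<open>12 * Fr k\<close>. The isolated second moment of \<open>vv k\<close> is at most
    \<open>Fr k\<close>, and \<open>?RR\<close> is at least 1. Together these give 15.\<close>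
  also have "\<dots> \<le> 12 * (Fr k * ennreal ?RR) + 3 * (Fr k * ennreal ?RR +
      expect_nn \<Omega> (\<lambda>\<omega>. ?s \<omega> * ?q \<omega>) * ennreal ?R0) +
      ennreal (3 * Kf) * (ennreal (h\<^sup>2) * expect_nn \<Omega> (\<lambda>\<omega>. ?s \<omega> * ?G \<omega>))"
  proof (intro add_mono mult_left_mono order_refl)
    have "ennreal (6 * ?RR) * (Fr k + 1) \<le> ennreal (6 * ?RR) * (Fr k + Fr k)"
      using Fr_ge(2)[OF k] by (intro mult_left_mono add_left_mono) auto
    also have "\<dots> = 12 * (Fr k * ennreal ?RR)"
    proof -
      have "ennreal (6 * ?RR) = 6 * ennreal ?RR" using RR by (simp add: ennreal_mult)
      moreover have "6 * a * (b + b) = 12 * (b * a)" for a b :: ennreal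
        by (simp add: mult_2[symmetric] mult_ac)
      ultimately show ?thesis by simp
    qed
    finally show "ennreal (6 * ?RR) * (Fr k + 1) \<le> 12 * (Fr k * ennreal ?RR)" .
    have "expect_nn \<Omega> ?s \<le> Fr k * 1" using Fr_ge(1)[OF k] by simp
    also have "\<dots> \<le> Fr k * ennreal ?RR"
      using ennreal_leI[OF sum_R_ge[OF k]] by (intro mult_left_mono) auto
    finally show "expect_nn \<Omega> ?s \<le> Fr k * ennreal ?RR" .
  qed auto
  also have "\<dots> \<le> ennreal (15 + 3 * Kf) * (Fr k * ennreal ?RR +
      expect_nn \<Omega> (\<lambda>\<omega>. ?s \<omega> * ?q \<omega>) * ennreal ?R0 +
      ennreal (h\<^sup>2) * expect_nn \<Omega> (\<lambda>\<omega>. ?s \<omega> * ?G \<omega>))"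
  proof -
    have "12 * a + 3 * (a + b) + ennreal (3 * Kf) * c \<le>
        ennreal (15 + 3 * Kf) * (a + b + c)" for a b c :: ennreal
    proof -
      have "12 * a + 3 * (a + b) + ennreal (3 * Kf) * c = 15 * a + 3 * b + ennreal (3 * Kf) * c"
      proof -
        have "15 * a = (12 + 3) * a" by simp
        also have "\<dots> = 12 * a + 3 * a" by (rule distrib_right)
        finally show ?thesis by (simp add: distrib_left add_ac)
      qed
      also have "\<dots> \<le> ennreal (15 + 3 * Kf) * a + ennreal (15 + 3 * Kf) * b + ennreal (15 +
          3 * Kf) * c"
      proof (intro add_mono mult_right_mono)
        show "15 \<le> ennreal (15 + 3 * Kf)" using ennreal_leI[of 15 "15 + 3 * Kf"] Kf_nonneg by simp
        show "3 \<le> ennreal (15 + 3 * Kf)" using ennreal_leI[of 3 "15 + 3 * Kf"] Kf_nonneg by simp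
        show "ennreal (3 * Kf) \<le> ennreal (15 + 3 * Kf)" by (rule ennreal_leI) simp
      qed auto
      finally show ?thesis by (simp add: distrib_left)
    qed
    then show ?thesis .
  qed
  also have "Fr k * ennreal ?RR + expect_nn \<Omega> (\<lambda>\<omega>. ?s \<omega> * ?q \<omega>) * ennreal ?R0 +
      ennreal (h\<^sup>2) * expect_nn \<Omega> (\<lambda>\<omega>. ?s \<omega> * ?G \<omega>) = stat k"
  proof -
    have "ennreal (?s \<omega> * ?G \<omega>) = ennreal (?s \<omega>) *
          (1 + ennreal ((norm (fst (P k \<omega>)))\<^sup>2)
           + ennreal ((bnorm (p k None) (P k \<omega>))\<^sup>2) * ennreal (R k None)
           + ennreal (1 / h) * (\<Sum>l\<in>UNIV. ennreal ((bnorm (p k (Some l)) (P k \<omega>))\<^sup>2) * ennreal (R k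
               (Some l))))" for \<omega>
    proof -
      have S: "0 \<le> (\<Sum>l\<in>UNIV. (bnorm (p k (Some l)) (P k \<omega>))\<^sup>2 * R k (Some l))"
        using R_ge(3)[OF k] by (intro sum_nonneg) simp
      have e1: "ennreal (\<Sum>l\<in>UNIV. (bnorm (p k (Some l)) (P k \<omega>))\<^sup>2 * R k (Some l)) =
         (\<Sum>l\<in>UNIV. ennreal ((bnorm (p k (Some l)) (P k \<omega>))\<^sup>2) * ennreal (R k (Some l)))"
        using R_ge(3)[OF k] by (subst sum_ennreal[symmetric]) (simp_all add: ennreal_mult)
      have e2: "ennreal (s * (1 + a + b * r + c * S)) =
          ennreal s * (1 + ennreal a + ennreal b * ennreal r + ennreal c * ennreal S)"
        if "0 \<le> s" "0 \<le> a" "0 \<le> b" "0 \<le> r" "0 \<le> c" "0 \<le> S" for s a b r c S :: real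
        using that by (simp add: ennreal_mult ennreal_plus)
      show ?thesis
        unfolding e1[symmetric] by (rule e2) (use S R0 h_pos in simp_all)
    qed
    then show ?thesis unfolding stat_def L2_set_square by simp
  qed
  finally show ?thesis .
qed

end

section \<open>The simulation-based scheme\<close>

lemma truncation_fun_Lipschitz:
  assumes "truncation_fun \<xi>"
  shows "\<bar>\<xi> x - \<xi> y\<bar> \<le> \<bar>x - y\<bar>"
proof -
  from assms obtain \<xi>1 where d: "\<And>x. (\<xi> has_real_derivative \<xi>1 x) (at x)"
    by (auto simp: truncation_fun_def C2b_def)
  have "\<bar>\<xi>1 x\<bar> \<le> 1" for x
    using assms unfolding truncation_fun_def DERIV_imp_deriv[OF d] by blast
  then have "norm (\<xi> x - \<xi> y) \<le> 1 * norm (x - y)"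
    by (intro field_differentiable_bound[of UNIV \<xi> \<xi>1]) (auto intro: d)
  then show ?thesis by simp
qed

lemma rho_hat_Lipschitz:
  assumes "truncation_fun \<xi>"
  shows "\<bar>rho_hat \<xi> C0 p x y - rho_hat \<xi> C0 p x y'\<bar> \<le> \<bar>y - y'\<bar>"
proof -
  let ?r = "rho C0 p x"
  have r: "0 < ?r" using rho_ge(1)[of C0 p x] by linarith
  have "\<bar>rho_hat \<xi> C0 p x y - rho_hat \<xi> C0 p x y'\<bar> = ?r * \<bar>\<xi> (y / ?r) - \<xi> (y' / ?r)\<bar>"
    using r by (simp add: rho_hat_def abs_mult right_diff_distrib[symmetric])
  also have "\<dots> \<le> ?r * \<bar>y / ?r - y' / ?r\<bar>"
    using r by (intro mult_left_mono truncation_fun_Lipschitz assms) simp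
  also have "\<dots> = \<bar>y - y'\<bar>"
    using r by (simp add: diff_divide_distrib[symmetric] abs_divide)
  finally show ?thesis .
qed

lemma rho_hat_id:
  assumes "truncation_fun \<xi>" "\<bar>y\<bar> \<le> rho C0 p x"
  shows "rho_hat \<xi> C0 p x y = y"
proof -
  have r: "0 < rho C0 p x" using rho_ge(1)[of C0 p x] by linarith
  then have "\<bar>y / rho C0 p x\<bar> \<le> 3/2" using assms(2) by (simp add: abs_divide field_simps)
  then show ?thesis using assms(1) r by (simp add: truncation_fun_def rho_hat_def)
qed

lemma rho_hat_bound:
  assumes "truncation_fun \<xi>"
  shows "\<bar>rho_hat \<xi> C0 p x y\<bar> \<le> 2 * rho C0 p x"
proof -
  have "0 < rho C0 p x" using rho_ge(1)[of C0 p x] by linarith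
  moreover have "\<bar>\<xi> (y / rho C0 p x)\<bar> \<le> 2" using assms by (simp add: truncation_fun_def)
  ultimately show ?thesis by (simp add: rho_hat_def abs_mult mult.commute)
qed

text \<open>The first bound is for the event on which the regressions are close. The second needs no
  closeness and consists of rho for \<open>y\<close> and twice rho for the truncated value.\<close>

lemma rho_hat_close:
  assumes "truncation_fun \<xi>" "\<bar>y\<bar> \<le> rho C0 p x"
  shows "\<bar>y - rho_hat \<xi> C0 p x y'\<bar> \<le> \<bar>y - y'\<bar>" "\<bar>y - rho_hat \<xi> C0 p x y'\<bar> \<le> 3 * rho C0 p x"
  using rho_hat_Lipschitz[OF assms(1), of C0 p x y y'] rho_hat_id[OF assms]
    rho_hat_bound[OF assms(1), of C0 p x y'] assms(2) by auto

lemma path_space_components: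
  shows "k \<le> N \<Longrightarrow> (\<lambda>z. fst z k) \<in> measurable (path_space e N) (state_space e)"
    and "k < N \<Longrightarrow> (\<lambda>z. snd z k) \<in> measurable (path_space e N) borel"
  unfolding path_space_def by measurable

locale simulated_regression = projected_regression T Cf f I N e h C0 S0 b \<sigma> \<Omega> W P \<Phi>N p \<alpha>
  for T Cf :: real and f :: "real \<Rightarrow> real^'d::finite \<Rightarrow> real \<Rightarrow> real^'q::finite \<Rightarrow> real"
    and I N e :: nat and h C0 :: real and S0 :: "real^'d"
    and b :: "real \<Rightarrow> real^'d \<Rightarrow> real^'d"
    and \<sigma> :: "real \<Rightarrow> real^'d \<Rightarrow> real^'q^'d"
    and \<Omega> :: "'w measure" and W :: "real \<Rightarrow> 'w \<Rightarrow> real^'q" and P :: "nat \<Rightarrow> 'w \<Rightarrow> 'd state"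
    and \<Phi>N :: "'d state \<Rightarrow> real" and p :: "nat \<Rightarrow> 'q option \<Rightarrow> 'd state basis"
    and \<alpha> :: "nat \<Rightarrow> nat \<Rightarrow> 'q coeffs" +
  fixes \<xi> :: "real \<Rightarrow> real" and M :: nat
    and Ps :: "nat \<Rightarrow> nat \<Rightarrow> 'w \<Rightarrow> 'd state" and dWs :: "nat \<Rightarrow> nat \<Rightarrow> 'w \<Rightarrow> real^'q"
    and \<alpha>M :: "'w \<Rightarrow> nat \<Rightarrow> nat \<Rightarrow> 'q coeffs"
  assumes trunc: "truncation_fun \<xi>" and M: "M \<ge> 1"
    and sims: "simulations \<Omega> T N e W P M Ps dWs"
    and sim_scheme: "simulation_scheme \<Omega> f h N I \<Phi>N p \<xi> C0 M Ps dWs \<alpha>M"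
    and h8: "h \<le> 1/8" and hK: "64 * (4 * Cf\<^sup>2) * h \<le> 1"
begin

abbreviation PS where "PS \<equiv> path_space e N :: ((nat \<Rightarrow> 'd state) \<times> (nat \<Rightarrow> real^'q)) measure"

abbreviation sim :: "nat \<Rightarrow> 'w \<Rightarrow> (nat \<Rightarrow> 'd state) \<times> (nat \<Rightarrow> real^'q)" where
  "sim m \<equiv> sample_path N (Ps m) (dWs m)"

lemma sample_path_simps:
  "k \<le> N \<Longrightarrow> fst (sample_path N Q D \<omega>) k = Q k \<omega>" "k < N \<Longrightarrow> snd (sample_path N Q D \<omega>) k = D k \<omega>"
  by (simp_all add: sample_path_def)

lemma sim_copies:
  "indep_vars (\<lambda>_. PS) sim {1..M}"
  "m \<in> {1..M} \<Longrightarrow> distr \<Omega> PS (sim m) = distr \<Omega> PS (sample_path N P dW)"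
  "m \<in> {1..M} \<Longrightarrow> sim m \<in> measurable \<Omega> PS"
proof -
  show i: "indep_vars (\<lambda>_. PS) sim {1..M}"
    and "m \<in> {1..M} \<Longrightarrow> distr \<Omega> PS (sim m) = distr \<Omega> PS (sample_path N P dW)"
    using sims unfolding simulations_def independent_copies_def h_eq by auto
  show "m \<in> {1..M} \<Longrightarrow> sim m \<in> measurable \<Omega> PS"
    using i unfolding indep_vars_def by auto
qed

lemma sample_measurable: "sample_path N P dW \<in> measurable \<Omega> PS"
  unfolding sample_path_def path_space_def using P dW_measurable
  by (intro measurable_Pair measurable_restrict) auto

lemma sim_measurable:
  assumes m: "m \<in> {1..M}"
  shows "k \<le> N \<Longrightarrow> Ps m k \<in> measurable \<Omega> (state_space e)" "k < N \<Longrightarrow> dWs m k \<in> borel_measurable \<Omega>"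
  using measurable_compose[OF sim_copies(3)[OF m] path_space_components(1)[of k N e]]
    measurable_compose[OF sim_copies(3)[OF m] path_space_components(2)[of k N e]]
  by (simp_all add: sample_path_simps)

text \<open>Almost sure properties of the state depend on its law alone, which the simulated paths
  share. This carries the domination by rho over to the simulations.\<close>

lemma AE_sim:
  assumes m: "m \<in> {1..M}" and k: "k \<le>
      N" and Q: "Measurable.pred (state_space e) Q" and ae: "AE \<omega> in \<Omega>. Q (P k \<omega>)"
  shows "AE \<omega> in \<Omega>. Q (Ps m k \<omega>)"
proof -
  have "Measurable.pred PS (\<lambda>z. Q (fst z k))"
    using Q measurable_compose[OF path_space_components(1)[OF k]] by blast
  then have s: "{z \<in> space PS. Q (fst z k)} \<in> sets PS" by measurable
  have "AE z in distr \<Omega> PS (sample_path N P dW). Q (fst z k)"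
    using ae k by (subst AE_distr_iff[OF sample_measurable s]) (simp add: sample_path_simps)
  then have "AE z in distr \<Omega> PS (sim m). Q (fst z k)" unfolding sim_copies(2)[OF m] .
  then show ?thesis
    using k by (subst (asm) AE_distr_iff[OF sim_copies(3)[OF m] s]) (simp add: sample_path_simps)
qed

abbreviation vs :: "nat \<Rightarrow> 'w \<Rightarrow> nat \<Rightarrow> 'q option \<times> nat \<Rightarrow> real" where
  "vs k \<omega> m \<equiv> v_vec h (p k) (Ps m k \<omega>) (dWs m k \<omega>)"

definition \<tau> :: "nat \<Rightarrow> 'w \<Rightarrow> nat \<Rightarrow> 'q option \<times> nat \<Rightarrow> real" where
  "\<tau> k \<omega> i r = avg M (\<lambda>m. resid k i (Ps m k \<omega>) (Ps m (Suc k) \<omega>) (dWs m k \<omega>) r)"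

lemma v_vec_measurable:
  assumes k: "k < N" and r: "r \<in> JJ k" and X: "X \<in> measurable Q (state_space e)"
      and D: "D \<in> borel_measurable Q"
  shows "(\<lambda>z. v_vec h (p k) (X z) (D z) r) \<in> borel_measurable Q"
proof -
  obtain l i where r': "r = (l, i)" "i < length (p k l)" using r by (auto simp: v_index_def)
  have "(\<lambda>z. (p k l ! i) (X z)) \<in> borel_measurable Q"
    by (rule measurable_compose[OF X basis_measurable[OF k r'(2)]])
  moreover have "(\<lambda>z. case l of None \<Rightarrow> 1 | Some l' \<Rightarrow> D z $ l' / sqrt h) \<in> borel_measurable Q"
    by (rule measurable_compose[OF D]) (cases l; simp)
  ultimately show ?thesis unfolding r'(1) v_vec_def by simp
qed

lemma resid_measurable:
  assumes k: "k < N" and r: "r \<in> JJ k"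
      and X: "X \<in> measurable Q (state_space e)" "X' \<in> measurable Q (state_space e)"
    and D: "D \<in> borel_measurable Q"
  shows "(\<lambda>z. resid k i (X z) (X' z) (D z) r) \<in> borel_measurable Q"
  unfolding resid_def target_def
  using k by (intro borel_measurable_times borel_measurable_diff borel_measurable_add
      borel_measurable_ip v_vec_measurable[OF k _ X(1) D] r
      drv_measurable[OF k X(1)] measurable_compose[OF X(2) Y_proj_measurable]
          borel_measurable_const) auto

text \<open>Each entry of \<open>\<tau>\<close> is the mean of one fixed measurable function
  \<open>?H r\<close> of independent copies of the path, and this function is centred. The entrywise
  variances are then added up.\<close>

lemma nn_\<tau>_le:
  assumes k: "k < N" and i: "1 \<le> i"
  shows "expect_nn \<Omega> (\<lambda>\<omega>. sqn (JJ k) (\<tau> k \<omega> i)) \<le>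
      ennreal (1 / real M) * (ennreal (15 + 3 * Kf) * stat k)"
proof -
  let ?H = "\<lambda>r z. resid k i (fst z k) (fst z (Suc k)) (snd z k) r"
  let ?Y = "\<lambda>r \<omega>. resid k i (P k \<omega>) (P (Suc k) \<omega>) (dW k \<omega>) r"
  let ?X = "\<lambda>r m \<omega>. resid k i (Ps m k \<omega>) (Ps m (Suc k) \<omega>) (dWs m k \<omega>) r"
  have H: "?H r \<in> borel_measurable PS" if "r \<in> JJ k" for r
    using k by (intro resid_measurable[OF k that] path_space_components) auto
  have X: "?X r m = (\<lambda>\<omega>. ?H r (sim m \<omega>))" for r m
    using k by (simp add: sample_path_simps)
  have Y: "?Y r = (\<lambda>\<omega>. ?H r (sample_path N P dW \<omega>))" for r
    using k by (simp add: sample_path_simps)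
  have one: "expect_nn \<Omega> (\<lambda>\<omega>. (\<tau> k \<omega> i r)\<^sup>2) \<le> ennreal (1 / real M) * expect_nn \<Omega> (\<lambda>\<omega>. (?Y r \<omega>)\<^sup>2)"
    if r: "r \<in> JJ k" for r
    unfolding \<tau>_def
  proof (rule nn_integral_avg_square_le[OF _ M _ resid_mean_zero[OF k i r]])
    show "indep_vars (\<lambda>_. borel) (?X r) {1..M}"
      unfolding X by (rule indep_vars_compose2[OF sim_copies(1) H[OF r]])
    show "distr \<Omega> borel (?X r m) = distr \<Omega> borel (?Y r)" if "m \<in> {1..M}" for m
      unfolding X Y distr_distr[OF H[OF r] sim_copies(3)[OF that], unfolded comp_def, symmetric]
        distr_distr[OF H[OF r] sample_measurable, unfolded comp_def,
            symmetric] sim_copies(2)[OF that] ..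
  qed
  have mt: "(\<lambda>\<omega>. ennreal ((\<tau> k \<omega> i r)\<^sup>2)) \<in> borel_measurable \<Omega>" if r: "r \<in> JJ k" for r
  proof -
    have "?X r m \<in> borel_measurable \<Omega>" if "m \<in> {1..M}" for m
      using k by (intro resid_measurable[OF k r] sim_measurable[OF that]) auto
    then have "(\<lambda>\<omega>. \<tau> k \<omega> i r) \<in> borel_measurable \<Omega>"
      unfolding \<tau>_def avg_def by (intro borel_measurable_divide borel_measurable_sum) auto
    then show ?thesis by simp
  qed
  have mY: "(\<lambda>\<omega>. ennreal ((?Y r \<omega>)\<^sup>2)) \<in> borel_measurable \<Omega>" if r: "r \<in> JJ k" for r
    using resid_mean_zero(1)[OF k i r] by (simp add: borel_measurable_integrable)
  have "expect_nn \<Omega> (\<lambda>\<omega>. sqn (JJ k) (\<tau> k \<omega> i)) = (\<Sum>r\<in>JJ k. expect_nn \<Omega> (\<lambda>\<omega>. (\<tau> k \<omega> i r)\<^sup>2))"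
    unfolding sqn_def using mt by (subst nn_integral_sum[symmetric]) (auto simp: sum_ennreal)
  also have "\<dots> \<le> (\<Sum>r\<in>JJ k. ennreal (1 / real M) * expect_nn \<Omega> (\<lambda>\<omega>. (?Y r \<omega>)\<^sup>2))"
    by (intro sum_mono one)
  also have "\<dots> = ennreal (1 / real M) * (\<Sum>r\<in>JJ k. expect_nn \<Omega> (\<lambda>\<omega>. (?Y r \<omega>)\<^sup>2))"
    by (rule sum_distrib_left[symmetric])
  also have "(\<Sum>r\<in>JJ k. expect_nn \<Omega> (\<lambda>\<omega>. (?Y r \<omega>)\<^sup>2)) =
      expect_nn \<Omega> (\<lambda>\<omega>. sqn (JJ k) (resid k i (P k \<omega>) (P (Suc k) \<omega>) (dW k \<omega>)))"
    unfolding sqn_def using mY by (subst nn_integral_sum[symmetric]) (auto simp: sum_ennreal)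
  also have "\<dots> \<le> ennreal (15 + 3 * Kf) * stat k" by (rule nn_resid_le[OF k])
  finally show ?thesis by (simp add: mult_left_mono)
qed

abbreviation A :: "nat \<Rightarrow> 'w set" where "A k \<equiv> good_event \<Omega> h N p M Ps dWs k"

text \<open>Over an empty index set \<open>eig_norm\<close> would be the supremum of the empty set,
  and the spectral criterion would be void.\<close>

lemma index_nonempty:
  assumes "k < N"
  shows "JJ k \<noteq> {}" "{..<length (p k l)} \<noteq> {}"
proof -
  show "JJ k \<noteq> {}" using card_JJ[OF assms] by force
  show "{..<length (p k l)} \<noteq> {}" using basis(1)[OF assms, of l] by auto
qed

lemma good_event_iff:
  "\<omega> \<in> A k \<longleftrightarrow> \<omega> \<in> space \<Omega> \<and> (\<forall>j\<in>{k..<N}. near_id M (JJ j) (vs j \<omega>) h \<and>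
     near_id M {..<length (p j None)} (\<lambda>m. vecs (p j None) (Ps m j \<omega>)) h \<and>
     (\<forall>l. near_id M {..<length (p j (Some l))} (\<lambda>m. vecs (p j (Some l)) (Ps m j \<omega>)) 1))"
proof -
  have 1: "eig_norm (JJ j) (emp_dev M u) \<le> c \<longleftrightarrow> near_id M (JJ j) u c" if "j \<in> {k..<N}" for j u c
    using that by (intro eig_norm_emp_dev_le_iff JJ_finite index_nonempty) simp
  have 2: "eig_norm {..<length (p j l)} (emp_dev M u) \<le> c \<longleftrightarrow> near_id M {..<length (p j l)} u c"
    if "j \<in> {k..<N}" for j l u c
    using that by (intro eig_norm_emp_dev_le_iff finite_lessThan index_nonempty) simp
  show ?thesis
    unfolding good_event_def mem_Collect_eq vecs_def
    by (intro conj_cong refl ball_cong) (simp_all only: 1 2)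
qed

definition \<theta>s :: "nat \<Rightarrow> 'w \<Rightarrow> nat \<Rightarrow> 'q option \<times> nat \<Rightarrow> real" where
  "\<theta>s k \<omega> i = cvec h (\<alpha>M \<omega> k i)"

definition drvs :: "nat \<Rightarrow> 'w \<Rightarrow> nat \<Rightarrow> nat \<Rightarrow> real" where
  "drvs k \<omega> i m = driver f (real k * h) (p k) (\<alpha>M \<omega> k i) (Ps m k \<omega>)"

abbreviation Ys :: "nat \<Rightarrow> 'w \<Rightarrow> nat \<Rightarrow> real" where
  "Ys k \<omega> m \<equiv> Y_sim \<xi> C0 \<Phi>N N p (\<alpha>M \<omega>) I k (Ps m k \<omega>)"

lemma \<alpha>M_0: "k < N \<Longrightarrow> \<omega> \<in> space \<Omega> \<Longrightarrow> \<alpha>M \<omega> k 0 = (\<lambda>_ _. 0)"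
  using sim_scheme by (simp add: simulation_scheme_def)

lemma sim_normal_equation:
  assumes k: "k < N" and \<omega>: "\<omega> \<in> space \<Omega>" and i: "1 \<le> i" "i \<le> I" and r: "r \<in> JJ k"
  shows "gram M (JJ k) (vs k \<omega>) (\<theta>s k \<omega> i) r =
      avg M (\<lambda>m. vs k \<omega> m r * (Ys (Suc k) \<omega> m + h * drvs k \<omega> (i - 1) m))"
proof (rule least_squares_avg[OF JJ_finite r])
  fix x :: "'q option \<times> nat \<Rightarrow> real"
  let ?F = "\<lambda>a. (\<Sum>m=1..M. (residual f h k p (\<alpha>M \<omega> k (i - 1)) a (Ys (Suc k) \<omega> m) (Ps m k \<omega>)
      (dWs m k \<omega>))\<^sup>2) / real M"
  have F: "?F a = avg M (\<lambda>m. (Ys (Suc k) \<omega> m +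
      h * drvs k \<omega> (i - 1) m - ip (JJ k) (vs k \<omega> m) (cvec h a))\<^sup>2)" for a
    unfolding residual_eq[OF h_pos] drvs_def avg_def ..
  have "is_arg_min ?F (\<lambda>_. True) (\<alpha>M \<omega> k i)"
    using sim_scheme k \<omega> i unfolding simulation_scheme_def by auto
  then have le: "?F (\<alpha>M \<omega> k i) \<le> ?F a" for a
    unfolding is_arg_min_def by (meson not_less)
  obtain a where "cvec h a = x" using cvec_surj[OF h_pos] by blast
  then show "avg M (\<lambda>m. (Ys (Suc k) \<omega> m +
      h * drvs k \<omega> (i - 1) m - ip (JJ k) (vs k \<omega> m) (\<theta>s k \<omega> i))\<^sup>2) \<le>
      avg M (\<lambda>m. (Ys (Suc k) \<omega> m + h * drvs k \<omega> (i - 1) m - ip (JJ k) (vs k \<omega> m) x)\<^sup>2)"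
    using le[of a] unfolding F \<theta>s_def by simp
qed

lemma Y_proj_dominated_sim:
  assumes m: "m \<in> {1..M}" and k: "k < N"
  shows "AE \<omega> in \<Omega>. \<bar>Y_proj \<Phi>N N p \<alpha> I k (Ps m k \<omega>)\<bar> \<le> rho C0 (p k None) (Ps m k \<omega>)"
proof (rule AE_sim[OF m])
  have [measurable]: "bnorm (p k None) \<in> borel_measurable (state_space e)"
    unfolding bnorm_def L2_set_def using basis_measurable[OF k] by measurable
  have [measurable]: "Y_proj \<Phi>N N p \<alpha> I k \<in> borel_measurable (state_space e)"
    using k by (intro Y_proj_measurable) simp
  show "Measurable.pred (state_space e) (\<lambda>x. \<bar>Y_proj \<Phi>N N p \<alpha> I k x\<bar> \<le> rho C0 (p k None) x)"
    unfolding rho_def by measurable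
  show "AE \<omega> in \<Omega>. \<bar>Y_proj \<Phi>N N p \<alpha> I k (P k \<omega>)\<bar> \<le> rho C0 (p k None) (P k \<omega>)"
    using dominated[OF k, of I] by eventually_elim simp
qed (use k in simp)

section \<open>Error recursion on the good event\<close>

definition L :: real where "L = (8 * (4 * Cf\<^sup>2)) ^ (I - 1)"
definition C1 :: real where "C1 = 2 * (4 * (64 * (4 * Cf\<^sup>2) + 1) + 3 + 64 * L) + 6"
definition C2 :: real where "C2 = 8 + 32 * L"

text \<open>The value 0 from time \<open>N\<close> on expresses that both schemes start from the
  same terminal values; it is the initial condition of the Gronwall argument.\<close>

definition ey :: "'w \<Rightarrow> nat \<Rightarrow> real" where
  "ey \<omega> k = (if k < N then sqn (idx0 (p k)) (\<lambda>r. \<theta> k I r - \<theta>s k \<omega> I r) else 0)"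

definition ez :: "'w \<Rightarrow> nat \<Rightarrow> real" where
  "ez \<omega> k = sqn (idx1 (p k)) (\<lambda>r. \<theta> k I r - \<theta>s k \<omega> I r)"

definition src :: "'w \<Rightarrow> nat \<Rightarrow> real" where
  "src \<omega> k = C2 / h * (sqn (JJ k) (\<tau> k \<omega> I) + sqn (JJ k) (\<tau> k \<omega> 1)) +
      C2 * h ^ (I - 1) * sqn (JJ k) (\<theta> k 1)"

lemma L_nonneg: "0 \<le> L" by (simp add: L_def)

lemma C_nonneg: "0 \<le> C1" "0 \<le> C2" using L_nonneg by (simp_all add: C1_def C2_def)

lemma src_nonneg: "0 \<le> src \<omega> k"
  using C_nonneg h_pos by (simp add: src_def)

text \<open>Instance of \<open>one_step\<close> at a fixed sample point, with
  \<open>K = 4 * Cf\<^sup>2\<close>. Randomness enters only through membership in \<open>A k\<close>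
  and the domination at the next time, which is therefore a pointwise hypothesis.\<close>

lemma error_step:
  assumes k: "k < N" and \<omega>: "\<omega> \<in> A k"
    and dom: "Suc k < N \<Longrightarrow>
        \<forall>m\<in>{1..M}. \<bar>Y_proj \<Phi>N N p \<alpha> I (Suc k) (Ps m (Suc k) \<omega>)\<bar> \<le>
        rho C0 (p (Suc k) None) (Ps m (Suc k) \<omega>)"
  shows "ey \<omega> k + ez \<omega> k / 2 \<le> (1 + C1 * h) * ey \<omega> (Suc k) + src \<omega> k"
proof -
  have sp: "\<omega> \<in> space \<Omega>" using \<omega> by (simp add: good_event_iff)
  have near: "near_id M (JJ k) (vs k \<omega>) h"
      "near_id M {..<length (p k None)} (\<lambda>m. vecs (p k None) (Ps m k \<omega>)) h"
    "\<And>l. near_id M {..<length (p k (Some l))} (\<lambda>m. vecs (p k (Some l)) (Ps m k \<omega>)) 1"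
    using \<omega> k by (auto simp: good_event_iff)
  have t: "real k * h \<in> {0..T}" using time_le[of k] k by simp
  have h01: "0 \<le> h" "h \<le> 1" using h_pos h1 by auto
  let ?y = "\<lambda>m. Y_proj \<Phi>N N p \<alpha> I (Suc k) (Ps m (Suc k) \<omega>)"
  let ?\<phi> = "\<lambda>i m. drv k i (Ps m k \<omega>)"
  have "sqn (idx0 (p k)) (\<lambda>r. \<theta> k I r - \<theta>s k \<omega> I r) +
      sqn (idx1 (p k)) (\<lambda>r. \<theta> k I r - \<theta>s k \<omega> I r) / 2 \<le>
    (1 + (2 * (4 * (64 * (4 * Cf\<^sup>2) + 1) + 3 + 64 * L) + 6) * h) * ey \<omega> (Suc k) +
    (8 + 32 * L) / h * (sqn (JJ k) (\<tau> k \<omega> I) + sqn (JJ k) (\<tau> k \<omega> 1)) + (8 +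
        32 * L) * h ^ (I - 1) * sqn (JJ k) (\<theta> k 1)"
  proof (rule one_step[where \<phi>' = "drvs k \<omega>" and \<phi> = ?\<phi> and y = ?y and y' = "Ys (Suc k) \<omega>" and v =
      "vs k \<omega>",
      OF finite_idx(1,2) idx_disjoint v_index_eq h_pos h8 _ hK I near(1)])
    show "0 \<le> ey \<omega> (Suc k)" by (simp add: ey_def)
    show "\<theta> k 0 r = 0" for r by (rule \<theta>_0[OF k])
    show "\<theta>s k \<omega> 0 r = 0" for r by (cases r) (simp add: \<theta>s_def cvec_def \<alpha>M_0[OF k sp])
    show "gram M (JJ k) (vs k \<omega>) (\<theta>s k \<omega> i) r =
        avg M (\<lambda>m. vs k \<omega> m r * (Ys (Suc k) \<omega> m + h * drvs k \<omega> (i - 1) m))"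
      if "1 \<le> i" "i \<le> I" "r \<in> JJ k" for i r by (rule sim_normal_equation[OF k sp that])
    \<comment> \<open>The truncation is removed first, then the error at the next time is measured
      along the samples. The event requires precision \<open>h\<close>, and not merely 1, for the
      Gram matrix of p_0: a larger factor than \<open>1 + h\<close> would not survive N
      steps.\<close>
    show "avg M (\<lambda>m. (?y m - Ys (Suc k) \<omega> m)\<^sup>2) \<le> (1 + h) * ey \<omega> (Suc k)"
    proof (cases "Suc k < N")
      case False
      then show ?thesis using k by (simp add: Y_proj_def Y_sim_def ey_def avg_def)
    next
      case True
      let ?d = "\<lambda>l j. \<alpha> (Suc k) I l j - \<alpha>M \<omega> (Suc k) I l j"
      have "avg M (\<lambda>m. (?y m - Ys (Suc k) \<omega> m)\<^sup>2) \<le>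
          avg M (\<lambda>m. (bdot (?d None) (p (Suc k) None) (Ps m (Suc k) \<omega>))\<^sup>2)"
      proof (rule avg_mono)
        fix m assume "m \<in> {1..M}"
        then have "\<bar>?y m\<bar> \<le> rho C0 (p (Suc k) None) (Ps m (Suc k) \<omega>)" using dom[OF True] by blast
        from rho_hat_close(1)[OF trunc this, of
            "bdot (\<alpha>M \<omega> (Suc k) I None) (p (Suc k) None) (Ps m (Suc k) \<omega>)"]
        have "\<bar>?y m - Ys (Suc k) \<omega> m\<bar> \<le> \<bar>bdot (?d None) (p (Suc k) None) (Ps m (Suc k) \<omega>)\<bar>"
          using True by (simp add: Y_proj_def Y_sim_def bdot_diff)
        from abs_le_imp_square_le[OF this]
        show "(?y m - Ys (Suc k) \<omega> m)\<^sup>2 \<le> (bdot (?d None) (p (Suc k) None) (Ps m (Suc k) \<omega>))\<^sup>2"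
            by simp
      qed
      also have "\<dots> \<le> (1 + h) * sqn {..<length (p (Suc k) None)} (?d None)"
        using \<omega> True unfolding bdot_eq_ip by (simp add: good_event_iff near_id_def)
      also have "sqn {..<length (p (Suc k) None)} (?d None) = ey \<omega> (Suc k)"
        using True sqn_idx0_cvec[of "p (Suc k)" h ?d] unfolding ey_def \<theta>_def \<theta>s_def cvec_diff
            by simp
      finally show ?thesis .
    qed
    show "h\<^sup>2 * avg M (\<lambda>m. (?\<phi> i m - drvs k \<omega> i m)\<^sup>2) \<le>
        4 * Cf\<^sup>2 * h * (h * sqn (idx0 (p k)) (\<lambda>r. \<theta> k i r - \<theta>s k \<omega> i r) +
        sqn (idx1 (p k)) (\<lambda>r. \<theta> k i r - \<theta>s k \<omega> i r))" for i
      unfolding drv_def drvs_def \<theta>_def \<theta>s_def by (rule driver_diff_avg_le[OF t h01 near(2,3)])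
    show "h\<^sup>2 * avg M (\<lambda>m. (drvs k \<omega> i m - drvs k \<omega> (i - 1) m)\<^sup>2) \<le>
        4 * Cf\<^sup>2 * h * (h * sqn (idx0 (p k)) (\<lambda>r. \<theta>s k \<omega> i r - \<theta>s k \<omega> (i - 1) r) +
        sqn (idx1 (p k)) (\<lambda>r. \<theta>s k \<omega> i r - \<theta>s k \<omega> (i - 1) r))" for i
      unfolding drvs_def \<theta>s_def by (rule driver_diff_avg_le[OF t h01 near(2,3)])
    show "sqn (JJ k) (\<lambda>r. \<theta> k I r - \<theta> k (I - 1) r) \<le>
        (8 * (4 * Cf\<^sup>2) * h) ^ (I - 1) * sqn (JJ k) (\<theta> k 1)"
      by (rule \<theta>_last_increment[OF k])
    show "\<tau> k \<omega> i r = avg M (\<lambda>m. vs k \<omega> m r * (ip (JJ k) (vs k \<omega> m) (\<theta> k i) - (?y m +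
        h * ?\<phi> (i - 1) m)))" for i r
      unfolding \<tau>_def resid_def target_def ..
  qed (simp_all add: L_def)
  then show ?thesis
    using k by (simp add: ey_def[of \<omega> k] ez_def src_def C1_def C2_def add_ac)
qed

text \<open>The exceptional null set is the finite union over times and paths where the domination
  fails. All steps from \<open>k\<close> on are available because \<open>A k\<close> is contained in
  \<open>A j\<close> for later \<open>j\<close>.\<close>

lemma error_bound:
  assumes k: "k < N"
  shows "AE \<omega> in \<Omega>. \<omega> \<in> A k \<longrightarrow> ey \<omega> k + (\<Sum>j=k..<N. ez \<omega> j) \<le> 2 * exp (C1 * T) * (\<Sum>j=k..<N. src \<omega> j)"
proof -
  have "AE \<omega> in \<Omega>. \<forall>j\<in>{..<N}. \<forall>m\<in>{1..M}. \<bar>Y_proj \<Phi>N N p \<alpha> I j (Ps m j \<omega>)\<bar> \<le>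
      rho C0 (p j None) (Ps m j \<omega>)"
    using Y_proj_dominated_sim by (intro AE_finite_allI) auto
  then show ?thesis
  proof eventually_elim
    case (elim \<omega>)
    show ?case
    proof
      assume \<omega>: "\<omega> \<in> A k"
      have hT: "C1 * h * real N = C1 * T" using N by (simp add: h_eq)
      have "ey \<omega> k + (\<Sum>j=k..<N. ez \<omega> j) \<le> 2 * exp (C1 * h * real N) * (\<Sum>j=k..<N. src \<omega> j)"
      proof (rule backward_Gronwall)
        show "ey \<omega> j + ez \<omega> j / 2 \<le> (1 + C1 * h) * ey \<omega> (Suc j) + src \<omega> j" if "k \<le> j" "j < N" for j
        proof (rule error_step)
          show "\<omega> \<in> A j" using \<omega> that by (auto simp: good_event_iff)
        qed (use that elim in auto)
      qed (use k C_nonneg h_pos src_nonneg in \<open>auto simp: ey_def ez_def\<close>)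
      then show "ey \<omega> k + (\<Sum>j=k..<N. ez \<omega> j) \<le> 2 * exp (C1 * T) * (\<Sum>j=k..<N. src \<omega> j)"
        unfolding hT .
    qed
  qed
qed

end

section \<open>Solving the empirical normal equation by iteration\<close>

primrec richardson :: "nat \<Rightarrow> 'i set \<Rightarrow> (nat \<Rightarrow> 'i \<Rightarrow> real) \<Rightarrow> ('i \<Rightarrow> real) \<Rightarrow> nat \<Rightarrow> 'i \<Rightarrow> real" where
  "richardson M J u g 0 = (\<lambda>_. 0)"
| "richardson M J u g (Suc n) =
    (\<lambda>r. richardson M J u g n r + (g r - gram M J u (richardson M J u g n) r))"

text \<open>With \<open>d\<close> the error and V the Gram matrix, the new error is d - V d. Since
  the squared norm of V d is at most \<open>1 + c\<close> times the form
  \<open>ip J d (V d)\<close>, the squared error drops by at least \<open>1 - c\<close> times this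
  form, hence by the fraction \<open>(1 - c)\<^sup>2\<close>. The iterates are finite expressions in
  \<open>u\<close> and \<open>g\<close>, so they inherit measurability from them.\<close>

lemma richardson_tendsto:
  assumes J: "finite J" and near: "near_id M J u c" and c: "0 \<le> c" "c < 1"
    and sol: "\<And>r. r \<in> J \<Longrightarrow> gram M J u x r = g r" and r: "r \<in> J"
  shows "(\<lambda>n. richardson M J u g n r) \<longlonglongrightarrow> x r"
proof -
  define d where "d = (\<lambda>n r. richardson M J u g n r - x r)"
  define \<kappa> where "\<kappa> = 1 - (1 - c)\<^sup>2"
  have "(1 - c)\<^sup>2 \<le> 1" "0 < (1 - c)\<^sup>2" using c by (auto simp: power_le_one)
  then have \<kappa>: "0 \<le> \<kappa>" "\<kappa> < 1" by (simp_all add: \<kappa>_def)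
  have step: "sqn J (d (Suc n)) \<le> \<kappa> * sqn J (d n)" for n
  proof -
    let ?q = "ip J (d n) (gram M J u (d n))"
    have "sqn J (d (Suc n)) = sqn J (\<lambda>r. d n r - gram M J u (d n) r)"
    proof (rule sqn_cong)
      fix r assume "r \<in> J"
      have "gram M J u (d n) r = gram M J u (richardson M J u g n) r - g r"
        unfolding d_def gram_diff sol[OF \<open>r \<in> J\<close>] ..
      then show "d (Suc n) r = d n r - gram M J u (d n) r" by (simp add: d_def)
    qed
    also have "\<dots> = sqn J (d n) - 2 * ?q + sqn J (gram M J u (d n))"
      by (simp add: sqn_def ip_def power2_diff sum.distrib sum_subtractf sum_distrib_left mult_ac)
    also have "sqn J (gram M J u (d n)) \<le> (1 + c) * ?q"
      using sqn_avg_le[OF near c(1), of "\<lambda>m. ip J (u m) (d n)"] unfolding ip_gram gram_def .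
    finally have "sqn J (d (Suc n)) \<le> sqn J (d n) - (1 - c) * ?q" by (simp add: algebra_simps)
    moreover have "(1 - c) * ((1 - c) * sqn J (d n)) \<le> (1 - c) * ?q"
      unfolding ip_gram using near c by (intro mult_left_mono) (auto simp: near_id_def)
    ultimately show ?thesis by (simp add: \<kappa>_def power2_eq_square algebra_simps)
  qed
  have pw: "sqn J (d n) \<le> \<kappa> ^ n * sqn J (d 0)" for n
  proof (induction n)
    case (Suc n)
    have "sqn J (d (Suc n)) \<le> \<kappa> * (\<kappa> ^ n * sqn J (d 0))"
      using step[of n] mult_left_mono[OF Suc \<kappa>(1)] by linarith
    then show ?case by (simp only: power_Suc mult.assoc)
  qed simp
  have "(\<lambda>n. \<kappa> ^ n * sqn J (d 0)) \<longlonglongrightarrow> 0 * sqn J (d 0)"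
    by (intro tendsto_mult LIMSEQ_realpow_zero \<kappa> tendsto_const)
  then have lim: "(\<lambda>n. \<kappa> ^ n * sqn J (d 0)) \<longlonglongrightarrow> 0" by simp
  have "(d n r)\<^sup>2 \<le> \<kappa> ^ n * sqn J (d 0)" for n
  proof -
    have "(d n r)\<^sup>2 \<le> sqn J (d n)" unfolding sqn_def using J r by (intro member_le_sum) auto
    then show ?thesis using pw[of n] by linarith
  qed
  then have "(\<lambda>n. (d n r)\<^sup>2) \<longlonglongrightarrow> 0"
    by (intro tendsto_sandwich[OF _ _ tendsto_const lim] always_eventually) auto
  then have "(\<lambda>n. d n r) \<longlonglongrightarrow> 0"
    using tendsto_real_sqrt[of "\<lambda>n. (d n r)\<^sup>2" 0 sequentially] by (simp add: tendsto_rabs_zero_iff)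
  then show ?thesis unfolding d_def by (simp add: LIM_zero_iff)
qed

lemma borel_measurable_avg:
  "(\<And>m. m \<in> {1..n} \<Longrightarrow> f m \<in> borel_measurable Q) \<Longrightarrow> (\<lambda>\<omega>. avg n (\<lambda>m. f m \<omega>)) \<in> borel_measurable Q"
  unfolding avg_def by (intro borel_measurable_divide borel_measurable_sum borel_measurable_const)

lemma indicator_bdot_square:
  "indicator A \<omega> * (bdot a p x)\<^sup>2 = (\<Sum>i<length p. (indicator A \<omega> * a i) * (p ! i) x)\<^sup>2"
  by (cases "\<omega> \<in> A") (simp_all add: bdot_def)

lemma indicator_sqn: "sqn J (\<lambda>r. indicator A \<omega> * x r) = indicator A \<omega> * sqn J x"
  by (cases "\<omega> \<in> A") (simp_all add: sqn_def)

section \<open>Independence of the empirical coefficients from the evaluation path\<close>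

context simulated_regression
begin

text \<open>The information in the simulations; \<open>HH\<close> below is the information in the
  original chain and Brownian motion. Membership in these sigma-algebras is how independence is
  passed on to coefficients and states.\<close>

definition GG :: "'w measure" where
  "GG = sigma_of \<Omega> (PiM {1..M} (\<lambda>_. PS)) (\<lambda>\<omega>. \<lambda>m\<in>{1..M}. sim m \<omega>)"

definition HH :: "'w measure" where
  "HH = sigma_of \<Omega> (PiM {..N} (\<lambda>_. state_space e) \<Otimes>\<^sub>M PiM {0..T} (\<lambda>_. borel)) (\<lambda>\<omega>.
      (\<lambda>k\<in>{..N}. P k \<omega>, \<lambda>t\<in>{0..T}. W t \<omega>))"

lemma indep_GG_HH: "indep_set (sets GG) (sets HH)"
  using sims unfolding simulations_def GG_def HH_def by blast

lemma space_GG [simp]: "space GG = space \<Omega>" and space_HH [simp]: "space HH = space \<Omega>"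
  by (simp_all add: GG_def HH_def)

lemma GG_HH_events: "sets GG \<subseteq> events" "sets HH \<subseteq> events"
  using indep_GG_HH by (auto simp: indep_set_def indep_sets_def split: bool.splits)

lemma measurable_GG:
  assumes X: "X \<in> measurable GG Q"
  shows "X \<in> measurable \<Omega> Q"
proof (rule measurableI)
  show "X \<omega> \<in> space Q" if "\<omega> \<in> space \<Omega>" for \<omega> using measurable_space[OF X] that by simp
  show "X -` D \<inter> space \<Omega> \<in> events" if "D \<in> sets Q" for D
    using measurable_sets[OF X that] GG_HH_events(1) by (simp only: space_GG) blast
qed

lemma sim_GG:
  assumes m: "m \<in> {1..M}"
  shows "sim m \<in> measurable GG PS"
proof -
  have "(\<lambda>\<omega>. \<lambda>m\<in>{1..M}. sim m \<omega>) \<in> measurable \<Omega> (PiM {1..M} (\<lambda>_. PS))"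
    using sim_copies(3) by (intro measurable_restrict) auto
  then have "(\<lambda>\<omega>. \<lambda>m\<in>{1..M}. sim m \<omega>) \<in> measurable GG (PiM {1..M} (\<lambda>_. PS))"
    unfolding GG_def by (intro measurable_vimage_algebra1) (auto dest: measurable_space)
  from measurable_compose[OF this measurable_component_singleton[OF m]] show ?thesis
    using m by simp
qed

lemma path_components_GG:
  assumes m: "m \<in> {1..M}"
  shows "k \<le> N \<Longrightarrow> Ps m k \<in> measurable GG (state_space e)" "k < N \<Longrightarrow> dWs m k \<in> borel_measurable GG"
  using measurable_compose[OF sim_GG[OF m] path_space_components(1)[of k N e]]
    measurable_compose[OF sim_GG[OF m] path_space_components(2)[of k N e]]
  by (simp_all add: sample_path_simps)

lemmas Ps_GG = path_components_GG(1) and dWs_GG = path_components_GG(2)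

lemma P_HH:
  assumes k: "k \<le> N"
  shows "P k \<in> measurable HH (state_space e)"
proof -
  let ?V = "\<lambda>\<omega>. (\<lambda>k\<in>{..N}. P k \<omega>, \<lambda>t\<in>{0..T}. W t \<omega>)"
  have "?V \<in> measurable \<Omega> (PiM {..N} (\<lambda>_. state_space e) \<Otimes>\<^sub>M PiM {0..T} (\<lambda>_. borel))"
    using P BM unfolding brownian_motion_def by (intro measurable_Pair measurable_restrict) auto
  then have V: "?V \<in> measurable HH (PiM {..N} (\<lambda>_. state_space e) \<Otimes>\<^sub>M PiM {0..T} (\<lambda>_. borel))"
    unfolding HH_def by (intro measurable_vimage_algebra1) (auto dest: measurable_space)
  have "(\<lambda>\<omega>. fst (?V \<omega>) k) \<in> measurable HH (state_space e)"
    using k by (intro measurable_compose[OF measurable_compose[OF V measurable_fst]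
        measurable_component_singleton]) simp
  then show ?thesis using k by simp
qed

lemma emp_dev_GG:
  assumes "\<And>m. m \<in> {1..M} \<Longrightarrow> (\<lambda>\<omega>. u \<omega> m r) \<in> borel_measurable GG" "\<And>m. m \<in> {1..M} \<Longrightarrow>
      (\<lambda>\<omega>. u \<omega> m s) \<in> borel_measurable GG"
  shows "(\<lambda>\<omega>. emp_dev M (u \<omega>) r s) \<in> borel_measurable GG"
  unfolding emp_dev_def outer_def using assms
  by (intro borel_measurable_diff borel_measurable_divide borel_measurable_sum
      borel_measurable_times borel_measurable_const)

lemma A_GG: "A k \<in> sets GG"
proof -
  have p: "(\<lambda>\<omega>. (p j l ! i) (Ps m j \<omega>)) \<in> borel_measurable GG" if "m \<in> {1..M}" "j < N"
      "i \<in> {..<length (p j l)}" for m j l i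
    using that by (intro measurable_compose[OF Ps_GG basis_measurable]) auto
  have v: "(\<lambda>\<omega>. vs j \<omega> m r) \<in> borel_measurable GG" if "m \<in> {1..M}" "j < N" "r \<in> JJ j" for m j r
    using that by (intro v_vec_measurable Ps_GG dWs_GG) auto
  have 1: "{\<omega> \<in> space GG. eig_norm (JJ j) (emp_dev M (vs j \<omega>)) \<le>
      c} \<in> sets GG" if "j \<in> {k..<N}" for j c
    using that by (intro measurable_eig_norm_le JJ_finite index_nonempty emp_dev_symmetric
        emp_dev_GG v) auto
  have 2: "{\<omega> \<in> space GG. eig_norm {..<length (p j l)} (emp_dev M (\<lambda>m i. (p j l ! i)
      (Ps m j \<omega>))) \<le> c} \<in> sets GG"
    if "j \<in> {k..<N}" for j l c
    using that by (intro measurable_eig_norm_le finite_lessThan index_nonempty emp_dev_symmetric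
        emp_dev_GG p) auto
  have "{\<omega> \<in> space GG. \<forall>j\<in>{k..<N}. eig_norm (JJ j) (emp_dev M (vs j \<omega>)) \<le> h \<and>
     eig_norm {..<length (p j None)} (emp_dev M (\<lambda>m i. (p j None ! i) (Ps m j \<omega>))) \<le> h \<and>
     (\<forall>l. eig_norm {..<length (p j (Some l))} (emp_dev M (\<lambda>m i. (p j (Some l) ! i) (Ps m j \<omega>))) \<le>
         1)} \<in> sets GG"
    by (intro sets.sets_Collect_finite_All sets.sets_Collect_conj sets.sets_Collect_countable_All
        1 2) auto
  then show ?thesis unfolding good_event_def by simp
qed

text \<open>The empirical minimizers are arbitrary off \<open>A k\<close>; on \<open>A k\<close> they are unique,
    and being limits of
  an explicit iteration they are functions of the simulations alone.\<close>

lemma \<alpha>M_restrict_measurable: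
  assumes k: "k \<le> j" "j < N" and i: "i \<le> I" and n: "n < length (p j l)"
  shows "(\<lambda>\<omega>. \<alpha>M \<omega> j i l n) \<in> borel_measurable (restrict_space GG (A k))"
proof -
  let ?Q = "restrict_space GG (A k)"
  have sQ: "space ?Q = A k"
    using sets.sets_into_space[OF A_GG[of k]] by (auto simp: space_restrict_space)
  have Ps: "Ps m j \<in> measurable ?Q (state_space e)" if "m \<in> {1..M}" "j \<le> N" for m j
    by (intro measurable_restrict_space1 Ps_GG that)
  have dWs: "dWs m j \<in> borel_measurable ?Q" if "m \<in> {1..M}" "j < N" for m j
    by (intro measurable_restrict_space1 dWs_GG that)
  \<comment> \<open>Inner induction, over the Picard iterates at a fixed time, given that the values
    at the next time are measurable with respect to the simulations.\<close>
  have coeff: "(\<lambda>\<omega>. \<alpha>M \<omega> j i l n) \<in> borel_measurable ?Q"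
    if j: "k \<le> j" "j < N" and i: "i \<le> I" and n: "n < length (p j l)"
      and Y: "\<And>m. m \<in> {1..M} \<Longrightarrow> (\<lambda>\<omega>. Ys (Suc j) \<omega> m) \<in> borel_measurable ?Q" for j i l n
    using i n
  proof (induction i arbitrary: l n)
    case 0
    have "(\<lambda>\<omega>. \<alpha>M \<omega> j 0 l n) \<in> borel_measurable ?Q \<longleftrightarrow> (\<lambda>_. 0 :: real) \<in> borel_measurable ?Q"
    proof (rule measurable_cong)
      fix \<omega> assume "\<omega> \<in> space ?Q"
      then have "\<omega> \<in> space \<Omega>" unfolding sQ good_event_iff by blast
      then show "\<alpha>M \<omega> j 0 l n = 0" by (simp add: \<alpha>M_0[OF j(2)])
    qed
    then show ?case by simp
  next
    case (Suc i)
    define g where "g = (\<lambda>\<omega> r. avg M (\<lambda>m. vs j \<omega> m r * (Ys (Suc j) \<omega> m + h * drvs j \<omega> i m)))"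
    have v: "(\<lambda>\<omega>. vs j \<omega> m r) \<in> borel_measurable ?Q" if "m \<in> {1..M}" "r \<in> JJ j" for m r
      using j that by (intro v_vec_measurable Ps dWs) auto
    have d: "(\<lambda>\<omega>. drvs j \<omega> i m) \<in> borel_measurable ?Q" if "m \<in> {1..M}" for m
      unfolding drvs_def
    proof (rule driver_measurable)
      show "Ps m j \<in> measurable ?Q (state_space e)" using that j by (intro Ps) auto
      show "set (p j l) \<subseteq> borel_measurable (state_space e)" for l by (rule basis(2)[OF j(2)])
    qed (use j Suc time_le[of j] in auto)
    have g: "(\<lambda>\<omega>. g \<omega> r) \<in> borel_measurable ?Q" if "r \<in> JJ j" for r
      unfolding g_def using that
      by (intro borel_measurable_avg borel_measurable_times borel_measurable_add
          borel_measurable_const v d Y)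
    have rich: "(\<lambda>\<omega>. richardson M (JJ j) (vs j \<omega>) (g \<omega>) q r) \<in> borel_measurable ?Q" if
        "r \<in> JJ j" for q r
      using that
    proof (induction q arbitrary: r)
      case (Suc q)
      show ?case
        unfolding richardson.simps gram_def
        by (intro borel_measurable_add borel_measurable_diff borel_measurable_avg
            borel_measurable_times borel_measurable_ip v Suc.IH Suc.prems g)
    qed simp
    have r: "(l, n) \<in> JJ j" using Suc.prems by (simp add: v_index_def)
    have lim: "(\<lambda>\<omega>. \<theta>s j \<omega> (Suc i) (l, n)) \<in> borel_measurable ?Q"
    proof (rule borel_measurable_LIMSEQ_real[OF _ rich[OF r]])
      fix \<omega> assume "\<omega> \<in> space ?Q"
      then have \<omega>: "\<omega> \<in> A k" "\<omega> \<in> space \<Omega>" unfolding sQ by (auto simp: good_event_iff)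
      show "(\<lambda>q. richardson M (JJ j) (vs j \<omega>) (g \<omega>) q (l, n)) \<longlonglongrightarrow> \<theta>s j \<omega> (Suc i) (l, n)"
      proof (rule richardson_tendsto[OF JJ_finite _ _ _ _ r])
        show "near_id M (JJ j) (vs j \<omega>) h" using \<omega>(1) j by (auto simp: good_event_iff)
        show "gram M (JJ j) (vs j \<omega>) (\<theta>s j \<omega> (Suc i)) r = g \<omega> r" if "r \<in> JJ j" for r
          using sim_normal_equation[OF j(2) \<omega>(2) _ _ that, of "Suc i"] Suc.prems
              by (simp add: g_def)
      qed (use h_pos h8 in auto)
    qed
    have s: "scl h l \<noteq> 0" using h_pos by (simp add: scl_def split: option.splits)
    have "(\<lambda>\<omega>. \<theta>s j \<omega> (Suc i) (l, n) / scl h l) \<in> borel_measurable ?Q" using lim by simp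
    then show ?case using s by (simp add: \<theta>s_def cvec_def)
  qed
  \<comment> \<open>Outer induction, backward in time: the coefficients at \<open>j\<close>
    determine the truncated values there, which feed the regression one step earlier.\<close>
  have Y: "\<forall>m\<in>{1..M}. (\<lambda>\<omega>. Ys j \<omega> m) \<in> borel_measurable ?Q" if "k \<le> j" "j \<le> N" for j
    using that(2,1)
  proof (induction j rule: inc_induct)
    case base
    have "Ys N \<omega> m = \<Phi>N (Ps m N \<omega>)" for \<omega> m by (simp add: Y_sim_def)
    then show ?case using measurable_compose[OF Ps \<Phi>N(1)] by simp
  next
    case (step j)
    have c: "(\<lambda>\<omega>. \<alpha>M \<omega> j I None n) \<in> borel_measurable ?Q" if "n < length (p j None)" for n
      using step that by (intro coeff) auto
    have \<xi>: "\<xi> \<in> borel_measurable borel"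
    proof (rule borel_measurable_continuous_onI)
      have "1-lipschitz_on UNIV \<xi>"
        using truncation_fun_Lipschitz[OF trunc] by (intro lipschitz_onI) (auto simp: dist_real_def)
      then show "continuous_on UNIV \<xi>" by (rule lipschitz_on_continuous_on)
    qed
    show ?case
    proof
      fix m assume m: "m \<in> {1..M}"
      have pm: "(\<lambda>\<omega>. (p j None ! i) (Ps m j \<omega>)) \<in> borel_measurable ?Q" if
          "i < length (p j None)" for i
        using step m that by (intro measurable_compose[OF Ps basis_measurable]) auto
      have b: "(\<lambda>\<omega>. bdot (\<alpha>M \<omega> j I None) (p j None) (Ps m j \<omega>)) \<in> borel_measurable ?Q"
        unfolding bdot_def using c pm by (intro borel_measurable_sum borel_measurable_times) auto
      have r: "(\<lambda>\<omega>. rho C0 (p j None) (Ps m j \<omega>)) \<in> borel_measurable ?Q"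
        unfolding rho_def bnorm_def L2_set_def using pm by auto
      show "(\<lambda>\<omega>. Ys j \<omega> m) \<in> borel_measurable ?Q"
        using step.hyps unfolding Y_sim_def rho_hat_def
        by (simp, intro borel_measurable_times r measurable_compose[OF borel_measurable_divide[OF
            b r] \<xi>])
    qed
  qed
  show ?thesis using k i n Y[of "Suc j"] by (intro coeff) auto
qed

abbreviation d\<alpha> :: "'w \<Rightarrow> nat \<Rightarrow> 'q option \<Rightarrow> nat \<Rightarrow> real" where
  "d\<alpha> \<omega> j l n \<equiv> \<alpha> j I l n - \<alpha>M \<omega> j I l n"

definition err :: "nat \<Rightarrow> nat \<Rightarrow> 'q option \<Rightarrow> 'w \<Rightarrow> real" where
  "err k j l \<omega> = indicator (A k) \<omega> * (bdot (d\<alpha> \<omega> j l) (p j l) (P j \<omega>))\<^sup>2"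

text \<open>Multiplication by the indicator replaces measurability on the restricted space by
  measurability on the whole space, as the decoupling requires.\<close>

lemma d\<alpha>_GG:
  assumes "k \<le> j" "j < N" "n < length (p j l)"
  shows "(\<lambda>\<omega>. indicator (A k) \<omega> * d\<alpha> \<omega> j l n) \<in> borel_measurable GG"
proof -
  have "(\<lambda>\<omega>. d\<alpha> \<omega> j l n) \<in> borel_measurable (restrict_space GG (A k))"
    by (intro borel_measurable_diff borel_measurable_const \<alpha>M_restrict_measurable assms order_refl)
  moreover have "A k \<inter> space GG \<in> sets GG" by (rule sets.Int[OF A_GG sets.top])
  ultimately show ?thesis by (simp add: borel_measurable_restrict_space_iff)
qed

lemma err_measurable:
  assumes j: "k \<le> j" "j < N"
  shows "err k j l \<in> borel_measurable \<Omega>"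
proof -
  have "(\<lambda>\<omega>. (indicator (A k) \<omega> * d\<alpha> \<omega> j l i) * (p j l ! i) (P j \<omega>)) \<in> borel_measurable \<Omega>"
    if "i < length (p j l)" for i
    using j that
    by (intro borel_measurable_times[OF measurable_GG[OF d\<alpha>_GG] measurable_compose[OF P
        basis_measurable]]) simp_all
  then show ?thesis
    unfolding err_def[abs_def] indicator_bdot_square
    by (intro borel_measurable_power borel_measurable_sum) simp
qed

text \<open>Decoupling: on \<open>A k\<close> the coefficient errors are functions of the
  simulations, while the basis is evaluated at the independent state \<open>P j\<close>. The
  indicator is put inside the square, into the coefficients.\<close>

lemma nn_err:
  assumes j: "k \<le> j" "j < N"
  shows "expect_nn \<Omega> (err k j l) =
      expect_nn \<Omega> (\<lambda>\<omega>. indicator (A k) \<omega> * sqn {..<length (p j l)} (d\<alpha> \<omega> j l))"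
proof -
  let ?J = "{..<length (p j l)}" and ?U = "\<lambda>\<omega> n. indicator (A k) \<omega> * d\<alpha> \<omega> j l n"
  have U: "(\<lambda>\<omega>. \<lambda>n\<in>?J. ?U \<omega> n) \<in> measurable GG (PiM ?J (\<lambda>_. borel))"
    using d\<alpha>_GG[OF j] by (intro measurable_restrict) auto
  have "expect_nn \<Omega> (\<lambda>\<omega>. (\<Sum>n\<in>?J. ?U \<omega> n * (p j l ! n) (P j \<omega>))\<^sup>2) = expect_nn \<Omega> (\<lambda>\<omega>. sqn ?J (?U \<omega>))"
  proof (rule decoupled_square[OF finite_lessThan indep_GG_HH measurable_GG[OF U] P])
    show "(\<lambda>\<omega>. \<lambda>n\<in>?J. ?U \<omega> n) -` D \<inter> space \<Omega> \<in> sets GG" if "D \<in> sets (PiM ?J (\<lambda>_. borel))" for D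
      using measurable_sets[OF U that] by simp
    show "P j -` D \<inter> space \<Omega> \<in> sets HH" if "D \<in> sets (state_space e)" for D
      using measurable_sets[OF P_HH that] j by simp
    show "orthonormal_on \<Omega> ?J (\<lambda>\<omega> r. (p j l ! r) (P j \<omega>))"
      using orthonormal_p[OF j(2), of l] by (simp add: vecs_def)
  qed (use j basis_measurable in auto)
  then show ?thesis
    unfolding err_def indicator_bdot_square indicator_sqn .
qed

lemma ey_eq: "k < N \<Longrightarrow> ey \<omega> k = sqn {..<length (p k None)} (d\<alpha> \<omega> k None)"
  unfolding ey_def \<theta>_def \<theta>s_def cvec_diff by (simp add: sqn_idx0_cvec)

lemma ez_eq: "ez \<omega> j = (\<Sum>l\<in>UNIV. h * sqn {..<length (p j (Some l))} (d\<alpha> \<omega> j (Some l)))"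
  unfolding ez_def \<theta>_def \<theta>s_def cvec_diff sqn_idx1_cvec[OF less_imp_le[OF h_pos]] sum_distrib_left
      ..

lemma indicator_sqn_measurable:
  assumes "k \<le> j" "j < N"
  shows "(\<lambda>\<omega>. indicator (A k) \<omega> * sqn {..<length (p j l)} (d\<alpha> \<omega> j l)) \<in> borel_measurable \<Omega>"
  unfolding indicator_sqn[symmetric]
  by (intro borel_measurable_sqn measurable_GG[OF d\<alpha>_GG[OF assms]]) simp

text \<open>The factors are 2 exp(C1 T) from Gronwall, \<open>C2\<close> from the single step, and
  \<open>2 * (15 + 3 * Kf)\<close> for the noise of the iterates \<open>I\<close> and 1. The
  additional 1 covers the term of order \<open>h ^ (I - 1)\<close>.\<close>

definition Cc :: real where "Cc = 2 * exp (C1 * T) * C2 * (2 * (15 + 3 * Kf) + 1)"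

lemma nn_src_le:
  assumes j: "j < N"
  shows "ennreal (2 * exp (C1 * T)) * expect_nn \<Omega> (\<lambda>\<omega>. src \<omega> j) \<le>
    ennreal (Cc * h ^ (I - 1)) * ennreal (\<Sum>l\<in>UNIV. R j l) + ennreal (Cc / (h * real M)) * stat j"
proof -
  let ?t = "\<lambda>i. expect_nn \<Omega> (\<lambda>\<omega>. sqn (JJ j) (\<tau> j \<omega> i))" and ?RR = "\<Sum>l\<in>UNIV. R j l"
  have X: "(\<lambda>\<omega>. resid j i (Ps m j \<omega>) (Ps m (Suc j) \<omega>) (dWs m j \<omega>) r) \<in> borel_measurable \<Omega>"
    if "m \<in> {1..M}" "r \<in> JJ j" for i m r
    using j that by (intro resid_measurable[OF j] sim_measurable) auto
  have mt [measurable]: "(\<lambda>\<omega>. sqn (JJ j) (\<tau> j \<omega> i)) \<in> borel_measurable \<Omega>" for i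
    unfolding \<tau>_def avg_def
    by (intro borel_measurable_sqn borel_measurable_divide borel_measurable_sum X
        borel_measurable_const)
  have hI: "0 \<le> h ^ (I - 1)" "0 \<le> C2 / h" using h_pos C_nonneg by auto
  have RR: "0 \<le> ?RR" using sum_R_ge[OF j] by simp
  have "expect_nn \<Omega> (\<lambda>\<omega>. src \<omega> j) =
      (\<integral>\<^sup>+\<omega>. ennreal (C2 / h) * (ennreal (sqn (JJ j) (\<tau> j \<omega> I)) + ennreal (sqn (JJ j) (\<tau> j \<omega> 1))) +
      ennreal (C2 * h ^ (I - 1) * sqn (JJ j) (\<theta> j 1)) \<partial>\<Omega>)"
  proof (rule nn_integral_cong)
    fix \<omega>
    have "ennreal (u * (a + b) + v) = ennreal u * (ennreal a + ennreal b) + ennreal v"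
      if "0 \<le> u" "0 \<le> a" "0 \<le> b" "0 \<le> v" for u a b v :: real
      using that by (simp add: ennreal_mult ennreal_plus)
    note e = this
    show "ennreal (src \<omega> j) =
        ennreal (C2 / h) * (ennreal (sqn (JJ j) (\<tau> j \<omega> I)) + ennreal (sqn (JJ j) (\<tau> j \<omega> 1))) +
      ennreal (C2 * h ^ (I - 1) * sqn (JJ j) (\<theta> j 1))"
      unfolding src_def by (rule e) (use hI C_nonneg in auto)
  qed
  also have "\<dots> = ennreal (C2 / h) * (?t I + ?t 1) + ennreal (C2 * h ^ (I - 1) * sqn (JJ j) (\<theta> j 1))"
    by (simp add: nn_integral_add nn_integral_cmult emeasure_space_1)
  also have "\<dots> \<le> ennreal (C2 / h) * (ennreal (1 / real M) * (ennreal (15 + 3 * Kf) * stat j) +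
      ennreal (1 / real M) * (ennreal (15 + 3 * Kf) * stat j)) +
      ennreal (C2 * h ^ (I - 1) * ?RR)"
  proof (intro add_mono mult_left_mono nn_\<tau>_le[OF j] ennreal_leI \<theta>_norm_le[OF j])
  qed (use I hI C_nonneg in auto)
  also have "\<dots> = ennreal (2 * (C2 / h) * (1 / real M) * (15 + 3 * Kf)) * stat j +
      ennreal (C2 * h ^ (I - 1)) * ennreal ?RR"
  proof -
    have e: "ennreal c * (ennreal a * (ennreal b * x) + ennreal a * (ennreal b * x)) =
        ennreal (2 * c * a * b) * x"
      if "0 \<le> a" "0 \<le> b" "0 \<le> c" for a b c :: real and x
    proof -
      have "ennreal (2 * c * a * b) = 2 * ennreal c * ennreal a * ennreal b"
        using that by (simp add: ennreal_mult)
      then show ?thesis by (simp add: mult_2[symmetric] mult_ac)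
    qed
    have e': "ennreal (C2 * h ^ (I - 1) * ?RR) = ennreal (C2 * h ^ (I - 1)) * ennreal ?RR"
      using hI C_nonneg RR by (intro ennreal_mult) auto
    show ?thesis unfolding e' by (subst e) (use hI Kf_nonneg in auto)
  qed
  finally have "ennreal (2 * exp (C1 * T)) * expect_nn \<Omega> (\<lambda>\<omega>. src \<omega> j) \<le>
      ennreal (2 * exp (C1 * T)) * \<dots>"
    by (rule mult_left_mono) simp
  also have "\<dots> = ennreal (2 * exp (C1 * T) * (2 * (C2 / h) * (1 / real M) * (15 +
      3 * Kf))) * stat j +
      ennreal (2 * exp (C1 * T) * (C2 * h ^ (I - 1))) * ennreal ?RR"
  proof -
    have e: "ennreal x * (ennreal u * a + ennreal v * b) =
        ennreal (x * u) * a + ennreal (x * v) * b"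
      if "0 \<le> x" "0 \<le> u" "0 \<le> v" for x u v :: real and a b :: ennreal
      using that by (simp add: distrib_left ennreal_mult mult.assoc)
    show ?thesis by (rule e) (use hI C_nonneg Kf_nonneg h_pos in auto)
  qed
  also have "\<dots> \<le> ennreal (Cc / (h * real M)) * stat j + ennreal (Cc * h ^ (I - 1)) * ennreal ?RR"
  proof (intro add_mono mult_right_mono ennreal_leI)
    define E where "E = 2 * exp (C1 * T)"
    have "0 \<le> E * C2" using C_nonneg by (simp add: E_def)
    have le: "E * C2 * (2 * (15 + 3 * Kf)) \<le> Cc" "E * C2 * 1 \<le> Cc"
      unfolding Cc_def E_def[symmetric]
      by (rule mult_left_mono[OF _ \<open>0 \<le> E * C2\<close>], use Kf_nonneg in simp)+
    have "x * (2 * (c / h) * (1 / m) * q) = x * c * (2 * q) / (h * m)" for x c m q :: real by simp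
    then have "E * (2 * (C2 / h) * (1 / real M) * (15 + 3 * Kf)) =
        E * C2 * (2 * (15 + 3 * Kf)) / (h * real M)" .
    also have "\<dots> \<le> Cc / (h * real M)" by (rule divide_right_mono[OF le(1)]) (use h_pos in simp)
    finally show "2 * exp (C1 * T) * (2 * (C2 / h) * (1 / real M) * (15 + 3 * Kf)) \<le>
        Cc / (h * real M)"
      unfolding E_def .
    show "2 * exp (C1 * T) * (C2 * h ^ (I - 1)) \<le> Cc * h ^ (I - 1)"
      using mult_right_mono[OF le(2) hI(1)] unfolding E_def
          by (simp only: mult.assoc mult_1_right mult_1)
  qed auto
  finally show ?thesis by (simp add: add.commute)
qed

lemma src_measurable: "j < N \<Longrightarrow> (\<lambda>\<omega>. src \<omega> j) \<in> borel_measurable \<Omega>"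
proof -
  assume j: "j < N"
  have X: "(\<lambda>\<omega>. resid j i (Ps m j \<omega>) (Ps m (Suc j) \<omega>) (dWs m j \<omega>) r) \<in> borel_measurable \<Omega>"
    if "m \<in> {1..M}" "r \<in> JJ j" for i m r
    using j that by (intro resid_measurable[OF j] sim_measurable) auto
  show ?thesis
    unfolding src_def \<tau>_def avg_def
    by (intro borel_measurable_add borel_measurable_times borel_measurable_const
        borel_measurable_sqn
        borel_measurable_divide borel_measurable_sum X)
qed

text \<open>Integrates the pathwise bound against the indicator of \<open>A k\<close>. By
  \<open>nn_err\<close> the prediction errors on the left may first be replaced by coefficient
  errors; on the right the indicator is simply dropped, as \<open>src\<close> is
  nonnegative.\<close>

lemma nn_err_sum_le:
  assumes k: "k < N"
  shows "expect_nn \<Omega> (err k k None) +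
      (\<Sum>j=k..<N. \<Sum>l\<in>UNIV. ennreal h * expect_nn \<Omega> (err k j (Some l))) \<le>
    (\<Sum>j=k..<N. ennreal (Cc * h ^ (I - 1)) * ennreal (\<Sum>l\<in>UNIV. R j l) +
        ennreal (Cc / (h * real M)) * stat j)"
proof -
  let ?s = "\<lambda>j l \<omega>. indicator (A k) \<omega> * sqn {..<length (p j l)} (d\<alpha> \<omega> j l)"
  have h0: "0 \<le> h" using h_pos by simp
  have ms [measurable]: "?s j l \<in> borel_measurable \<Omega>" if "j \<in> {k..<N}" for j l
    using that by (intro indicator_sqn_measurable) auto
  have "expect_nn \<Omega> (err k k None) +
      (\<Sum>j=k..<N. \<Sum>l\<in>UNIV. ennreal h * expect_nn \<Omega> (err k j (Some l))) =
    expect_nn \<Omega> (?s k None) + (\<Sum>j=k..<N. \<Sum>l\<in>UNIV. ennreal h * expect_nn \<Omega> (?s j (Some l)))"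
    using k by (simp add: nn_err)
  also have "\<dots> = (\<integral>\<^sup>+\<omega>. ennreal (?s k None \<omega>) +
      (\<Sum>j=k..<N. \<Sum>l\<in>UNIV. ennreal h * ennreal (?s j (Some l) \<omega>)) \<partial>\<Omega>)"
  proof -
    have "(\<Sum>j=k..<N. \<Sum>l\<in>UNIV. ennreal h * expect_nn \<Omega> (?s j (Some l))) =
        (\<Sum>j=k..<N. \<Sum>l\<in>UNIV. \<integral>\<^sup>+\<omega>. ennreal h * ennreal (?s j (Some l) \<omega>) \<partial>\<Omega>)"
      using ms by (intro sum.cong refl nn_integral_cmult[symmetric]) auto
    also have "\<dots> = (\<Sum>j=k..<N. \<integral>\<^sup>+\<omega>. (\<Sum>l\<in>UNIV. ennreal h * ennreal (?s j (Some l) \<omega>)) \<partial>\<Omega>)"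
      using ms by (intro sum.cong refl nn_integral_sum[symmetric]) auto
    also have "\<dots> = (\<integral>\<^sup>+\<omega>. (\<Sum>j=k..<N. \<Sum>l\<in>UNIV. ennreal h * ennreal (?s j (Some l) \<omega>)) \<partial>\<Omega>)"
      using ms by (intro nn_integral_sum[symmetric] borel_measurable_sum) auto
    finally show ?thesis
      using ms k by (subst nn_integral_add) (auto intro!: borel_measurable_sum)
  qed
  also have "\<dots> \<le> (\<integral>\<^sup>+\<omega>. ennreal (2 * exp (C1 * T)) * (\<Sum>j=k..<N. ennreal (src \<omega> j)) \<partial>\<Omega>)"
  proof (rule nn_integral_mono_AE)
    show "AE \<omega> in \<Omega>. ennreal (?s k None \<omega>) +
        (\<Sum>j=k..<N. \<Sum>l\<in>UNIV. ennreal h * ennreal (?s j (Some l) \<omega>)) \<le>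
      ennreal (2 * exp (C1 * T)) * (\<Sum>j=k..<N. ennreal (src \<omega> j))"
      using error_bound[OF k]
    proof eventually_elim
      case (elim \<omega>)
      show ?case
      proof (cases "\<omega> \<in> A k")
        case True
        have "ennreal (?s k None \<omega>) + (\<Sum>j=k..<N. \<Sum>l\<in>UNIV. ennreal h * ennreal (?s j (Some l) \<omega>)) =
            ennreal (ey \<omega> k + (\<Sum>j=k..<N. ez \<omega> j))"
        proof -
          have "(\<Sum>l\<in>UNIV. ennreal h * ennreal (?s j (Some l) \<omega>)) = ennreal (ez \<omega> j)" for j
            using True h0 by (simp add: ez_eq ennreal_mult[symmetric] sum_ennreal)
          then show ?thesis
            using True k by (simp add: ey_eq sum_ennreal ez_def ennreal_plus sum_nonneg)
        qed
        also have "\<dots> \<le> ennreal (2 * exp (C1 * T) * (\<Sum>j=k..<N. src \<omega> j))"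
          using elim True by (intro ennreal_leI) simp
        also have "\<dots> = ennreal (2 * exp (C1 * T)) * (\<Sum>j=k..<N. ennreal (src \<omega> j))"
          by (subst ennreal_mult) (auto simp: sum_ennreal src_nonneg sum_nonneg)
        finally show ?thesis .
      qed simp
    qed
  qed
  also have "\<dots> = (\<Sum>j=k..<N. ennreal (2 * exp (C1 * T)) * expect_nn \<Omega> (\<lambda>\<omega>. src \<omega> j))"
  proof -
    have m: "(\<lambda>\<omega>. ennreal (src \<omega> j)) \<in> borel_measurable \<Omega>" if "j \<in> {k..<N}" for j
      using src_measurable[of j] that by simp
    have "(\<integral>\<^sup>+\<omega>. ennreal (2 * exp (C1 * T)) * (\<Sum>j=k..<N. ennreal (src \<omega> j)) \<partial>\<Omega>) =
        ennreal (2 * exp (C1 * T)) * (\<integral>\<^sup>+\<omega>. (\<Sum>j=k..<N. ennreal (src \<omega> j)) \<partial>\<Omega>)"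
      using m by (intro nn_integral_cmult borel_measurable_sum) auto
    also have "(\<integral>\<^sup>+\<omega>. (\<Sum>j=k..<N. ennreal (src \<omega> j)) \<partial>\<Omega>) = (\<Sum>j=k..<N. expect_nn \<Omega> (\<lambda>\<omega>. src \<omega> j))"
      using m by (rule nn_integral_sum)
    finally show ?thesis by (simp add: sum_distrib_left)
  qed
  also have "\<dots> \<le> (\<Sum>j=k..<N. ennreal (Cc * h ^ (I - 1)) * ennreal (\<Sum>l\<in>UNIV. R j l) +
      ennreal (Cc / (h * real M)) * stat j)"
    by (intro sum_mono nn_src_le) auto
  finally show ?thesis .
qed


section \<open>Truncated errors on and off the good event\<close>

definition trunc_off :: "nat \<Rightarrow> nat \<Rightarrow> 'q option \<Rightarrow> 'w \<Rightarrow> real" where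
  "trunc_off k j l \<omega> = (rho C0 (p j l) (P j \<omega>))\<^sup>2 * indicator (space \<Omega> - A k) \<omega>"

lemma trunc_off_measurable:
  assumes "j < N"
  shows "trunc_off k j l \<in> borel_measurable \<Omega>"
proof -
  have "space \<Omega> - A k \<in> events" using A_GG[of k] GG_HH_events(1) by blast
  then show ?thesis
    unfolding trunc_off_def[abs_def] using rho_measurable[OF assms] by simp
qed

lemma square_error_cases:
  assumes \<omega>: "\<omega> \<in> space \<Omega>" and dom: "\<bar>y\<bar> \<le> rho C0 (p j l) (P j \<omega>)"
  shows "(y - rho_hat \<xi> C0 (p j l) (P j \<omega>) y')\<^sup>2 \<le>
      9 * trunc_off k j l \<omega> + indicator (A k) \<omega> * (y - y')\<^sup>2"
proof (cases "\<omega> \<in> A k")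
  case True
  then show ?thesis
    using abs_le_imp_square_le[OF rho_hat_close(1)[OF trunc dom, of y']]
        by (simp add: trunc_off_def)
next
  case False
  then show ?thesis
    using abs_le_imp_square_le[OF rho_hat_close(2)[OF trunc dom, of y']] \<omega>
    by (simp add: trunc_off_def power_mult_distrib)
qed

lemma Y_error_le:
  assumes k: "k < N"
  shows "expect_nn \<Omega> (\<lambda>\<omega>. (Y_proj \<Phi>N N p \<alpha> I k (P k \<omega>) - Y_sim \<xi> C0 \<Phi>N N p (\<alpha>M \<omega>) I k (P k \<omega>))\<^sup>2) \<le>
    9 * expect_nn \<Omega> (trunc_off k k None) + expect_nn \<Omega> (err k k None)"
proof -
  have "AE \<omega> in \<Omega>. (Y_proj \<Phi>N N p \<alpha> I k (P k \<omega>) - Y_sim \<xi> C0 \<Phi>N N p (\<alpha>M \<omega>) I k (P k \<omega>))\<^sup>2 \<le>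
      9 * trunc_off k k None \<omega> + err k k None \<omega>"
    using dominated[OF k, of I] AE_space
  proof eventually_elim
    case (elim \<omega>)
    then show ?case
      using square_error_cases[of \<omega> "bdot (\<alpha> k I None) (p k None) (P k \<omega>)" k None
          "bdot (\<alpha>M \<omega> k I None) (p k None) (P k \<omega>)" k] k
      by (simp add: Y_proj_def Y_sim_def err_def bdot_diff)
  qed
  then have "expect_nn \<Omega> (\<lambda>\<omega>. (Y_proj \<Phi>N N p \<alpha> I k (P k \<omega>) - Y_sim \<xi> C0 \<Phi>N N p (\<alpha>M \<omega>) I k
      (P k \<omega>))\<^sup>2) \<le>
      (\<integral>\<^sup>+\<omega>. 9 * ennreal (trunc_off k k None \<omega>) + ennreal (err k k None \<omega>) \<partial>\<Omega>)"
  proof (intro nn_integral_mono_AE, eventually_elim)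
    case (elim \<omega>)
    have "0 \<le> trunc_off k k None \<omega>" "0 \<le> err k k None \<omega>" by (simp_all add: trunc_off_def err_def)
    then show ?case using ennreal_leI[OF elim(2)] by (simp add: ennreal_plus ennreal_mult)
  qed
  also have "\<dots> = 9 * expect_nn \<Omega> (trunc_off k k None) + expect_nn \<Omega> (err k k None)"
    using trunc_off_measurable[OF k] err_measurable[OF order_refl k]
    by (simp add: nn_integral_add nn_integral_cmult)
  finally show ?thesis .
qed

text \<open>The truncation levels bound \<open>sqrt h\<close> times Z, so the comparison is made
  componentwise for this product; the outer factor \<open>h\<close> is the square of the
  weight.\<close>

lemma Z_error_le:
  assumes j: "k \<le> j" "j < N"
  shows "ennreal h * expect_nn \<Omega> (\<lambda>\<omega>. (norm (Z_proj p \<alpha> I j (P j \<omega>) - Z_sim \<xi> C0 h p (\<alpha>M \<omega>) I j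
      (P j \<omega>)))\<^sup>2) \<le>
    (\<Sum>l\<in>UNIV. 9 * expect_nn \<Omega> (trunc_off k j (Some l)) +
        ennreal h * expect_nn \<Omega> (err k j (Some l)))"
proof -
  let ?D = "\<lambda>\<omega>. Z_proj p \<alpha> I j (P j \<omega>) - Z_sim \<xi> C0 h p (\<alpha>M \<omega>) I j (P j \<omega>)"
  let ?B = "\<lambda>l \<omega>. 9 * ennreal (trunc_off k j (Some l) \<omega>) + ennreal h * ennreal (err k j (Some l) \<omega>)"
  have nn: "0 \<le> trunc_off k j l \<omega>" "0 \<le> err k j l \<omega>" for l \<omega>
      by (simp_all add: trunc_off_def err_def)
  have mB: "?B l \<in> borel_measurable \<Omega>" for l
    using trunc_off_measurable[OF j(2)] err_measurable[OF j] by simp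
  have "AE \<omega> in \<Omega>. ennreal ((norm (?D \<omega>))\<^sup>2) \<le> ennreal (1 / h) * (\<Sum>l\<in>UNIV. ?B l \<omega>)"
    using dominated[OF j(2), of I] AE_space
  proof eventually_elim
    case (elim \<omega>)
    have comp: "h * (?D \<omega> $ l)\<^sup>2 \<le> 9 * trunc_off k j (Some l) \<omega> + h * err k j (Some l) \<omega>" for l
    proof -
      let ?y = "bdot (\<alpha> j I (Some l)) (p j (Some l)) (P j \<omega>)" and ?y' =
          "bdot (\<alpha>M \<omega> j I (Some l)) (p j (Some l)) (P j \<omega>)"
      have s: "sqrt h \<noteq> 0" "(sqrt h)\<^sup>2 = h" using h_pos by simp_all
      have "h * (?D \<omega> $ l)\<^sup>2 = (sqrt h * ?D \<omega> $ l)\<^sup>2" by (simp add: power_mult_distrib s)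
      also have "sqrt h * ?D \<omega> $ l =
          sqrt h * ?y - rho_hat \<xi> C0 (p j (Some l)) (P j \<omega>) (sqrt h * ?y')"
        using s by (simp add: Z_proj_def Z_sim_def right_diff_distrib)
      also have "(\<dots>)\<^sup>2 \<le>
          9 * trunc_off k j (Some l) \<omega> + indicator (A k) \<omega> * (sqrt h * ?y - sqrt h * ?y')\<^sup>2"
      proof (rule square_error_cases)
        show "\<bar>sqrt h * ?y\<bar> \<le> rho C0 (p j (Some l)) (P j \<omega>)"
          using elim(1) h_pos by (simp add: Z_proj_def abs_mult)
      qed (rule elim(2))
      also have "indicator (A k) \<omega> * (sqrt h * ?y - sqrt h * ?y')\<^sup>2 = h * err k j (Some l) \<omega>"
        unfolding right_diff_distrib[symmetric] power_mult_distrib s err_def bdot_diff by simp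
      finally show ?thesis .
    qed
    have "(norm (?D \<omega>))\<^sup>2 = 1 / h * (\<Sum>l\<in>UNIV. h * (?D \<omega> $ l)\<^sup>2)"
      unfolding norm_vec_square sum_distrib_left[symmetric] using h_pos by simp
    also have "\<dots> \<le> 1 / h * (\<Sum>l\<in>UNIV. 9 * trunc_off k j (Some l) \<omega> + h * err k j (Some l) \<omega>)"
      using h_pos by (intro mult_left_mono sum_mono comp) simp
    finally have "ennreal ((norm (?D \<omega>))\<^sup>2) \<le>
        ennreal (1 / h * (\<Sum>l\<in>UNIV. 9 * trunc_off k j (Some l) \<omega> + h * err k j (Some l) \<omega>))"
      by (rule ennreal_leI)
    also have "\<dots> = ennreal (1 / h) * ennreal (\<Sum>l\<in>UNIV. 9 * trunc_off k j (Some l) \<omega> +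
        h * err k j (Some l) \<omega>)"
      using h_pos nn by (intro ennreal_mult) (auto intro!: sum_nonneg add_nonneg_nonneg)
    also have "ennreal (\<Sum>l\<in>UNIV. 9 * trunc_off k j (Some l) \<omega> + h * err k j (Some l) \<omega>) =
        (\<Sum>l\<in>UNIV. ?B l \<omega>)"
      using h_pos nn by (subst sum_ennreal[symmetric])
          (auto simp: ennreal_plus ennreal_mult intro!: add_nonneg_nonneg)
    finally show ?case .
  qed
  then have "ennreal h * expect_nn \<Omega> (\<lambda>\<omega>. (norm (?D \<omega>))\<^sup>2) \<le>
      ennreal h * (\<integral>\<^sup>+\<omega>. ennreal (1 / h) * (\<Sum>l\<in>UNIV. ?B l \<omega>) \<partial>\<Omega>)"
    by (intro mult_left_mono nn_integral_mono_AE) auto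
  also have "(\<integral>\<^sup>+\<omega>. ennreal (1 / h) * (\<Sum>l\<in>UNIV. ?B l \<omega>) \<partial>\<Omega>) =
      ennreal (1 / h) * (\<integral>\<^sup>+\<omega>. (\<Sum>l\<in>UNIV. ?B l \<omega>) \<partial>\<Omega>)"
    using mB by (intro nn_integral_cmult borel_measurable_sum) auto
  also have "(\<integral>\<^sup>+\<omega>. (\<Sum>l\<in>UNIV. ?B l \<omega>) \<partial>\<Omega>) = (\<Sum>l\<in>UNIV. integral\<^sup>N \<Omega> (?B l))"
    using mB by (intro nn_integral_sum) auto
  also have "ennreal h * (ennreal (1 / h) * (\<Sum>l\<in>UNIV. integral\<^sup>N \<Omega> (?B l))) =
      (\<Sum>l\<in>UNIV. integral\<^sup>N \<Omega> (?B l))"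
    using h_pos by (simp add: mult.assoc[symmetric] ennreal_mult[symmetric])
  also have "\<dots> = (\<Sum>l\<in>UNIV. 9 * expect_nn \<Omega> (trunc_off k j (Some l)) +
      ennreal h * expect_nn \<Omega> (err k j (Some l)))"
    using trunc_off_measurable[OF j(2)] err_measurable[OF j]
    by (intro sum.cong refl) (simp add: nn_integral_add nn_integral_cmult)
  finally show ?thesis .
qed

lemma nn_trunc_off:
  assumes j: "j < N"
  shows "expect_nn \<Omega> (\<lambda>\<omega>. (rho_norm C0 (p j) (P j \<omega>))\<^sup>2 * indicator (space \<Omega> - A k) \<omega>) =
    expect_nn \<Omega> (trunc_off k j None) + (\<Sum>l\<in>UNIV. expect_nn \<Omega> (trunc_off k j (Some l)))"
proof -
  have nn: "0 \<le> trunc_off k j l \<omega>" for l \<omega> by (simp add: trunc_off_def)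
  have m: "(\<lambda>\<omega>. ennreal (trunc_off k j l \<omega>)) \<in> borel_measurable \<Omega>" for l
    using trunc_off_measurable[OF j] by simp
  have "expect_nn \<Omega> (\<lambda>\<omega>. (rho_norm C0 (p j) (P j \<omega>))\<^sup>2 * indicator (space \<Omega> - A k) \<omega>) =
      (\<integral>\<^sup>+\<omega>. ennreal (trunc_off k j None \<omega>) + (\<Sum>l\<in>UNIV. ennreal (trunc_off k j (Some l) \<omega>)) \<partial>\<Omega>)"
  proof (rule nn_integral_cong)
    fix \<omega>
    have "(rho_norm C0 (p j) (P j \<omega>))\<^sup>2 * indicator (space \<Omega> - A k) \<omega> =
        trunc_off k j None \<omega> + (\<Sum>l\<in>UNIV. trunc_off k j (Some l) \<omega>)"
      unfolding rho_norm_square sum_option trunc_off_def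
          by (simp add: distrib_right sum_distrib_right)
    then show "ennreal ((rho_norm C0 (p j) (P j \<omega>))\<^sup>2 * indicator (space \<Omega> - A k) \<omega>) =
        ennreal (trunc_off k j None \<omega>) + (\<Sum>l\<in>UNIV. ennreal (trunc_off k j (Some l) \<omega>))"
      using nn by (simp add: ennreal_plus sum_nonneg sum_ennreal)
  qed
  also have "\<dots> = expect_nn \<Omega> (trunc_off k j None) + (\<Sum>l\<in>UNIV. expect_nn \<Omega> (trunc_off k j (Some l)))"
    using m by (subst nn_integral_add) (auto intro!: borel_measurable_sum simp: nn_integral_sum)
  finally show ?thesis .
qed

lemma total_error_le:
  assumes k: "k < N"
  shows "expect_nn \<Omega> (\<lambda>\<omega>. (Y_proj \<Phi>N N p \<alpha> I k (P k \<omega>) - Y_sim \<xi> C0 \<Phi>N N p (\<alpha>M \<omega>) I k (P k \<omega>))\<^sup>2)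
      + ennreal h * (\<Sum>j=k..<N. expect_nn \<Omega> (\<lambda>\<omega>. (norm (Z_proj p \<alpha> I j (P j \<omega>) - Z_sim \<xi> C0 h p
          (\<alpha>M \<omega>) I j (P j \<omega>)))\<^sup>2))
    \<le> 9 * (\<Sum>j=k..<N. expect_nn \<Omega> (\<lambda>\<omega>. (rho_norm C0 (p j) (P j \<omega>))\<^sup>2 * indicator (space \<Omega> - A k) \<omega>))
      + (\<Sum>j=k..<N. ennreal (Cc * h ^ (I - 1)) * ennreal (\<Sum>l\<in>UNIV. R j l) +
          ennreal (Cc / (h * real M)) * stat j)"
    (is "?Y + ennreal h * (\<Sum>j=k..<N. ?Z j) \<le> 9 * (\<Sum>j=k..<N. ?O j) + ?S")
proof -
  let ?t = "\<lambda>j l. expect_nn \<Omega> (trunc_off k j l)" and ?e = "\<lambda>j l. expect_nn \<Omega> (err k j l)"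
  have "?Y + ennreal h * (\<Sum>j=k..<N. ?Z j) \<le> (9 * ?t k None + ?e k None) +
      (\<Sum>j=k..<N. \<Sum>l\<in>UNIV. 9 * ?t j (Some l) + ennreal h * ?e j (Some l))"
    unfolding sum_distrib_left by (intro add_mono Y_error_le[OF k] sum_mono Z_error_le) auto
  also have "\<dots> = 9 * (?t k None + (\<Sum>j=k..<N. \<Sum>l\<in>UNIV. ?t j (Some l))) +
      (?e k None + (\<Sum>j=k..<N. \<Sum>l\<in>UNIV. ennreal h * ?e j (Some l)))"
    by (simp add: sum.distrib distrib_left sum_distrib_left add_ac)
  also have "\<dots> \<le> 9 * (\<Sum>j=k..<N. ?O j) + ?S"
  proof (intro add_mono mult_left_mono nn_err_sum_le[OF k])
    \<comment> \<open>On the left the Y-error occurs at time \<open>k\<close> only. The Y-levels at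
      later times are added to complete the squared norm of the whole vector of levels.\<close>
    have "?t k None \<le> (\<Sum>j=k..<N. ?t j None)"
      using k by (intro member_le_sum) auto
    then have "?t k None + (\<Sum>j=k..<N. \<Sum>l\<in>UNIV. ?t j (Some l)) \<le>
        (\<Sum>j=k..<N. ?t j None) + (\<Sum>j=k..<N. \<Sum>l\<in>UNIV. ?t j (Some l))"
      by (rule add_right_mono)
    also have "\<dots> = (\<Sum>j=k..<N. ?O j)"
      unfolding sum.distrib[symmetric] by (intro sum.cong refl nn_trunc_off[symmetric]) simp
    finally show "?t k None + (\<Sum>j=k..<N. \<Sum>l\<in>UNIV. ?t j (Some l)) \<le> (\<Sum>j=k..<N. ?O j)" .
  qed simp
  finally show ?thesis .
qed

end

theorem theorem3:
  fixes T Cf C\<Phi> :: real and I :: nat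
    and b :: "real \<Rightarrow> real^'d \<Rightarrow> real^'d"
    and \<sigma> :: "real \<Rightarrow> real^'d \<Rightarrow> real^'q^'d"
    and f :: "real \<Rightarrow> real^'d \<Rightarrow> real \<Rightarrow> real^'q \<Rightarrow> real"
    and \<Phi> :: "(real \<Rightarrow> real^'d) \<Rightarrow> real"
  assumes "T > 0"
    and "\<exists>L. L-lipschitz_on ({0..T} \<times> UNIV) (\<lambda>(t, x). b t x)"
    and "\<exists>L. L-lipschitz_on ({0..T} \<times> UNIV) (\<lambda>(t, x). \<sigma> t x)"
    and "\<And>t1 t2 x1 x2 y1 y2 z1 z2. t1 \<in> {0..T} \<Longrightarrow> t2 \<in> {0..T} \<Longrightarrow>
           \<bar>f t2 x2 y2 z2 - f t1 x1 y1 z1\<bar>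
             \<le> Cf * (sqrt \<bar>t2 - t1\<bar> + norm (x2 - x1) + \<bar>y2 - y1\<bar> + norm (z2 - z1))"
    and "\<And>s1 s2. continuous_on {0..T} s1 \<Longrightarrow> continuous_on {0..T} s2 \<Longrightarrow>
           \<bar>\<Phi> s1 - \<Phi> s2\<bar> \<le> C\<Phi> * (SUP t\<in>{0..T}. norm (s1 t - s2 t))"
    and "I \<ge> 3"
  shows "\<exists>h0>0. \<exists>C\<ge>0.
    \<forall>(\<Omega> :: 'w measure) (W :: real \<Rightarrow> 'w \<Rightarrow> real^'q) (S0 :: real^'d) (N :: nat) (h :: real)
     (e :: nat) (P :: nat \<Rightarrow> 'w \<Rightarrow> 'd state) (\<Phi>N :: 'd state \<Rightarrow> real)
     (p :: nat \<Rightarrow> 'q option \<Rightarrow> 'd state basis) (C0 :: real) (\<xi> :: real \<Rightarrow> real)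
     (M :: nat) (Ps :: nat \<Rightarrow> nat \<Rightarrow> 'w \<Rightarrow> 'd state) (dWs :: nat \<Rightarrow> nat \<Rightarrow> 'w \<Rightarrow> real^'q)
     (\<alpha> :: nat \<Rightarrow> nat \<Rightarrow> 'q coeffs) (\<alpha>M :: 'w \<Rightarrow> nat \<Rightarrow> nat \<Rightarrow> 'q coeffs).
      brownian_motion \<Omega> T W \<longrightarrow>
      N \<ge> 1 \<longrightarrow> h = T / real N \<longrightarrow> h \<le> h0 \<longrightarrow>
      markov_chain \<Omega> (state_space e) N P \<longrightarrow>
      (\<forall>k\<le>N. P k \<in> measurable (augmented_filtration \<Omega> W (real k * h)) (state_space e)) \<longrightarrow>
      (\<forall>k\<le>N. \<forall>\<omega>\<in>space \<Omega>. fst (P k \<omega>) = euler b \<sigma> S0 h (\<lambda>j. increment W h j \<omega>) k) \<longrightarrow>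
      \<Phi>N \<in> borel_measurable (state_space e) \<longrightarrow>
      integrable \<Omega> (\<lambda>\<omega>. (\<Phi>N (P N \<omega>))\<^sup>2) \<longrightarrow>
      (\<forall>k<N. \<forall>l. p k l \<noteq> [] \<and> set (p k l) \<subseteq> borel_measurable (state_space e) \<and>
         orthonormal_basis \<Omega> (P k) (p k l) \<and>
         integrable \<Omega> (\<lambda>\<omega>. (bnorm (p k l) (P k \<omega>)) ^ 4)) \<longrightarrow>
      projected_scheme \<Omega> f h N I W P \<Phi>N p \<alpha> \<longrightarrow>
      C0 > 0 \<longrightarrow>
      (\<forall>k<N. \<forall>i. AE \<omega> in \<Omega>.
         \<bar>Y_proj \<Phi>N N p \<alpha> i k (P k \<omega>)\<bar> \<le> rho C0 (p k None) (P k \<omega>) \<and>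
         (\<forall>l. sqrt h * \<bar>Z_proj p \<alpha> i k (P k \<omega>) $ l\<bar> \<le> rho C0 (p k (Some l)) (P k \<omega>))) \<longrightarrow>
      truncation_fun \<xi> \<longrightarrow>
      M \<ge> 1 \<longrightarrow>
      simulations \<Omega> T N e W P M Ps dWs \<longrightarrow>
      simulation_scheme \<Omega> f h N I \<Phi>N p \<xi> C0 M Ps dWs \<alpha>M \<longrightarrow>
      (\<forall>k<N.
        expect_nn \<Omega> (\<lambda>\<omega>. (Y_proj \<Phi>N N p \<alpha> I k (P k \<omega>) - Y_sim \<xi> C0 \<Phi>N N p (\<alpha>M \<omega>) I k (P k \<omega>))\<^sup>2)
        + ennreal h * (\<Sum>j=k..<N.
            expect_nn \<Omega> (\<lambda>\<omega>. (norm (Z_proj p \<alpha> I j (P j \<omega>) - Z_sim \<xi> C0 h p (\<alpha>M \<omega>) I j (P j \<omega>)))\<^sup>2))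
        \<le> 9 * (\<Sum>j=k..<N.
            expect_nn \<Omega> (\<lambda>\<omega>. (rho_norm C0 (p j) (P j \<omega>))\<^sup>2 *
                     indicator (space \<Omega> - good_event \<Omega> h N p M Ps dWs k) \<omega>))
        + ennreal (C * h ^ (I - 1)) * (\<Sum>j=k..<N.
            1 + ennreal ((norm S0)\<^sup>2) + expect_nn \<Omega> (\<lambda>\<omega>. (rho_norm C0 (p j) (P j \<omega>))\<^sup>2))
        + ennreal (C / (h * real M)) * (\<Sum>j=k..<N.
            (let v = (\<lambda>\<omega>. v_vec h (p j) (P j \<omega>) (increment W h j \<omega>));
                 J = v_index (p j);
                 R = (\<lambda>l. expect_nn \<Omega> (\<lambda>\<omega>. (rho C0 (p j l) (P j \<omega>))\<^sup>2))
             in expect_nn \<Omega> (\<lambda>\<omega>. (frob_norm J (\<lambda>r s. outer (v \<omega>) r s - id_mat r s))\<^sup>2)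
                  * expect_nn \<Omega> (\<lambda>\<omega>. (rho_norm C0 (p j) (P j \<omega>))\<^sup>2)
                + expect_nn \<Omega> (\<lambda>\<omega>. (L2_set (v \<omega>) J)\<^sup>2 * (p0_norm \<Phi>N N p (Suc j) (P (Suc j) \<omega>))\<^sup>2)
                  * R None
                + ennreal (h\<^sup>2) *
                  (\<integral>\<^sup>+\<omega>. ennreal ((L2_set (v \<omega>) J)\<^sup>2) *
                     (1 + ennreal ((norm (fst (P j \<omega>)))\<^sup>2)
                      + ennreal ((bnorm (p j None) (P j \<omega>))\<^sup>2) * R None
                      + ennreal (1 / h) *
                        (\<Sum>l\<in>UNIV. ennreal ((bnorm (p j (Some l)) (P j \<omega>))\<^sup>2) * R (Some l)))
                   \<partial>\<Omega>))))"
proof -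
  define L where "L = (8 * (4 * Cf\<^sup>2)) ^ (I - 1)"
  define K where "K = 4 * ((\<bar>f 0 0 0 0\<bar> + Cf * sqrt T)\<^sup>2 + Cf\<^sup>2)"
  \<comment> \<open>\<open>Cc\<close> written out: the constant has to be fixed before the
    probability space, the bases and \<open>C0\<close> are introduced, hence outside the
    locale.\<close>
  define C where "C = 2 * exp ((2 * (4 * (64 * (4 * Cf\<^sup>2) + 1) + 3 + 64 * L) + 6) * T) * (8 +
      32 * L) * (2 * (15 + 3 * K) + 1)"
  \<comment> \<open>The bound 1/8 serves the estimates of \<open>(1 - h)\<^sup>2\<close>, the other
    one yields \<open>64 * K * h \<le> 1\<close> for \<open>K = 4 * Cf\<^sup>2\<close>; the summand
    1 keeps the denominator positive when \<open>Cf = 0\<close>.\<close>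
  define h0 where "h0 = min (1/8) (1 / (64 * (4 * Cf\<^sup>2) + 1))"
  have c0: "0 < 64 * (4 * Cf\<^sup>2) + 1" by (simp add: add_nonneg_pos)
  have h0: "0 < h0" using c0 by (simp add: h0_def)
  have C: "0 \<le> C" by (simp add: C_def L_def K_def)
  show ?thesis
  proof (rule exI[of _ h0], rule conjI[OF h0], rule exI[of _ C], rule conjI[OF C],
      intro allI impI, goal_cases)
    case (1 \<Omega> W S0 N h e P \<Phi>N p C0 \<xi> M Ps dWs \<alpha> \<alpha>M k)
    note a = 1
    have hpos: "0 < h" using a(2,3) \<open>T > 0\<close> by simp
    have h8: "h \<le> 1/8" "h \<le> 1 / (64 * (4 * Cf\<^sup>2) + 1)" using a(4) by (simp_all add: h0_def)
    have hK: "64 * (4 * Cf\<^sup>2) * h \<le> 1"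
    proof -
      have "64 * (4 * Cf\<^sup>2) * h \<le> (64 * (4 * Cf\<^sup>2) + 1) * h" using hpos
          by (intro mult_right_mono) auto
      also have "\<dots> \<le> 1" using h8(2) c0 by (simp add: pos_le_divide_eq mult.commute)
      finally show ?thesis .
    qed
    interpret S: simulated_regression T Cf f I N e h C0 S0 b \<sigma> \<Omega> W P \<Phi>N p \<alpha> \<xi> M Ps dWs \<alpha>M
    proof unfold_locales
      show "0 < T" by (rule assms(1))
      show "\<bar>f t2 x2 y2 z2 - f t1 x1 y1 z1\<bar>
             \<le> Cf * (sqrt \<bar>t2 - t1\<bar> + norm (x2 - x1) + \<bar>y2 - y1\<bar> + norm (z2 - z1))"
        if "t1 \<in> {0..T}" "t2 \<in> {0..T}" for t1 t2 x1 x2 y1 y2 z1 z2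
        by (rule assms(4)[OF that])
      show "2 \<le> I" using \<open>I \<ge> 3\<close> by simp
      show "\<exists>L. L-lipschitz_on ({0..T} \<times> UNIV) (\<lambda>(t, x). b t x)" by (rule assms(2))
      show "\<exists>L. L-lipschitz_on ({0..T} \<times> UNIV) (\<lambda>(t, x). \<sigma> t x)" by (rule assms(3))
      show "P k \<in> measurable \<Omega> (state_space e)" if "k \<le> N" for k
        using a(5) that unfolding markov_chain_def by blast
      show "P k \<in> measurable (augmented_filtration \<Omega> W (real k * h)) (state_space e)" if "k \<le>
          N" for k
        using a(6) that by blast
      show "fst (P k \<omega>) = euler b \<sigma> S0 h (\<lambda>j. increment W h j \<omega>) k" if "k \<le> N" "\<omega> \<in> space \<Omega>" for k \<omega>
        using a(7) that by blast
      show "p k l \<noteq> []" "set (p k l) \<subseteq> borel_measurable (state_space e)"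
          "orthonormal_basis \<Omega> (P k) (p k l)"
        if "k < N" for k l using a(10) that by blast+
      show "AE \<omega> in \<Omega>. \<bar>Y_proj \<Phi>N N p \<alpha> i k (P k \<omega>)\<bar> \<le> rho C0 (p k None) (P k \<omega>) \<and>
         (\<forall>l. sqrt h * \<bar>Z_proj p \<alpha> i k (P k \<omega>) $ l\<bar> \<le>
             rho C0 (p k (Some l)) (P k \<omega>))" if "k < N" for k i
        using a(13) that by blast
      show "h \<le> 1" using h8 by simp
    qed (fact a h8 hK)+
    \<comment> \<open>The locale constant turns out to involve only \<open>T\<close>,
      \<open>Cf\<close>, \<open>f\<close> and \<open>I\<close>, so it agrees with the constant
      chosen in advance.\<close>
    have Cc: "S.Cc = C"
      unfolding S.Cc_def S.C1_def S.C2_def S.L_def S.Kf_def C_def L_def K_def ..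
    let ?B = "\<lambda>j. (let v = (\<lambda>\<omega>. v_vec h (p j) (P j \<omega>) (increment W h j \<omega>));
                 J = v_index (p j);
                 R = (\<lambda>l. expect_nn \<Omega> (\<lambda>\<omega>. (rho C0 (p j l) (P j \<omega>))\<^sup>2))
             in expect_nn \<Omega> (\<lambda>\<omega>. (frob_norm J (\<lambda>r s. outer (v \<omega>) r s - id_mat r s))\<^sup>2)
                  * expect_nn \<Omega> (\<lambda>\<omega>. (rho_norm C0 (p j) (P j \<omega>))\<^sup>2)
                + expect_nn \<Omega> (\<lambda>\<omega>. (L2_set (v \<omega>) J)\<^sup>2 * (p0_norm \<Phi>N N p (Suc j) (P (Suc j) \<omega>))\<^sup>2)
                  * R None
                + ennreal (h\<^sup>2) *
                  (\<integral>\<^sup>+\<omega>. ennreal ((L2_set (v \<omega>) J)\<^sup>2) *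
                     (1 + ennreal ((norm (fst (P j \<omega>)))\<^sup>2)
                      + ennreal ((bnorm (p j None) (P j \<omega>))\<^sup>2) * R None
                      + ennreal (1 / h) *
                        (\<Sum>l\<in>UNIV. ennreal ((bnorm (p j (Some l)) (P j \<omega>))\<^sup>2) * R (Some l)))
                   \<partial>\<Omega>))"
    have st: "?B j = S.stat j" if "j \<in> {k..<N}" for j
    proof -
      have j: "j < N" using that by simp
      show ?thesis
        unfolding Let_def S.stat_def S.Fr_def S.nn_rho[OF j] S.nn_rho_norm[OF j] ..
    qed
    have rho: "ennreal (\<Sum>l\<in>UNIV. S.R j l) \<le>
        1 + ennreal ((norm S0)\<^sup>2) + expect_nn \<Omega> (\<lambda>\<omega>. (rho_norm C0 (p j) (P j \<omega>))\<^sup>2)"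
      if "j \<in> {k..<N}" for j
      using that by (subst S.nn_rho_norm) (auto intro: add_increasing)
    have k: "k < N" by (rule a)
    show ?case
      unfolding add.assoc[of "9 * _"]
    proof (rule order_trans[OF S.total_error_le[OF k] add_left_mono])
      show "(\<Sum>j=k..<N. ennreal (S.Cc * h ^ (I - 1)) * ennreal (\<Sum>l\<in>UNIV. S.R j l) +
          ennreal (S.Cc / (h * real M)) * S.stat j) \<le>
        ennreal (C * h ^ (I - 1)) * (\<Sum>j=k..<N. 1 + ennreal ((norm S0)\<^sup>2) +
            expect_nn \<Omega> (\<lambda>\<omega>. (rho_norm C0 (p j) (P j \<omega>))\<^sup>2)) +
        ennreal (C / (h * real M)) * (\<Sum>j=k..<N. ?B j)"
        unfolding Cc sum_distrib_left[of "ennreal (C * h ^ (I - 1))"]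
          sum_distrib_left[of "ennreal (C / (h * real M))"] sum.distrib[symmetric]
        by (intro sum_mono add_mono mult_left_mono rho eq_refl[OF st[symmetric]]) simp_all
    qed
  qed
qed

end
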